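(* Let $a,b,c\in\mathbb{C}$ be algebraically independent over $\mathbb{Q}$ and such that the imaginary part of $\begin{bmatrix} a&b\\ b&c\end{bmatrix}$ is positive definite. Let $S=\mathbb{C}^2/\Lambda_S$ be the $(1,3)$-polarised abelian surface whose lattice $\Lambda_S$ is generated over $\mathbb{Z}$ by the columns of $$L_S=\begin{bmatrix} a & b & 1&0\\ b & c & 0&3\end{bmatrix},$$ and let $\hat S$ be its dual abelian surface, which is $\mathbb{C}^2$ modulo the lattice generated by the columns of $$L_{\hat S}=\begin{bmatrix} 3a & b & 3&0\\ b & \frac{c}{3} & 0&1\end{bmatrix}.$$ Let $A=S\times\hat S$, i.e. $A=\mathbb{C}^4/\Lambda_A$ with $\Lambda_A$ generated by the columns of $$L_A=\begin{bmatrix} a & b & 0&0&1&0&0&0\\ b & c & 0&0&0&3&0&0\\ 0 & 0 & 3a&b&0&0&3&0\\ 0 & 0 & b&\frac{c}{3}&0&0&0&1 \end{bmatrix}.$$ Then $A$ is isomorphic to its dual abelian variety $\hat A$, but $A$ does not admit a principal polarisation.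
   Context: All abelian varieties are over $\mathbb{C}$. A polarisation on an abelian variety $X$ of dimension $m$ is the Néron–Severi class of an ample line bundle $\mathcal{L}$; with $\varphi_{\mathcal{L}}:X\to\hat X=\mathrm{Pic}^0(X)$, $x\mapsto t_x^*\mathcal{L}\otimes\mathcal{L}^{-1}$ ($t_x$ translation by $x$), one has $\ker\varphi_{\mathcal{L}}\cong(\mathbb{Z}_{d_1}\times\cdots\times\mathbb{Z}_{d_m})^2$ with $d_i\mid d_{i+1}$, and $(d_1,\ldots,d_m)$ is the type of the polarisation. It is principal if the type is $(1,\ldots,1)$, i.e. $\varphi_{\mathcal{L}}$ is an isomorphism. "Isomorphic" means abstractly isomorphic as abelian varieties. The polarisation of type $(1,3)$ on $S$ is the one given by the Hermitian form with matrix $(\mathrm{Im}\,Z)^{-1}$, $Z=\begin{bmatrix} a&b\\ b&c\end{bmatrix}$, in the standard basis of $\mathbb{C}^2$. *)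

theory Defs
  imports "HOL-Analysis.Analysis" "HOL-Algebra.Coset"
begin

section \<open>Complex tori\<close>

text \<open>
  A complex torus is given by a lattice in \<open>\<complex>\<^sup>n\<close>, and is the quotient group of the
  additive group of \<open>\<complex>\<^sup>n\<close> by it; its points are cosets.
\<close>

definition column_lattice :: "complex^'m^'n \<Rightarrow> (complex^'n) set" where
  "column_lattice L = range (\<lambda>k :: int^'m. L *v (\<chi> j. of_int (k $ j)))"

definition vec_group :: "(complex^'n) monoid" where
  "vec_group = \<lparr>carrier = UNIV, mult = (+), one = 0\<rparr>"

definition torus :: "(complex^'n) set \<Rightarrow> (complex^'n) set monoid" where
  "torus \<Lambda> = vec_group Mod \<Lambda>"

definition torus_proj :: "(complex^'n) set \<Rightarrow> complex^'n \<Rightarrow> (complex^'n) set" where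
  "torus_proj \<Lambda> v = \<Lambda> #>\<^bsub>vec_group\<^esub> v"

text \<open>
  Several complex variables: holomorphic means Frechet differentiable over the reals with
  a complex-linear derivative.
\<close>

definition holo_on :: "(complex^'n) set \<Rightarrow> (complex^'n \<Rightarrow> complex) \<Rightarrow> bool" where
  "holo_on U f \<longleftrightarrow>
     (\<forall>v\<in>U. \<exists>D. (f has_derivative D) (at v) \<and> (\<forall>c w. D (c *s w) = c * D w))"

definition holo_torus_map ::
  "(complex^'n) set \<Rightarrow> (complex^'m) set \<Rightarrow> ((complex^'n) set \<Rightarrow> (complex^'m) set) \<Rightarrow> bool"
where
  "holo_torus_map \<Lambda> \<Gamma> f \<longleftrightarrow>
     (\<forall>v. \<exists>U g. open U \<and> v \<in> U \<and> (\<forall>i. holo_on U (\<lambda>u. g u $ i)) \<and>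
              (\<forall>u\<in>U. f (torus_proj \<Lambda> u) = torus_proj \<Gamma> (g u)))"

text \<open>
  Isomorphisms of abelian varieties are the biholomorphic group isomorphisms; between abelian
  varieties these are automatically algebraic, by Chow's theorem.
\<close>

definition torus_isos ::
  "(complex^'n) set \<Rightarrow> (complex^'m) set \<Rightarrow> ((complex^'n) set \<Rightarrow> (complex^'m) set) set"
where
  "torus_isos \<Lambda> \<Gamma> =
     {f \<in> iso (torus \<Lambda>) (torus \<Gamma>).
        holo_torus_map \<Lambda> \<Gamma> f \<and> holo_torus_map \<Gamma> \<Lambda> (inv_into (carrier (torus \<Lambda>)) f)}"

definition tori_isomorphic :: "(complex^'n) set \<Rightarrow> (complex^'m) set \<Rightarrow> bool" where
  "tori_isomorphic \<Lambda> \<Gamma> \<longleftrightarrow> torus_isos \<Lambda> \<Gamma> \<noteq> {}"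


section \<open>Line bundles\<close>

text \<open>
  Every holomorphic line bundle on \<open>\<complex>\<^sup>n\<close> is trivial, so a holomorphic line bundle on
  \<open>\<complex>\<^sup>n / \<Lambda>\<close> is the quotient of \<open>\<complex>\<^sup>n \<times> \<complex>\<close> by an action
  \<open>\<gamma> \<cdot> (v, t) = (v + \<gamma>, e \<gamma> v * t)\<close> of \<open>\<Lambda>\<close>.  We represent it by its factor of automorphy \<open>e\<close>,
  only the values at \<open>\<gamma> \<in> \<Lambda>\<close> being relevant.
\<close>

type_synonym 'n automorphy = "complex^'n \<Rightarrow> complex^'n \<Rightarrow> complex"

definition line_bundle :: "(complex^'n) set \<Rightarrow> 'n automorphy \<Rightarrow> bool" where
  "line_bundle \<Lambda> e \<longleftrightarrow>
     (\<forall>\<gamma>\<in>\<Lambda>. holo_on UNIV (e \<gamma>) \<and> (\<forall>v. e \<gamma> v \<noteq> 0)) \<and>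
     (\<forall>\<gamma>\<in>\<Lambda>. \<forall>\<delta>\<in>\<Lambda>. \<forall>v. e (\<gamma> + \<delta>) v = e \<gamma> (v + \<delta>) * e \<delta> v)"

definition bundle_iso :: "(complex^'n) set \<Rightarrow> 'n automorphy \<Rightarrow> 'n automorphy \<Rightarrow> bool" where
  "bundle_iso \<Lambda> e e' \<longleftrightarrow>
     (\<exists>g. holo_on UNIV g \<and> (\<forall>v. g v \<noteq> 0) \<and>
          (\<forall>\<gamma>\<in>\<Lambda>. \<forall>v. e' \<gamma> v * g v = g (v + \<gamma>) * e \<gamma> v))"

definition bundle_tensor :: "'n automorphy \<Rightarrow> 'n automorphy \<Rightarrow> 'n automorphy" where
  "bundle_tensor e e' = (\<lambda>\<gamma> v. e \<gamma> v * e' \<gamma> v)"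

definition bundle_dual :: "'n automorphy \<Rightarrow> 'n automorphy" where
  "bundle_dual e = (\<lambda>\<gamma> v. inverse (e \<gamma> v))"

definition bundle_power :: "'n automorphy \<Rightarrow> nat \<Rightarrow> 'n automorphy" where
  "bundle_power e k = (\<lambda>\<gamma> v. e \<gamma> v ^ k)"

definition bundle_translate :: "complex^'n \<Rightarrow> 'n automorphy \<Rightarrow> 'n automorphy" where
  "bundle_translate x e = (\<lambda>\<gamma> v. e \<gamma> (v + x))"

text \<open>Global sections, pulled back to \<open>\<complex>\<^sup>n\<close>.\<close>

definition sections :: "(complex^'n) set \<Rightarrow> 'n automorphy \<Rightarrow> (complex^'n \<Rightarrow> complex) set" where
  "sections \<Lambda> e =
     {\<theta>. holo_on UNIV \<theta> \<and> (\<forall>\<gamma>\<in>\<Lambda>. \<forall>v. \<theta> (v + \<gamma>) = e \<gamma> v * \<theta> v)}"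

text \<open>
  Some sections \<open>\<theta>\<^sub>0, \<dots>, \<theta>\<^sub>N\<close> define an embedding \<open>v \<mapsto> [\<theta>\<^sub>0 v : \<dots> : \<theta>\<^sub>N v]\<close> of the torus into
  projective space: they have no common zero, the map is injective, and it is an immersion (a
  tangent vector \<open>w\<close> at \<open>v\<close> is killed iff the derivative of \<open>(\<theta>\<^sub>0, \<dots>, \<theta>\<^sub>N)\<close> along \<open>w\<close> is a
  multiple of \<open>(\<theta>\<^sub>0 v, \<dots>, \<theta>\<^sub>N v)\<close>).  As the torus is compact, nothing else is required.
\<close>

definition very_ample :: "(complex^'n) set \<Rightarrow> 'n automorphy \<Rightarrow> bool" where
  "very_ample \<Lambda> e \<longleftrightarrow>
     (\<exists>(N::nat) \<theta>.
        (\<forall>i\<le>N. \<theta> i \<in> sections \<Lambda> e) \<and>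
        (\<forall>v. \<exists>i\<le>N. \<theta> i v \<noteq> 0) \<and>
        (\<forall>v v' c. (\<forall>i\<le>N. \<theta> i v' = c * \<theta> i v) \<longrightarrow> torus_proj \<Lambda> v' = torus_proj \<Lambda> v) \<and>
        (\<forall>v w c. (\<forall>i\<le>N. frechet_derivative (\<theta> i) (at v) w = c * \<theta> i v) \<longrightarrow> w = 0))"

definition ample :: "(complex^'n) set \<Rightarrow> 'n automorphy \<Rightarrow> bool" where
  "ample \<Lambda> e \<longleftrightarrow> line_bundle \<Lambda> e \<and> (\<exists>k\<ge>1. very_ample \<Lambda> (bundle_power e k))"


section \<open>The dual torus\<close>

text \<open>
  The dual of \<open>V / \<Lambda>\<close> (\<open>V = \<complex>\<^sup>n\<close>) is the quotient of the space of antilinear functionals \<open>l\<close> on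
  \<open>V\<close> by the lattice of all \<open>l\<close> with \<open>Im (l \<gamma>) \<in> \<int>\<close> for \<open>\<gamma> \<in> \<Lambda>\<close>.  It is \<open>Pic\<^sup>0 (V / \<Lambda>)\<close>: the class
  of \<open>l\<close> is the line bundle with constant factor of automorphy \<open>\<gamma> \<mapsto> exp (2\<pi>\<i> Im (l \<gamma>))\<close>.
  An antilinear functional is written \<open>v \<mapsto> \<Sum>i. w\<^sub>i * cnj v\<^sub>i\<close> with \<open>w \<in> \<complex>\<^sup>n\<close>; this identification
  with \<open>\<complex>\<^sup>n\<close> is complex-linear.
\<close>

definition anti_pairing :: "complex^'n \<Rightarrow> complex^'n \<Rightarrow> complex" where
  "anti_pairing w v = (\<Sum>i\<in>UNIV. w $ i * cnj (v $ i))"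

definition dual_lattice :: "(complex^'n) set \<Rightarrow> (complex^'n) set" where
  "dual_lattice \<Lambda> = {w. \<forall>\<gamma>\<in>\<Lambda>. Im (anti_pairing w \<gamma>) \<in> \<int>}"

definition pic0_bundle :: "complex^'n \<Rightarrow> 'n automorphy" where
  "pic0_bundle w = (\<lambda>\<gamma> v. exp (2 * of_real pi * \<i> * of_real (Im (anti_pairing w \<gamma>))))"


section \<open>Polarisations\<close>

text \<open>The Neron--Severi group is \<open>Pic / Pic\<^sup>0\<close>.\<close>

definition ns_class :: "(complex^'n) set \<Rightarrow> 'n automorphy \<Rightarrow> 'n automorphy set" where
  "ns_class \<Lambda> e =
     {e'. line_bundle \<Lambda> e' \<and>
          (\<exists>w. bundle_iso \<Lambda> (bundle_tensor e' (bundle_dual e)) (pic0_bundle w))}"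

definition polarisations :: "(complex^'n) set \<Rightarrow> 'n automorphy set set" where
  "polarisations \<Lambda> = {ns_class \<Lambda> e | e. ample \<Lambda> e}"

text \<open>
  \<open>is_phi \<Lambda> e \<phi>\<close>: \<open>\<phi>\<close> is the map \<open>x \<mapsto> t\<^sub>x\<^sup>* L \<otimes> L\<^sup>-\<^sup>1\<close> from the torus to its dual, for \<open>L\<close> with
  factor of automorphy \<open>e\<close>.
\<close>

definition is_phi ::
  "(complex^'n) set \<Rightarrow> 'n automorphy \<Rightarrow> ((complex^'n) set \<Rightarrow> (complex^'n) set) \<Rightarrow> bool"
where
  "is_phi \<Lambda> e \<phi> \<longleftrightarrow>
     (\<forall>x. \<exists>w. \<phi> (torus_proj \<Lambda> x) = torus_proj (dual_lattice \<Lambda>) w \<and>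
              bundle_iso \<Lambda> (bundle_tensor (bundle_translate x e) (bundle_dual e)) (pic0_bundle w))"

text \<open>The map \<open>\<phi>\<close> depends only on the Neron--Severi class.\<close>

definition principal :: "(complex^'n) set \<Rightarrow> 'n automorphy set \<Rightarrow> bool" where
  "principal \<Lambda> C \<longleftrightarrow> (\<exists>e\<in>C. \<exists>\<phi>. is_phi \<Lambda> e \<phi> \<and> \<phi> \<in> torus_isos \<Lambda> (dual_lattice \<Lambda>))"

definition admits_principal_polarisation :: "(complex^'n) set \<Rightarrow> bool" where
  "admits_principal_polarisation \<Lambda> \<longleftrightarrow> (\<exists>C\<in>polarisations \<Lambda>. principal \<Lambda> C)"


section \<open>The hypotheses and the tori\<close>

text \<open>
  A polynomial in three variables over the rationals is a finitely supported family \<open>p\<close> of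
  coefficients.
\<close>

definition alg_independent3 :: "complex \<Rightarrow> complex \<Rightarrow> complex \<Rightarrow> bool" where
  "alg_independent3 a b c \<longleftrightarrow>
     (\<forall>p :: nat \<times> nat \<times> nat \<Rightarrow> rat.
        finite {m. p m \<noteq> 0} \<longrightarrow>
        (\<Sum>(i, j, k)\<in>{m. p m \<noteq> 0}. of_rat (p (i, j, k)) * a ^ i * b ^ j * c ^ k) = 0 \<longrightarrow>
        (\<forall>m. p m = 0))"

definition pos_def_matrix :: "real^'n^'n \<Rightarrow> bool" where
  "pos_def_matrix M \<longleftrightarrow> transpose M = M \<and> (\<forall>x. x \<noteq> 0 \<longrightarrow> 0 < x \<bullet> (M *v x))"

definition matrix_Z :: "complex \<Rightarrow> complex \<Rightarrow> complex \<Rightarrow> complex^2^2" where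
  "matrix_Z a b c = vector [vector [a, b], vector [b, c]]"

definition matrix_S :: "complex \<Rightarrow> complex \<Rightarrow> complex \<Rightarrow> complex^4^2" where
  "matrix_S a b c = vector
     [vector [a, b, 1, 0],
      vector [b, c, 0, 3]]"

definition matrix_S_dual :: "complex \<Rightarrow> complex \<Rightarrow> complex \<Rightarrow> complex^4^2" where
  "matrix_S_dual a b c = vector
     [vector [3 * a, b, 3, 0],
      vector [b, c / 3, 0, 1]]"

definition matrix_A :: "complex \<Rightarrow> complex \<Rightarrow> complex \<Rightarrow> complex^8^4" where
  "matrix_A a b c = vector
     [vector [a, b, 0,     0,     1, 0, 0, 0],
      vector [b, c, 0,     0,     0, 3, 0, 0],
      vector [0, 0, 3 * a, b,     0, 0, 3, 0],
      vector [0, 0, b,     c / 3, 0, 0, 0, 1]]"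


section \<open>The relations between the tori\<close>

lemma sum_8: "sum f (UNIV :: 8 set) = f 1 + f 2 + f 3 + f 4 + f 5 + f 6 + f 7 + f 8"
proof -
  have ex: "x = 1 \<or> x = 2 \<or> x = 3 \<or> x = 4 \<or> x = 5 \<or> x = 6 \<or> x = 7 \<or> x = 8" for x :: 8
  proof (induct x)
    case (of_int z)
    then have "0 \<le> z" "z < 8" by simp_all
    then have "z = 0 \<or> z = 1 \<or> z = 2 \<or> z = 3 \<or> z = 4 \<or> z = 5 \<or> z = 6 \<or> z = 7" by arith
    then show ?case by auto
  qed
  then have U: "(UNIV :: 8 set) = {1, 2, 3, 4, 5, 6, 7, 8}" by auto
  show ?thesis unfolding U by (simp add: ac_simps)
qed

lemma vector_4':
  "(vector [x1,x2,x3,x4] :: 'a::zero^4) $ 1 = x1" "(vector [x1,x2,x3,x4] :: 'a^4) $ 2 = x2"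
  "(vector [x1,x2,x3,x4] :: 'a^4) $ 3 = x3" "(vector [x1,x2,x3,x4] :: 'a^4) $ 4 = x4"
  unfolding vector_def by simp_all

lemma vector_8':
  "(vector [x1,x2,x3,x4,x5,x6,x7,x8] :: 'a::zero^8) $ 1 = x1"
  "(vector [x1,x2,x3,x4,x5,x6,x7,x8] :: 'a^8) $ 2 = x2"
  "(vector [x1,x2,x3,x4,x5,x6,x7,x8] :: 'a^8) $ 3 = x3"
  "(vector [x1,x2,x3,x4,x5,x6,x7,x8] :: 'a^8) $ 4 = x4"
  "(vector [x1,x2,x3,x4,x5,x6,x7,x8] :: 'a^8) $ 5 = x5"
  "(vector [x1,x2,x3,x4,x5,x6,x7,x8] :: 'a^8) $ 6 = x6"
  "(vector [x1,x2,x3,x4,x5,x6,x7,x8] :: 'a^8) $ 7 = x7"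
  "(vector [x1,x2,x3,x4,x5,x6,x7,x8] :: 'a^8) $ 8 = x8"
  unfolding vector_def by simp_all

lemma ex_int_vec4: "(\<exists>k :: int^4. P (k $ 1) (k $ 2) (k $ 3) (k $ 4)) \<longleftrightarrow> (\<exists>p q r s. P p q r s)"
proof
  assume "\<exists>p q r s. P p q r s"
  then obtain p q r s where "P p q r s" by blast
  then show "\<exists>k :: int^4. P (k $ 1) (k $ 2) (k $ 3) (k $ 4)"
    by (intro exI[of _ "vector [p, q, r, s]"]) (simp add: vector_4')
qed blast

lemma ex_int_vec8:
  "(\<exists>k :: int^8. P (k $ 1) (k $ 2) (k $ 3) (k $ 4) (k $ 5) (k $ 6) (k $ 7) (k $ 8)) \<longleftrightarrow>
   (\<exists>p q r s t u v w. P p q r s t u v w)"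
proof
  assume "\<exists>p q r s t u v w. P p q r s t u v w"
  then obtain p q r s t u v w where "P p q r s t u v w" by blast
  then show "\<exists>k :: int^8. P (k $ 1) (k $ 2) (k $ 3) (k $ 4) (k $ 5) (k $ 6) (k $ 7) (k $ 8)"
    by (intro exI[of _ "vector [p, q, r, s, t, u, v, w]"]) (simp add: vector_8')
qed blast

lemma mem_lattice_S:
  "v \<in> column_lattice (matrix_S a b c) \<longleftrightarrow>
     (\<exists>p q r s :: int. v $ 1 = a * of_int p + b * of_int q + of_int r \<and>
                      v $ 2 = b * of_int p + c * of_int q + 3 * of_int s)"
  unfolding ex_int_vec4[symmetric]
  by (simp add: column_lattice_def image_iff vec_eq_iff forall_2 matrix_vector_mult_def
        matrix_S_def sum_4 vector_4')

lemma mem_lattice_S_dual: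
  "v \<in> column_lattice (matrix_S_dual a b c) \<longleftrightarrow>
     (\<exists>p q r s :: int. v $ 1 = 3 * a * of_int p + b * of_int q + 3 * of_int r \<and>
                      v $ 2 = b * of_int p + c / 3 * of_int q + of_int s)"
  unfolding ex_int_vec4[symmetric]
  by (simp add: column_lattice_def image_iff vec_eq_iff forall_2 matrix_vector_mult_def
        matrix_S_dual_def sum_4 vector_4')

lemma mem_lattice_A:
  "v \<in> column_lattice (matrix_A a b c) \<longleftrightarrow>
     (\<exists>p q p' q' r s r' s' :: int.
        v $ 1 = a * of_int p + b * of_int q + of_int r \<and>
        v $ 2 = b * of_int p + c * of_int q + 3 * of_int s \<and>
        v $ 3 = 3 * a * of_int p' + b * of_int q' + 3 * of_int r' \<and>
        v $ 4 = b * of_int p' + c / 3 * of_int q' + of_int s')"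
  unfolding ex_int_vec8[symmetric]
  by (simp add: column_lattice_def image_iff vec_eq_iff forall_4 matrix_vector_mult_def
        matrix_A_def sum_8 vector_4' vector_8')

lemma lattice_A_product:
  "column_lattice (matrix_A a b c) =
     {v. vector [v $ 1, v $ 2] \<in> column_lattice (matrix_S a b c) \<and>
         vector [v $ 3, v $ 4] \<in> column_lattice (matrix_S_dual a b c)}"
  unfolding set_eq_iff mem_Collect_eq mem_lattice_A mem_lattice_S mem_lattice_S_dual vector_2
  by blast

lemma torus_proj_eq: "torus_proj \<Lambda> v = (\<lambda>l. l + v) ` \<Lambda>"
  by (auto simp: torus_proj_def vec_group_def r_coset_def)

lemma carrier_torus: "carrier (torus \<Lambda>) = range (torus_proj \<Lambda>)"
  by (auto simp: torus_def FactGroup_def RCOSETS_def torus_proj_def vec_group_def)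

lemma holo_on_linear:
  assumes "\<And>x y. f (x + y) = f x + f y" and "\<And>k w. f (k *s w) = k * f w"
  shows "holo_on U (f :: complex^'n \<Rightarrow> complex)"
proof -
  have "linear f"
  proof (rule linearI)
    fix r :: real and x :: "complex^'n"
    have "r *\<^sub>R x = complex_of_real r *s x" by (simp add: vec_eq_iff scaleR_conv_of_real[where 'a=complex])
    then show "f (r *\<^sub>R x) = r *\<^sub>R f x" using assms(2) by (simp add: scaleR_conv_of_real)
  qed (rule assms(1))
  then have "(f has_derivative f) (at v)" for v
    using linear_conv_bounded_linear bounded_linear_imp_has_derivative by blast
  then show ?thesis unfolding holo_on_def using assms(2) by blast
qed

lemma tori_isomorphic_linear:
  fixes M :: "complex^'n^'n" and M' :: "complex^'n^'n"
  assumes inv: "M ** M' = mat 1" "M' ** M = mat 1" and im: "(*v) M ` \<Lambda> = \<Gamma>"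
  shows "tori_isomorphic \<Lambda> \<Gamma>"
proof -
  define f where "f = (\<lambda>X. (*v) M ` X)"
  have i1: "M *v (M' *v x) = x" and i2: "M' *v (M *v x) = x" for x
    by (simp_all add: matrix_vector_mul_assoc inv)
  have fp: "f (torus_proj \<Lambda> v) = torus_proj \<Gamma> (M *v v)" for v
    by (auto simp: f_def torus_proj_eq im[symmetric] image_image matrix_vector_right_distrib)
  have inj: "inj f"
    unfolding f_def by (metis i2 injI inj_image_eq_iff)
  have surj: "f ` carrier (torus \<Lambda>) = carrier (torus \<Gamma>)"
    by (auto simp: carrier_torus fp image_image) (metis fp i1 rangeI)
  have hom: "f \<in> hom (torus \<Lambda>) (torus \<Gamma>)"
  proof (rule homI)
    fix X assume "X \<in> carrier (torus \<Lambda>)"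
    then show "f X \<in> carrier (torus \<Gamma>)" using surj by blast
  next
    fix X Y
    show "f (X \<otimes>\<^bsub>torus \<Lambda>\<^esub> Y) = f X \<otimes>\<^bsub>torus \<Gamma>\<^esub> f Y"
      by (auto simp: f_def torus_def FactGroup_def set_mult_def vec_group_def image_iff
          matrix_vector_right_distrib) (blast | metis matrix_vector_right_distrib)+
  qed
  have lin: "holo_on U (\<lambda>u. (N *v u) $ i)" for U i and N :: "complex^'n^'n"
    by (rule holo_on_linear)
      (auto simp: matrix_vector_right_distrib vector_scalar_commute)
  have "bij_betw f (carrier (torus \<Lambda>)) (carrier (torus \<Gamma>))"
    using inj surj by (auto simp: bij_betw_def intro: inj_on_subset)
  moreover have "holo_torus_map \<Lambda> \<Gamma> f"
    unfolding holo_torus_map_def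
    by (intro allI exI[of _ UNIV] exI[of _ "(*v) M"]) (auto simp: lin fp)
  moreover have "inv_into (carrier (torus \<Lambda>)) f (torus_proj \<Gamma> u) = torus_proj \<Lambda> (M' *v u)" for u
    by (rule inv_into_f_eq) (use inj in \<open>auto simp: carrier_torus fp i1 intro: inj_on_subset\<close>)
  then have "holo_torus_map \<Gamma> \<Lambda> (inv_into (carrier (torus \<Lambda>)) f)"
    unfolding holo_torus_map_def
    by (intro allI exI[of _ UNIV] exI[of _ "(*v) M'"]) (auto simp: lin)
  ultimately have "f \<in> torus_isos \<Lambda> \<Gamma>"
    using hom by (auto simp: torus_isos_def iso_def)
  then show ?thesis by (auto simp: tori_isomorphic_def)
qed


lemma mem_dual_lattice_S:
  "w \<in> dual_lattice (column_lattice (matrix_S a b c)) \<longleftrightarrow>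
     Im (w $ 1) \<in> \<int> \<and> 3 * Im (w $ 2) \<in> \<int> \<and>
     Im (w $ 1 * cnj a + w $ 2 * cnj b) \<in> \<int> \<and> Im (w $ 1 * cnj b + w $ 2 * cnj c) \<in> \<int>"
  (is "?l \<longleftrightarrow> ?r")
proof
  assume l: ?l
  have "Im (w $ 1 * cnj (a * of_int p + b * of_int q + of_int r) +
            w $ 2 * cnj (b * of_int p + c * of_int q + 3 * of_int s)) \<in> \<int>" for p q r s
  proof -
    have "vector [a * of_int p + b * of_int q + of_int r, b * of_int p + c * of_int q + 3 * of_int s]
        \<in> column_lattice (matrix_S a b c)"
      by (auto simp: mem_lattice_S)
    with l have "Im (anti_pairing w (vector [a * of_int p + b * of_int q + of_int r,
        b * of_int p + c * of_int q + 3 * of_int s])) \<in> \<int>"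
      unfolding dual_lattice_def by blast
    then show ?thesis by (simp only: anti_pairing_def sum_2 vector_2)
  qed
  from this[of 0 0 1 0] this[of 0 0 0 1] this[of 1 0 0 0] this[of 0 1 0 0]
  show ?r by (simp add: mult.commute)
next
  assume r: ?r
  show ?l unfolding dual_lattice_def
  proof (intro CollectI ballI)
    fix v assume "v \<in> column_lattice (matrix_S a b c)"
    then obtain p q r s :: int where
      v: "v $ 1 = a * of_int p + b * of_int q + of_int r"
         "v $ 2 = b * of_int p + c * of_int q + 3 * of_int s"
      by (auto simp: mem_lattice_S)
    have "Im (anti_pairing w v) =
        of_int p * Im (w $ 1 * cnj a + w $ 2 * cnj b) + of_int q * Im (w $ 1 * cnj b + w $ 2 * cnj c)
        + of_int r * Im (w $ 1) + of_int s * (3 * Im (w $ 2))"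
      by (simp add: anti_pairing_def sum_2 v algebra_simps)
    with r show "Im (anti_pairing w v) \<in> \<int>" by (metis Ints_add Ints_mult Ints_of_int)
  qed
qed

text \<open>The torus with lattice \<open>column_lattice (matrix_S_dual a b c)\<close> is the dual of \<open>S\<close>.\<close>

lemma S_dual_isomorphic:
  assumes pd: "pos_def_matrix (map_matrix Im (matrix_Z a b c))"
  shows "tori_isomorphic (dual_lattice (column_lattice (matrix_S a b c)))
           (column_lattice (matrix_S_dual a b c))"
proof -
  define d where "d = Im a * Im c - Im b * Im b"
  have pos: "0 < x \<bullet> (map_matrix Im (matrix_Z a b c) *v x)" if "x \<noteq> 0" for x
    using pd that by (simp add: pos_def_matrix_def)
  have a: "Im a > 0"
    using pos[of "vector [1, 0]"]
    by (simp add: vec_eq_iff forall_2 inner_vec_def sum_2 matrix_vector_mult_def matrix_Z_def)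
  have "0 < Im a * d"
    using pos[of "vector [- Im b, Im a]"] a
    by (simp add: vec_eq_iff forall_2 inner_vec_def sum_2 matrix_vector_mult_def matrix_Z_def
        d_def algebra_simps)
  with a have d: "d \<noteq> 0" by auto
  define y where "y = complex_of_real (Im a)"
  define z where "z = complex_of_real (Im b)"
  define u where "u = complex_of_real (Im c)"
  define D where "D = complex_of_real d"
  have D: "D \<noteq> 0" using d by (simp add: D_def)
  have D': "D = y * u - z * z" by (simp add: D_def d_def y_def z_def u_def)
  define M :: "complex^2^2" where "M = vector [vector [3 * y, 3 * z], vector [z, u]]"
  define M' :: "complex^2^2" where
    "M' = vector [vector [u / (3 * D), - z / D], vector [- z / (3 * D), y / D]]"
  have MM: "M ** M' = mat 1" "M' ** M = mat 1"
    using D by (simp_all add: vec_eq_iff forall_2 matrix_matrix_mult_def sum_2 M_def M'_def mat_def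
      field_simps) (simp_all add: D' algebra_simps)
  have M: "(M *v w) $ 1 = 3 * (y * w $ 1 + z * w $ 2)" "(M *v w) $ 2 = z * w $ 1 + u * w $ 2" for w
    by (simp_all add: M_def matrix_vector_mult_def sum_2 algebra_simps)
  have key: "w \<in> dual_lattice (column_lattice (matrix_S a b c)) \<longleftrightarrow>
        M *v w \<in> column_lattice (matrix_S_dual a b c)" for w
  proof
    assume "w \<in> dual_lattice (column_lattice (matrix_S a b c))"
    then obtain p q r s :: int where *: "Im (w $ 1) = of_int p" "3 * Im (w $ 2) = of_int q"
      "Im (w $ 1 * cnj a + w $ 2 * cnj b) = of_int r"
      "Im (w $ 1 * cnj b + w $ 2 * cnj c) = of_int s"
      unfolding mem_dual_lattice_S by (auto elim!: Ints_cases)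
    have q: "Im (w $ 2) = of_int q / 3" using *(2) by simp
    have r: "Re (w $ 1) * Im a + Re (w $ 2) * Im b = of_int p * Re a + of_int q / 3 * Re b - of_int r"
      using *(3) by (simp add: *(1) q)
    have s: "Re (w $ 1) * Im b + Re (w $ 2) * Im c = of_int p * Re b + of_int q / 3 * Re c - of_int s"
      using *(4) by (simp add: *(1) q)
    show "M *v w \<in> column_lattice (matrix_S_dual a b c)"
      unfolding mem_lattice_S_dual
      by (rule exI[of _ p], rule exI[of _ q], rule exI[of _ "- r"], rule exI[of _ "- s"])
        (use r s in \<open>simp add: M complex_eq_iff y_def z_def u_def *(1) q algebra_simps\<close>)
  next
    assume "M *v w \<in> column_lattice (matrix_S_dual a b c)"
    then obtain p q r s :: int where
      "3 * (y * w $ 1 + z * w $ 2) = 3 * a * of_int p + b * of_int q + 3 * of_int r"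
      "z * w $ 1 + u * w $ 2 = b * of_int p + c / 3 * of_int q + of_int s"
      unfolding mem_lattice_S_dual M by auto
    then have *: "3 * (Im a * Im (w $ 1) + Im b * Im (w $ 2)) = 3 * Im a * of_int p + Im b * of_int q"
      "Im b * Im (w $ 1) + Im c * Im (w $ 2) = Im b * of_int p + Im c / 3 * of_int q"
      "3 * (Im a * Re (w $ 1) + Im b * Re (w $ 2)) = 3 * Re a * of_int p + Re b * of_int q + 3 * of_int r"
      "Im b * Re (w $ 1) + Im c * Re (w $ 2) = Re b * of_int p + Re c / 3 * of_int q + of_int s"
      by (simp_all add: complex_eq_iff y_def z_def u_def)
    define e where "e = Im (w $ 1) - of_int p"
    define f where "f = Im (w $ 2) - of_int q / 3"
    have ef: "Im a * e + Im b * f = 0" "Im b * e + Im c * f = 0"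
      using *(1,2) by (simp_all add: e_def f_def algebra_simps)
    have de: "d * e = Im c * (Im a * e + Im b * f) - Im b * (Im b * e + Im c * f)"
      "d * f = Im a * (Im b * e + Im c * f) - Im b * (Im a * e + Im b * f)"
      by (simp_all add: d_def algebra_simps)
    have "e = 0" "f = 0" using de[unfolded ef] d by simp_all
    then have w: "Im (w $ 1) = of_int p" "Im (w $ 2) = of_int q / 3" by (simp_all add: e_def f_def)
    have "Im (w $ 1 * cnj a + w $ 2 * cnj b) = of_int (- r)"
      "Im (w $ 1 * cnj b + w $ 2 * cnj c) = of_int (- s)"
      using *(3,4) by (simp_all add: w algebra_simps)
    then show "w \<in> dual_lattice (column_lattice (matrix_S a b c))"
      unfolding mem_dual_lattice_S by (simp only: w Ints_of_int) simp
  qed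
  have "(*v) M ` dual_lattice (column_lattice (matrix_S a b c)) = column_lattice (matrix_S_dual a b c)"
  proof (rule Set.set_eqI)
    fix v
    have "M *v (M' *v v) = v" by (simp add: matrix_vector_mul_assoc MM)
    then show "v \<in> (*v) M ` dual_lattice (column_lattice (matrix_S a b c)) \<longleftrightarrow>
        v \<in> column_lattice (matrix_S_dual a b c)"
      using key by (metis (no_types, lifting) image_iff)
  qed
  with MM show ?thesis by (rule tori_isomorphic_linear)
qed

end

theory Submission
  imports Defs "HOL-Complex_Analysis.Cauchy_Integral_Formula"
begin

text \<open>
  In the coordinates \<open>v\<^sub>1\<close>, \<open>v\<^sub>2\<close> on \<open>S\<close> and \<open>v\<^sub>3 / 3\<close>, \<open>v\<^sub>4\<close> on its dual, both lattices span
  \<open>Z \<rat>\<^sup>2 + \<rat>\<^sup>2\<close> over \<open>\<rat>\<close>, and the dual of \<open>A\<close> is \<open>A\<close> with its two factors exchanged.  By algebraic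
  independence, homomorphisms between the factors are rational scalars, so a polarisation
  is given by integers \<open>X, Y, Y', T\<close> with \<open>3 dvd T\<close>.  The form \<open>Im (F \<gamma>, \<delta>)\<close> attached to
  \<open>\<phi>\<^sub>L\<close>, with analytic representation \<open>F\<close>, is the Chern class of the line bundle; hence it is
  alternating, which gives \<open>Y = Y'\<close>, and it is semipositive, which gives \<open>X T - Y\<^sup>2 \<ge> 0\<close>.
  If \<open>\<phi>\<^sub>L\<close> is an isomorphism then \<open>X T - Y\<^sup>2 = 1\<close>, which is impossible modulo \<open>3\<close>.

  Semipositivity needs no normal form for factors of automorphy: the function
  \<open>log (\<Sum>i. |\<theta>\<^sub>i|\<^sup>2)\<close> built from sections without common zeros is smooth with periodic, nonnegative
  Levi form, and integrating the Levi form over the parallelogram of two lattice vectors close to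
  \<open>n \<gamma>\<close> and \<open>\<i> n \<gamma>\<close> gives the Chern class up to an error linear in \<open>n\<close>.
\<close>

section \<open>Entire functions of several variables\<close>

text \<open>Bijectivity on the lattice alone gives \<open>X * T - Y\<^sup>2\<close> = 1 or -1, and
  -1 does occur: the isomorphism of \<open>A\<close> with its dual that exchanges the factors has
  \<open>X = T = 0\<close> and \<open>Y = Y' = 1\<close>. Its form is even alternating, so symmetry
  cannot exclude it; only the indefiniteness of its Hermitian form does. This is why ampleness has
  to enter through an inequality, and why semipositivity takes so much of the work. The number 3
  enters through the polarisation type: in the chosen coordinates the lattice of the dual of
  \<open>S\<close> contains \<open>(0, 1)\<close>, which a scalar \<open>T\<close> sends to
  \<open>(0, T)\<close>, while constant terms in the second coordinate of \<open>S\<close> are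
  multiples of 3. A second obstacle is that \<open>\<phi>\<close> is known only through the
  existence of isomorphisms of bundles, which determine a character modulo integers. Division points
  of lattice vectors remove this ambiguity.\<close>

abbreviation (input) dderiv :: "(complex^'n \<Rightarrow> complex) \<Rightarrow> complex^'n \<Rightarrow> complex^'n \<Rightarrow> complex" where
  "dderiv f v \<equiv> frechet_derivative f (at v)"

lemma holo_on_has_derivative:
  assumes "holo_on UNIV f"
  shows "(f has_derivative dderiv f v) (at v)"
  using assms unfolding holo_on_def by (metis UNIV_I frechet_derivative_at)

lemma dderiv_scale:
  assumes "holo_on UNIV f"
  shows "dderiv f v (c *s w) = c * dderiv f v w"
  using assms unfolding holo_on_def by (metis UNIV_I frechet_derivative_at)

lemma dderiv_add:
  assumes "holo_on UNIV f"
  shows "dderiv f v (w + w') = dderiv f v w + dderiv f v w'"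
  using has_derivative_linear[OF holo_on_has_derivative[OF assms, of v]] linear_add by blast

lemma holo_on_has_derivativeI:
  assumes "\<And>v. (f has_derivative D v) (at v)" "\<And>v c w. D v (c *s w) = c * D v w"
  shows "holo_on UNIV f"
  using assms unfolding holo_on_def by blast

lemma dderiv_eq:
  assumes "(f has_derivative D) (at v)"
  shows "dderiv f v = D"
  using assms by (metis frechet_derivative_at)

lemma holo_on_continuous: "holo_on UNIV f \<Longrightarrow> continuous_on S f"
  by (metis continuous_at_imp_continuous_on has_derivative_continuous holo_on_has_derivative)

lemma holo_on_const: "holo_on UNIV (\<lambda>v. c)"
  by (rule holo_on_has_derivativeI[where D = "\<lambda>v w. 0"]) auto

lemma holo_on_mult:
  assumes "holo_on UNIV f" "holo_on UNIV g"
  shows "holo_on UNIV (\<lambda>v. f v * g v)"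
  by (rule holo_on_has_derivativeI[OF has_derivative_mult[OF holo_on_has_derivative[OF assms(1)]
          holo_on_has_derivative[OF assms(2)]]])
     (simp add: dderiv_scale assms algebra_simps)

lemma holo_on_compose_field:
  assumes "holo_on UNIV f" "\<And>v. (h has_field_derivative h' (f v)) (at (f v))"
  shows "holo_on UNIV (\<lambda>v. h (f v))"
  by (rule holo_on_has_derivativeI[OF has_derivative_compose[OF holo_on_has_derivative[OF assms(1)]
        assms(2)[unfolded has_field_derivative_def]]])
     (simp add: dderiv_scale assms algebra_simps)

lemma holo_on_inverse:
  assumes "holo_on UNIV f" "\<And>v. f v \<noteq> 0"
  shows "holo_on UNIV (\<lambda>v. inverse (f v))"
  by (rule holo_on_compose_field[OF assms(1) DERIV_inverse]) (rule assms(2))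

lemma holo_on_divide:
  assumes "holo_on UNIV f" "holo_on UNIV g" "\<And>v. g v \<noteq> 0"
  shows "holo_on UNIV (\<lambda>v. f v / g v)"
  unfolding divide_inverse by (intro holo_on_mult holo_on_inverse assms)

lemma holo_on_prod:
  assumes "\<And>i. i \<in> I \<Longrightarrow> holo_on UNIV (f i)"
  shows "holo_on UNIV (\<lambda>v. \<Prod>i\<in>I. f i v)"
  using assms
  by (induction I rule: infinite_finite_induct) (simp_all add: holo_on_const holo_on_mult)

lemma has_derivative_shift:
  fixes f :: "'a::real_normed_vector \<Rightarrow> 'b::real_normed_vector"
  assumes "(f has_derivative D) (at (v + x))"
  shows "((\<lambda>u. f (u + x)) has_derivative D) (at v)"
proof -
  have "((\<lambda>u. u + x) has_derivative (\<lambda>h. h)) (at v)"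
    by (auto intro!: derivative_eq_intros)
  from has_derivative_compose[OF this assms] show ?thesis .
qed

lemma holo_on_shift:
  assumes "holo_on UNIV f"
  shows "holo_on UNIV (\<lambda>v. f (v + x))"
  by (rule holo_on_has_derivativeI[OF has_derivative_shift[OF holo_on_has_derivative[OF assms]]])
     (rule dderiv_scale[OF assms])

lemma scaleR_vec_complex: "r *\<^sub>R (x :: complex^'n) = complex_of_real r *s x"
  by (simp add: vec_eq_iff scaleR_conv_of_real[where 'a=complex])

lemma norm_smult_vec: "norm (c *s (x :: complex^'n)) = cmod c * norm x"
  by (simp add: norm_vec_def norm_mult L2_set_right_distrib)

lemma bounded_linear_smult_left: "bounded_linear (\<lambda>z. z *s (w :: complex^'n))"
  by (rule bounded_linear_intro[where K = "norm w"])
     (simp_all add: vec_eq_iff algebra_simps norm_smult_vec)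

lemma bounded_bilinear_smult: "bounded_bilinear (\<lambda>z (w :: complex^'n). z *s w)"
  by (rule bounded_bilinear.intro)
     (auto simp: vec_eq_iff algebra_simps norm_smult_vec intro!: exI[of _ 1])

lemmas continuous_on_smult [continuous_intros] =
  bounded_bilinear.continuous_on[OF bounded_bilinear_smult]

lemma holo_on_line:
  assumes "holo_on UNIV f"
  shows "((\<lambda>z. f (v + z *s w)) has_field_derivative dderiv f (v + z *s w) w) (at z)"
proof -
  have "((\<lambda>z. v + z *s w) has_derivative (\<lambda>h. h *s w)) (at z)"
    using has_derivative_add[OF has_derivative_const
        bounded_linear_imp_has_derivative[OF bounded_linear_smult_left], of v w]
    by simp
  from has_derivative_compose[OF this holo_on_has_derivative[OF assms]]
  have "((\<lambda>z. f (v + z *s w)) has_derivative (\<lambda>h. dderiv f (v + z *s w) (h *s w))) (at z)" .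
  then show ?thesis
    by (simp add: has_field_derivative_def dderiv_scale[OF assms] mult.commute[of _ "dderiv f _ w"])
qed

lemma bounded_holo_on_const:
  assumes "holo_on UNIV f" "\<And>v. cmod (f v) \<le> B"
  shows "f v = f 0"
proof -
  have "(\<lambda>z. f (0 + z *s v)) holomorphic_on UNIV"
    using holo_on_line[OF assms(1), of 0 v]
    by (auto simp: holomorphic_on_def field_differentiable_def intro: has_field_derivative_at_within)
  moreover have "bounded (range (\<lambda>z. f (0 + z *s v)))"
    by (rule boundedI[of _ B]) (auto simp: assms(2))
  ultimately have "(\<lambda>z. f (0 + z *s v)) constant_on UNIV"
    by (rule Liouville_theorem)
  then obtain c where "\<And>z. f (0 + z *s v) = c" unfolding constant_on_def by auto
  from this[of 1] this[of 0] show ?thesis by simp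
qed

text \<open>Restriction to the complex line through \<open>v\<close> in direction \<open>w\<close>
  reduces this to Cauchy's formula on the unit circle, a radius allowed because \<open>f\<close> is
  entire. A derivative becomes an integral of values of \<open>f\<close>, which supplies the higher
  regularity that \<open>holo_on\<close> does not assert.\<close>

lemma dderiv_cauchy:
  assumes "holo_on UNIV f"
  shows "dderiv f v w =
    integral {0..1} (\<lambda>t. f (v + exp (2 * of_real pi * \<i> * of_real t) *s w) *
                         exp (- (2 * of_real pi * \<i> * of_real t)))"
proof -
  define F where "F = (\<lambda>z. f (v + z *s w))"
  have F: "F holomorphic_on S" for S
    using holo_on_line[OF assms(1), of v w]
    by (auto simp: F_def holomorphic_on_def field_differentiable_def intro: has_field_derivative_at_within)
  have "(F has_field_derivative (1 / (2 * of_real pi * \<i>) *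
      contour_integral (circlepath 0 1) (\<lambda>u. F u / (u - 0)\<^sup>2))) (at 0)"
    by (rule Cauchy_derivative_integral_circlepath(2)[where z = 0 and w = 0 and r = 1])
       (auto intro: F holomorphic_on_imp_continuous_on)
  moreover have "(F has_field_derivative dderiv f v w) (at 0)"
    using holo_on_line[OF assms(1), of v w 0] by (simp add: F_def)
  ultimately have "dderiv f v w = 1 / (2 * of_real pi * \<i>) *
      contour_integral (circlepath 0 1) (\<lambda>u. F u / (u - 0)\<^sup>2)"
    by (rule DERIV_unique[THEN sym])
  also have "contour_integral (circlepath 0 1) (\<lambda>u. F u / (u - 0)\<^sup>2) =
     integral {0..1} (\<lambda>t. (2 * of_real pi * \<i>) * (F (exp (2 * of_real pi * \<i> * of_real t)) *
          exp (- (2 * of_real pi * \<i> * of_real t))))"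
    unfolding contour_integral_integral
    by (rule integral_cong, subst vector_derivative_circlepath)
       (simp add: circlepath exp_minus field_simps power2_eq_square)
  finally show ?thesis
    by (simp add: F_def)
qed

lemma continuous_on_dderiv:
  assumes "holo_on UNIV f"
  shows "continuous_on S (\<lambda>v. dderiv f v w)"
proof -
  have "continuous_on (UNIV \<times> cbox 0 1) (\<lambda>(v, t::real).
      f (v + exp (2 * of_real pi * \<i> * of_real t) *s w) * exp (- (2 * of_real pi * \<i> * of_real t)))"
    unfolding split_beta
    by (intro continuous_intros continuous_on_compose2[OF holo_on_continuous[OF assms, of UNIV]]) auto
  from integral_continuous_on_param[OF this] show ?thesis
    unfolding dderiv_cauchy[OF assms] by (auto intro: continuous_on_subset)
qed

text \<open>Differentiating the Cauchy integral of \<open>dderiv f v w\<close> along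
  \<open>u\<close> under the integral sign gives the Cauchy integral of the derivative along
  \<open>w\<close> of \<open>dderiv f v u\<close>; this is the symmetry. Derivatives are packaged as
  bounded linear functions because the Leibniz rule wants them continuous in operator norm.\<close>

lemma
  assumes f: "holo_on UNIV f"
  shows holo_on_dderiv: "holo_on UNIV (\<lambda>v. dderiv f v w)"
    and dderiv_commute: "dderiv (\<lambda>v. dderiv f v w) v u = dderiv (\<lambda>v. dderiv f v u) v w"
proof -
  define B where "B = (\<lambda>v. Blinfun (dderiv f v))"
  have B: "blinfun_apply (B v) = dderiv f v" for v
    using has_derivative_bounded_linear[OF holo_on_has_derivative[OF f]]
    by (simp add: B_def bounded_linear_Blinfun_apply)
  have contB: "continuous_on UNIV B"
    by (rule continuous_on_blinfun_componentwise) (simp add: B continuous_on_dderiv f)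
  define p where "p = (\<lambda>t::real. exp (2 * of_real pi * \<i> * of_real t))"
  define q where "q = (\<lambda>t::real. exp (- (2 * of_real pi * \<i> * of_real t)))"
  have pq: "continuous_on S p" "continuous_on S q" for S
    by (auto simp: p_def q_def intro!: continuous_intros)
  have cauchy: "dderiv g v w = integral (cbox 0 1) (\<lambda>t. g (v + p t *s w) * q t)"
    if "holo_on UNIV g" for v w and g :: "complex^'a \<Rightarrow> complex"
    by (simp add: dderiv_cauchy[OF that] p_def q_def)
  define D where "D = (\<lambda>w v t. blinfun_mult_left (q t) o\<^sub>L B (v + p t *s w))"
  have D: "blinfun_apply (D w v t) = (\<lambda>x. dderiv f (v + p t *s w) x * q t)" for w v t
    by (rule ext) (simp add: D_def B blinfun_mult_left.rep_eq)
  have contD: "continuous_on (UNIV \<times> cbox 0 1) (\<lambda>(v, t). D w v t)" for w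
    unfolding D_def split_beta
    by (intro continuous_intros continuous_on_compose2[OF contB]
        continuous_on_compose2[OF pq(1)[of UNIV]] continuous_on_compose2[OF pq(2)[of UNIV]]
        bounded_linear.continuous_on[OF bounded_linear_blinfun_mult_left]) auto
  have der: "((\<lambda>v. integral (cbox 0 1) (\<lambda>t. f (v + p t *s w) * q t)) has_derivative
      blinfun_apply (integral (cbox 0 1) (D w v))) (at v within UNIV)" for v w
  proof (rule leibniz_rule[where U = UNIV and fx = "D w"])
    fix v t
    show "((\<lambda>v. f (v + p t *s w) * q t) has_derivative blinfun_apply (D w v t)) (at v within UNIV)"
      using has_derivative_mult_left[OF has_derivative_shift[OF holo_on_has_derivative[OF f, of "v + p t *s w"]],
          of "q t"]
      by (simp add: D)
  next
    fix v
    show "(\<lambda>t. f (v + p t *s w) * q t) integrable_on cbox 0 1"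
      by (intro integrable_continuous continuous_intros pq
          continuous_on_compose2[OF holo_on_continuous[OF f, of UNIV]]) auto
  qed (use contD in auto)
  have app: "blinfun_apply (integral (cbox 0 1) (D w v)) u =
      integral (cbox 0 1) (\<lambda>t. dderiv f (v + p t *s w) u * q t)" for w v u
  proof -
    have "D w v integrable_on cbox 0 1"
      by (rule integrable_continuous, rule continuous_on_compose2[OF contD[of w, unfolded split_beta],
           of _ "\<lambda>t. (v, t)", simplified])
         (auto intro!: continuous_intros)
    from integral_linear[OF this, of "\<lambda>T. blinfun_apply T u"]
    show ?thesis by (simp add: o_def D bounded_linear_intros)
  qed
  have h: "holo_on UNIV (\<lambda>v. dderiv f v w)" for w
    unfolding cauchy[OF f]
    by (rule holo_on_has_derivativeI[OF der])
       (unfold app, simp add: dderiv_scale[OF f] mult.assoc)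
  then show "holo_on UNIV (\<lambda>v. dderiv f v w)" .
  have "dderiv (\<lambda>v. dderiv f v w) v u = blinfun_apply (integral (cbox 0 1) (D w v)) u"
    unfolding cauchy[OF f] by (subst dderiv_eq[OF der]) simp
  also have "\<dots> = dderiv (\<lambda>v. dderiv f v u) v w"
    by (simp only: app cauchy[OF h])
  finally show "dderiv (\<lambda>v. dderiv f v w) v u = dderiv (\<lambda>v. dderiv f v u) v w" .
qed

section \<open>Continuous logarithms\<close>

lemma continuous_logarithm_entire:
  fixes f :: "complex^'n \<Rightarrow> complex"
  assumes "holo_on UNIV f" "\<And>v. f v \<noteq> 0"
  obtains g where "continuous_on UNIV g" "\<And>v. f v = exp (g v)"
  using continuous_logarithm_on_contractible[of UNIV f] assms holo_on_continuous[of f UNIV]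
    contractible_UNIV by (metis UNIV_I)

text \<open>Near \<open>v\<close> the values of \<open>g\<close> move by less than \<pi>, so
  \<open>g\<close> agrees there with \<open>g v\<close> plus the principal logarithm of a quotient
  close to 1.\<close>

lemma continuous_logarithm_has_derivative:
  fixes g :: "'a::real_normed_vector \<Rightarrow> complex"
  assumes g: "continuous_on UNIV g" and D: "((\<lambda>v. exp (g v)) has_derivative D) (at v)"
  shows "(g has_derivative (\<lambda>w. D w / exp (g v))) (at v)"
proof -
  have "((\<lambda>u. exp (g u) / exp (g v)) has_derivative (\<lambda>w. D w / exp (g v))) (at v)"
    using has_derivative_mult_left[OF D, of "inverse (exp (g v))"] by (simp add: divide_inverse)
  moreover have "(Ln has_field_derivative 1) (at (exp (g v) / exp (g v)))"
    using has_field_derivative_Ln[of 1] by (simp add: complex_nonpos_Reals_iff)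
  ultimately have "((\<lambda>u. Ln (exp (g u) / exp (g v))) has_derivative (\<lambda>w. D w / exp (g v))) (at v)"
    using has_derivative_compose[of "\<lambda>u. exp (g u) / exp (g v)" _ v UNIV Ln "(*) 1"]
    unfolding has_field_derivative_def by simp
  then have L: "((\<lambda>u. g v + Ln (exp (g u) / exp (g v))) has_derivative (\<lambda>w. D w / exp (g v))) (at v)"
    using has_derivative_add[OF has_derivative_const[of "g v"]] by fastforce
  have "isCont g v" using g by (simp add: continuous_on_eq_continuous_at)
  then have "\<forall>\<^sub>F u in at v. dist (g u) (g v) < pi"
    unfolding isCont_def tendsto_iff by simp
  then have "\<forall>\<^sub>F u in at v. g v + Ln (exp (g u) / exp (g v)) = g u"
  proof eventually_elim
    case (elim u)
    have "\<bar>Im (g u - g v)\<bar> < pi"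
      using elim abs_Im_le_cmod[of "g u - g v"] by (simp add: dist_norm)
    then have "Ln (exp (g u - g v)) = g u - g v" by (intro Ln_exp) auto
    then show ?case by (simp add: exp_diff)
  qed
  with L show ?thesis
    by (rule has_derivative_transform_eventually) auto
qed

text \<open>Distinct values differ by at least \<open>2 * pi\<close>, so connectedness leaves only
  one. The integer values of \<open>chern\<close> come from here.\<close>

lemma continuous_exp_const:
  fixes f :: "'a::real_normed_vector \<Rightarrow> complex"
  assumes "continuous_on UNIV f" "\<And>v. exp (f v) = exp (c::complex)"
  shows "\<exists>n::int. \<forall>v. f v = c + 2 * of_real pi * \<i> * of_int n"
proof -
  have *: "\<exists>n::int. f v = c + 2 * of_real pi * \<i> * of_int n" for v
    using assms(2)[of v] by (auto simp: exp_eq algebra_simps)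
  have "f constant_on UNIV"
  proof (rule continuous_discrete_range_constant[OF connected_UNIV assms(1)])
    fix x
    have "2 * pi \<le> norm (f y - f x)" if ne: "f y \<noteq> f x" for y
    proof -
      obtain m n :: int where mn: "f y = c + 2 * of_real pi * \<i> * of_int m"
        "f x = c + 2 * of_real pi * \<i> * of_int n" using * by metis
      then have e: "f y - f x = of_real (2 * pi) * \<i> * of_int (m - n)" by (simp add: algebra_simps)
      have "m \<noteq> n" using ne mn by auto
      then have "1 \<le> \<bar>real_of_int (m - n)\<bar>" by linarith
      then show ?thesis unfolding e norm_mult norm_of_int
        using mult_left_mono[of 1 "\<bar>real_of_int (m - n)\<bar>" "2 * pi"] by (simp add: norm_mult)
    qed
    then show "\<exists>e>0. \<forall>y. y \<in> UNIV \<and> f y \<noteq> f x \<longrightarrow> e \<le> norm (f y - f x)"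
      by (intro exI[of _ "2 * pi"]) auto
  qed
  then obtain k where "\<And>v. f v = k" unfolding constant_on_def by auto
  with * show ?thesis by metis
qed

section \<open>Lifting isomorphisms of tori\<close>

definition add_subgroup :: "'a::ab_group_add set \<Rightarrow> bool" where
  "add_subgroup \<Lambda> \<longleftrightarrow> 0 \<in> \<Lambda> \<and> (\<forall>x\<in>\<Lambda>. \<forall>y\<in>\<Lambda>. x - y \<in> \<Lambda>)"

lemma add_subgroup_zero: "add_subgroup \<Lambda> \<Longrightarrow> 0 \<in> \<Lambda>"
  and add_subgroup_diff: "add_subgroup \<Lambda> \<Longrightarrow> x \<in> \<Lambda> \<Longrightarrow> y \<in> \<Lambda> \<Longrightarrow> x - y \<in> \<Lambda>"
  by (auto simp: add_subgroup_def)

lemma add_subgroup_minus: "add_subgroup \<Lambda> \<Longrightarrow> x \<in> \<Lambda> \<Longrightarrow> - x \<in> \<Lambda>"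
  by (metis add_subgroup_diff add_subgroup_zero diff_0)

lemma add_subgroup_add: "add_subgroup \<Lambda> \<Longrightarrow> x \<in> \<Lambda> \<Longrightarrow> y \<in> \<Lambda> \<Longrightarrow> x + y \<in> \<Lambda>"
  by (metis add_subgroup_diff add_subgroup_minus diff_minus_eq_add)

lemma torus_proj_eq_iff:
  assumes "add_subgroup \<Lambda>"
  shows "torus_proj \<Lambda> u = torus_proj \<Lambda> v \<longleftrightarrow> u - v \<in> \<Lambda>"
proof
  assume "torus_proj \<Lambda> u = torus_proj \<Lambda> v"
  moreover have "u \<in> torus_proj \<Lambda> u"
    using add_subgroup_zero[OF assms] by (force simp: torus_proj_eq)
  ultimately show "u - v \<in> \<Lambda>" by (auto simp: torus_proj_eq)
next
  assume uv: "u - v \<in> \<Lambda>"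
  have "l + u \<in> torus_proj \<Lambda> v" if "l \<in> \<Lambda>" for l
    using add_subgroup_add[OF assms that uv] by (auto simp: torus_proj_eq image_iff intro!: bexI[of _ "l + (u - v)"])
  moreover have "l + v \<in> torus_proj \<Lambda> u" if "l \<in> \<Lambda>" for l
    using add_subgroup_diff[OF assms that uv] by (auto simp: torus_proj_eq image_iff intro!: bexI[of _ "l - (u - v)"])
  ultimately show "torus_proj \<Lambda> u = torus_proj \<Lambda> v"
    by (auto simp: torus_proj_eq)
qed

lemma torus_proj_add:
  assumes "add_subgroup \<Lambda>"
  shows "torus_proj \<Lambda> u \<otimes>\<^bsub>torus \<Lambda>\<^esub> torus_proj \<Lambda> v = torus_proj \<Lambda> (u + v)"
proof (intro subset_antisym subsetI)
  fix x assume "x \<in> torus_proj \<Lambda> (u + v)"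
  then obtain l where "l \<in> \<Lambda>" "x = (l + u) + (0 + v)" by (auto simp: torus_proj_eq algebra_simps)
  then show "x \<in> torus_proj \<Lambda> u \<otimes>\<^bsub>torus \<Lambda>\<^esub> torus_proj \<Lambda> v"
    using add_subgroup_zero[OF assms] unfolding torus_def FactGroup_def set_mult_def vec_group_def torus_proj_eq
    by simp (metis add.right_neutral)
next
  fix x assume "x \<in> torus_proj \<Lambda> u \<otimes>\<^bsub>torus \<Lambda>\<^esub> torus_proj \<Lambda> v"
  then obtain l l' where "l \<in> \<Lambda>" "l' \<in> \<Lambda>" "x = (l + l') + (u + v)"
    unfolding torus_def FactGroup_def set_mult_def vec_group_def torus_proj_eq by (auto simp: algebra_simps)
  then show "x \<in> torus_proj \<Lambda> (u + v)"
    using add_subgroup_add[OF assms] by (auto simp: torus_proj_eq)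
qed

lemma le_zero_of_le_mult:
  fixes x y :: real
  assumes "\<And>e. e > 0 \<Longrightarrow> x \<le> e * y" "y \<ge> 0"
  shows "x \<le> 0"
proof (rule ccontr)
  assume x: "\<not> x \<le> 0"
  then have "x \<le> x / (2 * (y + 1)) * y" using assms(2) by (intro assms(1)) auto
  then have "x * (2 * (y + 1)) \<le> x * y" using assms(2) by (simp add: field_simps)
  then have "x * (y + 2) \<le> 0" by (simp add: algebra_simps)
  moreover have "x * (y + 2) > 0" using x assms(2) by (intro mult_pos_pos) auto
  ultimately show False by simp
qed

text \<open>
  Near the origin the lift \<open>k\<close> of a homomorphism is additive, as \<open>k (u + u') - k u - k u'\<close>
  is a small element of a discrete group; hence it coincides with its derivative.
\<close>

lemma torus_iso_lift:
  fixes \<Lambda> \<Gamma> :: "(complex^'n) set"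
  assumes \<Lambda>: "add_subgroup \<Lambda>" and \<Gamma>: "add_subgroup \<Gamma>"
    and disc\<Lambda>: "0 < \<delta>" "\<And>x. x \<in> \<Lambda> \<Longrightarrow> norm x < \<delta> \<Longrightarrow> x = 0"
    and disc\<Gamma>: "0 < \<epsilon>" "\<And>x. x \<in> \<Gamma> \<Longrightarrow> norm x < \<epsilon> \<Longrightarrow> x = 0"
    and f: "f \<in> torus_isos \<Lambda> \<Gamma>"
  obtains F where "\<And>u v. F (u + v) = F u + F v" "\<And>c v. F (c *s v) = c *s F v"
    "\<And>v. f (torus_proj \<Lambda> v) = torus_proj \<Gamma> (F v)" "F ` \<Lambda> = \<Gamma>"
proof -
  have hom: "f \<in> hom (torus \<Lambda>) (torus \<Gamma>)"
    and bij: "bij_betw f (carrier (torus \<Lambda>)) (carrier (torus \<Gamma>))"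
    and hol: "holo_torus_map \<Lambda> \<Gamma> f"
    using f by (auto simp: torus_isos_def iso_def)
  have fadd: "f (torus_proj \<Lambda> (u + v)) = f (torus_proj \<Lambda> u) \<otimes>\<^bsub>torus \<Gamma>\<^esub> f (torus_proj \<Lambda> v)" for u v
    using hom_mult[OF hom] by (simp add: torus_proj_add[OF \<Lambda>, symmetric] carrier_torus)
  obtain U g where U: "open U" "0 \<in> U" and g: "\<And>i. holo_on U (\<lambda>u. g u $ i)"
    and fg: "\<And>u. u \<in> U \<Longrightarrow> f (torus_proj \<Lambda> u) = torus_proj \<Gamma> (g u)"
    using spec[OF hol[unfolded holo_torus_map_def], of 0] by blast
  have "torus_proj \<Gamma> (g 0) = torus_proj \<Gamma> (g 0 + g 0)"
    using fadd[of 0 0] U by (simp add: fg torus_proj_add[OF \<Gamma>])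
  then have g0: "g 0 \<in> \<Gamma>"
    unfolding torus_proj_eq_iff[OF \<Gamma>] using add_subgroup_minus[OF \<Gamma>, of "- g 0"] by simp
  define k where "k u = g u - g 0" for u
  have k0: "k 0 = 0" by (simp add: k_def)
  have fk: "f (torus_proj \<Lambda> u) = torus_proj \<Gamma> (k u)" if "u \<in> U" for u
    using that g0 by (simp add: fg torus_proj_eq_iff[OF \<Gamma>] k_def)
  have "\<exists>D. ((\<lambda>u. g u $ i) has_derivative D) (at 0) \<and> (\<forall>c w. D (c *s w) = c * D w)" for i
    using g[of i] U(2) unfolding holo_on_def by blast
  then obtain D' where D': "((\<lambda>u. g u $ i) has_derivative D' i) (at 0)" "D' i (c *s w) = c * D' i w" for i c w
    by metis
  define F where "F v = (\<chi> i. D' i v)" for v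
  have Fadd: "F (u + v) = F u + F v" for u v
    using linear_add[OF has_derivative_linear[OF D'(1)]] by (simp add: F_def vec_eq_iff)
  have Fscale: "F (c *s v) = c *s F v" for c v
    by (simp add: F_def vec_eq_iff D')
  have "isCont (\<lambda>u. k u $ i) 0" for i
    unfolding k_def using has_derivative_continuous[OF D'(1)[of i]]
    by (auto intro!: continuous_intros)
  then have "isCont k 0"
    unfolding isCont_def by (intro vec_tendstoI)
  then have "\<forall>\<^sub>F u in at 0. dist (k u) (k 0) < \<epsilon> / 3"
    unfolding isCont_def tendsto_iff using disc\<Gamma>(1) by (meson divide_pos_pos zero_less_numeral)
  moreover have "\<forall>\<^sub>F u in at 0. u \<in> U" using U by (auto intro: eventually_at_in_open')
  ultimately have "\<forall>\<^sub>F u in at 0. u \<in> U \<and> norm (k u) < \<epsilon> / 3"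
    by eventually_elim (simp add: k0)
  then obtain r where r: "r > 0" "\<And>u. u \<noteq> 0 \<Longrightarrow> dist u 0 < r \<Longrightarrow> u \<in> U \<and> norm (k u) < \<epsilon> / 3"
    by (auto simp: eventually_at)
  have r': "u \<in> U" "norm (k u) < \<epsilon> / 3" if "norm u < r" for u
    using r(2)[of u] that U disc\<Gamma>(1) k0 by (cases "u = 0"; simp)+
  have kadd: "k (u + u) = k u + k u" if u: "norm u < r / 2" for u
  proof -
    have u2: "norm u < r" "norm (u + u) < r" using u r(1) norm_triangle_ineq[of u u] by auto
    have "k (u + u) - (k u + k u) \<in> \<Gamma>"
      using fadd[of u u] u2 by (simp add: fk r' torus_proj_add[OF \<Gamma>] torus_proj_eq_iff[OF \<Gamma>])
    moreover have "norm (k (u + u) - (k u + k u)) < \<epsilon>"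
      using r'(2)[OF u2(1)] r'(2)[OF u2(2)] norm_triangle_ineq4[of "k (u + u)" "k u + k u"]
        norm_triangle_ineq[of "k u" "k u"] by linarith
    ultimately show ?thesis using disc\<Gamma>(2) by fastforce
  qed
  have khalf: "k ((1 / 2 ^ n) *\<^sub>R u) = (1 / 2 ^ n) *\<^sub>R k u" if "norm u < r / 2" for u n
  proof (induction n)
    case (Suc n)
    have "norm ((1 / 2 ^ Suc n) *\<^sub>R u) \<le> norm u"
      using mult_right_mono[of "1 / 2 ^ Suc n" 1 "norm u"] one_le_power[of "2::real" "Suc n"] by simp
    then have "k ((1 / 2 ^ Suc n) *\<^sub>R u + (1 / 2 ^ Suc n) *\<^sub>R u) = k ((1 / 2 ^ Suc n) *\<^sub>R u) + k ((1 / 2 ^ Suc n) *\<^sub>R u)"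
      using that by (intro kadd) linarith
    moreover have "(1 / 2 ^ Suc n) *\<^sub>R u + (1 / 2 ^ Suc n) *\<^sub>R u = (1 / 2 ^ n) *\<^sub>R u"
      by (simp add: scaleR_left_distrib[symmetric] field_simps)
    ultimately have "2 *\<^sub>R k ((1 / 2 ^ Suc n) *\<^sub>R u) = (1 / 2 ^ n) *\<^sub>R k u"
      using Suc.IH by (simp add: scaleR_2)
    then have "(1 / 2) *\<^sub>R (2 *\<^sub>R k ((1 / 2 ^ Suc n) *\<^sub>R u)) = (1 / 2) *\<^sub>R ((1 / 2 ^ n) *\<^sub>R k u)" by simp
    then show ?case by simp
  qed simp
  \<comment> \<open>\<open>u\<close> is halved until the difference quotient at the origin is
    accurate to \<open>e\<close>. Scaling back loses nothing, since \<open>k\<close> and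
    \<open>D' i\<close> both commute with halving.\<close>
  have kF: "k u = F u" if u: "norm u < r / 2" for u
  proof -
    have "k u $ i = D' i u" for i
    proof -
      have "cmod (k u $ i - D' i u) \<le> e * norm u" if e: "e > 0" for e
      proof -
        obtain d where d: "d > 0" "\<And>h. norm h < d \<Longrightarrow> norm (g h $ i - g 0 $ i - D' i (h - 0)) \<le> e * norm (h - 0)"
          using D'(1)[of i] e unfolding has_derivative_at_alt by (metis diff_zero)
        obtain n where n: "norm u / d < 2 ^ n" using real_arch_pow[of 2 "norm u / d"] by auto
        define h where "h = (1 / 2 ^ n) *\<^sub>R u"
        have "norm h < d" using n d(1) by (simp add: h_def field_simps)
        then have "cmod (k h $ i - D' i h) \<le> e * norm h" using d(2)[of h] by (simp add: k_def)
        moreover have "k h $ i = (1 / 2 ^ n) *\<^sub>R (k u $ i)" using khalf[OF u, of n] by (simp add: h_def)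
        moreover have "D' i h = (1 / 2 ^ n) *\<^sub>R D' i u"
          unfolding h_def using linear_scale[OF has_derivative_linear[OF D'(1)[of i]]] by blast
        ultimately have "cmod ((1 / 2 ^ n) *\<^sub>R (k u $ i - D' i u)) \<le> e * ((1 / 2 ^ n) * norm u)"
          by (simp add: h_def scaleR_diff_right)
        then show ?thesis by (simp add: divide_simps)
      qed
      then have "cmod (k u $ i - D' i u) \<le> 0" by (rule le_zero_of_le_mult[OF _ norm_ge_zero])
      then show ?thesis by simp
    qed
    then show ?thesis by (simp add: F_def vec_eq_iff)
  qed
  have fF: "f (torus_proj \<Lambda> v) = torus_proj \<Gamma> (F v)" for v
  proof -
    have *: "f (torus_proj \<Lambda> (2 ^ n *\<^sub>R u)) = torus_proj \<Gamma> (F (2 ^ n *\<^sub>R u))" if "norm u < r / 2" for u n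
    proof (induction n)
      case 0
      then show ?case using that r(1) fk[of u] kF[of u] r'(1)[of u] by simp
    next
      case (Suc n)
      have "(2 ^ Suc n) *\<^sub>R u = 2 ^ n *\<^sub>R u + 2 ^ n *\<^sub>R u" by (simp add: scaleR_left_distrib[symmetric])
      then show ?case by (simp only: fadd Suc torus_proj_add[OF \<Gamma>] Fadd)
    qed
    obtain n where n: "norm v / (r / 2) < 2 ^ n" using real_arch_pow[of 2 "norm v / (r / 2)"] by auto
    then have "norm ((1 / 2 ^ n) *\<^sub>R v) < r / 2" using r(1) by (simp add: field_simps)
    from *[OF this, of n] show ?thesis by simp
  qed
  have F0: "F 0 = 0" using Fadd[of 0 0] by simp
  have fker: "v \<in> \<Lambda>" if "F v \<in> \<Gamma>" for v
  proof -
    have "f (torus_proj \<Lambda> v) = f (torus_proj \<Lambda> 0)"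
      using that by (simp add: fF torus_proj_eq_iff[OF \<Gamma>] F0)
    then have "torus_proj \<Lambda> v = torus_proj \<Lambda> 0"
      using bij unfolding bij_betw_def carrier_torus by (auto dest: inj_onD)
    then show ?thesis by (simp add: torus_proj_eq_iff[OF \<Lambda>])
  qed
  \<comment> \<open>A kernel vector \<open>v\<close> puts every \<open>v / 2 ^ n\<close> into
    \<open>\<Lambda>\<close>, which discreteness allows only for \<open>v = 0\<close>. Equal
    dimensions then make \<open>F\<close> surjective, so that all of \<open>\<Gamma>\<close> is
    reached.\<close>
  have inj: "v = 0" if v: "F v = 0" for v
  proof -
    have *: "F (c *s v) = 0" for c using v Fscale by simp
    obtain n where n: "norm v / \<delta> < 2 ^ n" using real_arch_pow[of 2 "norm v / \<delta>"] by auto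
    have "complex_of_real (1 / 2 ^ n) *s v \<in> \<Lambda>"
      by (rule fker) (unfold *, rule add_subgroup_zero[OF \<Gamma>])
    moreover have "norm (complex_of_real (1 / 2 ^ n) *s v) < \<delta>"
      using n disc\<Lambda>(1) unfolding norm_smult_vec norm_of_real by (simp add: field_simps)
    ultimately have "complex_of_real (1 / 2 ^ n) *s v = 0" by (rule disc\<Lambda>(2))
    then show ?thesis by simp
  qed
  have lin: "linear F"
    by (rule linearI) (simp_all add: Fadd scaleR_vec_complex Fscale)
  have "inj F" using inj linear_injective_0[OF lin] by blast
  then have surj: "surj F" using linear_injective_imp_surjective[OF lin] by simp
  have "F ` \<Lambda> = \<Gamma>"
  proof (intro subset_antisym subsetI)
    fix w assume "w \<in> F ` \<Lambda>"
    then obtain v where v: "v \<in> \<Lambda>" "w = F v" by auto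
    then have "torus_proj \<Lambda> v = torus_proj \<Lambda> 0" by (simp add: torus_proj_eq_iff[OF \<Lambda>])
    then have "torus_proj \<Gamma> (F v) = torus_proj \<Gamma> 0" by (metis fF F0)
    then show "w \<in> \<Gamma>" using v by (simp add: torus_proj_eq_iff[OF \<Gamma>])
  next
    fix w assume "w \<in> \<Gamma>"
    moreover obtain v where "w = F v" using surj by (rule surjE)
    ultimately show "w \<in> F ` \<Lambda>" using fker[of v] by simp
  qed
  with that Fadd Fscale fF show ?thesis by blast
qed

section \<open>The alternating form of a line bundle\<close>

lemma anti_pairing_add_left: "anti_pairing (w + w') v = anti_pairing w v + anti_pairing w' v"
  by (simp add: anti_pairing_def algebra_simps sum.distrib)

lemma anti_pairing_add_right: "anti_pairing w (v + v') = anti_pairing w v + anti_pairing w v'"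
  by (simp add: anti_pairing_def algebra_simps sum.distrib)

lemma anti_pairing_diff_left: "anti_pairing (w - w') v = anti_pairing w v - anti_pairing w' v"
  by (simp add: anti_pairing_def algebra_simps sum_subtractf)

lemma anti_pairing_scale_left: "anti_pairing (c *s w) v = c * anti_pairing w v"
  by (simp add: anti_pairing_def algebra_simps sum_distrib_left)

lemma anti_pairing_scale_right: "anti_pairing w (c *s v) = cnj c * anti_pairing w v"
  by (simp add: anti_pairing_def algebra_simps sum_distrib_left)

lemma anti_pairing_le: "cmod (anti_pairing w v) \<le> of_nat CARD('n) * (norm w * norm v)"
  for w v :: "complex^'n"
proof -
  have "cmod (anti_pairing w v) \<le> (\<Sum>i\<in>UNIV. cmod (w $ i * cnj (v $ i)))"
    unfolding anti_pairing_def by (rule norm_sum)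
  also have "\<dots> \<le> (\<Sum>i\<in>(UNIV :: 'n set). norm w * norm v)"
    by (intro sum_mono) (simp add: norm_mult mult_mono Finite_Cartesian_Product.norm_nth_le)
  finally show ?thesis by simp
qed

lemma add_subgroup_dual_lattice: "add_subgroup (dual_lattice \<Lambda>)"
proof -
  have "anti_pairing 0 \<gamma> = 0" for \<gamma> :: "complex^'a" by (simp add: anti_pairing_def)
  then show ?thesis by (auto simp: add_subgroup_def dual_lattice_def anti_pairing_diff_left)
qed

lemma pic0_bundle_cong:
  assumes "w - w' \<in> dual_lattice \<Lambda>" "\<gamma> \<in> \<Lambda>"
  shows "pic0_bundle w \<gamma> v = pic0_bundle w' \<gamma> v"
proof -
  have "Im (anti_pairing (w - w') \<gamma>) \<in> \<int>" using assms by (auto simp: dual_lattice_def)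
  then obtain n :: int where "Im (anti_pairing (w - w') \<gamma>) = of_int n" by (elim Ints_cases)
  then have n: "complex_of_real (Im (anti_pairing w \<gamma>)) = of_real (Im (anti_pairing w' \<gamma>)) + of_int n"
    by (simp add: anti_pairing_diff_left) (metis add.commute diff_add_cancel of_real_add of_real_of_int_eq)
  show ?thesis unfolding pic0_bundle_def exp_eq n
    by (intro exI[of _ n]) (simp add: algebra_simps)
qed

text \<open>\<open>principal\<close> supplies \<open>\<phi>\<close> for some representative of the
  class, while ampleness is known for another. The two factors differ by a coboundary of
  \<open>g\<close> and a character; the character is constant in \<open>v\<close> and cancels
  against its translate, and the coboundary only changes \<open>h\<close> into
  \<open>h v * g v / g (v + x)\<close>.\<close>

lemma is_phi_ns_class:
  assumes e: "line_bundle \<Lambda> e" and e': "e' \<in> ns_class \<Lambda> e" and \<phi>: "is_phi \<Lambda> e' \<phi>"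
  shows "is_phi \<Lambda> e \<phi>"
  unfolding is_phi_def
proof
  fix x
  obtain w where w: "\<phi> (torus_proj \<Lambda> x) = torus_proj (dual_lattice \<Lambda>) w"
    and iso: "bundle_iso \<Lambda> (bundle_tensor (bundle_translate x e') (bundle_dual e')) (pic0_bundle w)"
    using \<phi> unfolding is_phi_def by blast
  obtain h where h: "holo_on UNIV h" "\<And>v. h v \<noteq> 0"
    "\<And>\<gamma> v. \<gamma> \<in> \<Lambda> \<Longrightarrow> pic0_bundle w \<gamma> v * h v = h (v + \<gamma>) * (e' \<gamma> (v + x) * inverse (e' \<gamma> v))"
    using iso unfolding bundle_iso_def bundle_tensor_def bundle_translate_def bundle_dual_def by blast
  obtain u g where g: "holo_on UNIV g" "\<And>v. g v \<noteq> 0"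
    "\<And>\<gamma> v. \<gamma> \<in> \<Lambda> \<Longrightarrow> pic0_bundle u \<gamma> v * g v = g (v + \<gamma>) * (e' \<gamma> v * inverse (e \<gamma> v))"
    using e' unfolding ns_class_def bundle_iso_def bundle_tensor_def bundle_dual_def by blast
  have e0: "e \<gamma> v \<noteq> 0" if "\<gamma> \<in> \<Lambda>" for \<gamma> v using e that by (auto simp: line_bundle_def)
  define c where "c \<gamma> = pic0_bundle u \<gamma> 0" for \<gamma>
  have c: "pic0_bundle u \<gamma> v = c \<gamma>" "c \<gamma> \<noteq> 0" for \<gamma> v by (auto simp: c_def pic0_bundle_def)
  have e'_eq: "e' \<gamma> v = c \<gamma> * g v * e \<gamma> v / g (v + \<gamma>)" if "\<gamma> \<in> \<Lambda>" for \<gamma> v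
    using g(3)[OF that, of v] g(2) e0[OF that] by (simp add: c field_simps)
  define h' where "h' v = h v * g v / g (v + x)" for v
  have "pic0_bundle w \<gamma> v * h' v = h' (v + \<gamma>) * (e \<gamma> (v + x) * inverse (e \<gamma> v))" if \<gamma>: "\<gamma> \<in> \<Lambda>" for \<gamma> v
  proof -
    have "pic0_bundle w \<gamma> v * h' v = (pic0_bundle w \<gamma> v * h v) * g v / g (v + x)" by (simp add: h'_def)
    also have "\<dots> = h (v + \<gamma>) * (e' \<gamma> (v + x) * inverse (e' \<gamma> v)) * g v / g (v + x)"
      by (simp only: h(3)[OF \<gamma>])
    also have "\<dots> = h' (v + \<gamma>) * (e \<gamma> (v + x) * inverse (e \<gamma> v))"
      using g(2) e0[OF \<gamma>] c(2) by (simp add: h'_def e'_eq[OF \<gamma>] field_simps)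
    finally show ?thesis .
  qed
  moreover have "holo_on UNIV h'" "\<And>v. h' v \<noteq> 0"
    unfolding h'_def using h g by (auto intro!: holo_on_divide holo_on_mult holo_on_shift)
  ultimately have "bundle_iso \<Lambda> (bundle_tensor (bundle_translate x e) (bundle_dual e)) (pic0_bundle w)"
    unfolding bundle_iso_def bundle_tensor_def bundle_translate_def bundle_dual_def by blast
  with w show "\<exists>w. \<phi> (torus_proj \<Lambda> x) = torus_proj (dual_lattice \<Lambda>) w \<and>
      bundle_iso \<Lambda> (bundle_tensor (bundle_translate x e) (bundle_dual e)) (pic0_bundle w)" by blast
qed

text \<open>Compactness of the torus is encoded by \<open>R\<close>, a bound for the distance from
  any point to the lattice. The logarithms \<open>\<L>\<close> are an arbitrary continuous choice;
  adding constants to them does not affect \<open>chern\<close>.\<close>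

locale torus_line_bundle =
  fixes \<Lambda> :: "(complex^'n) set" and R :: real and e :: "'n automorphy"
    and \<L> :: "complex^'n \<Rightarrow> complex^'n \<Rightarrow> complex"
  assumes subgroup: "add_subgroup \<Lambda>"
    and cocompact: "\<And>v. \<exists>\<gamma>\<in>\<Lambda>. norm (v - \<gamma>) \<le> R"
    and is_line_bundle: "line_bundle \<Lambda> e"
    and log_continuous: "\<And>\<gamma>. \<gamma> \<in> \<Lambda> \<Longrightarrow> continuous_on UNIV (\<L> \<gamma>)"
    and exp_log: "\<And>\<gamma> v. \<gamma> \<in> \<Lambda> \<Longrightarrow> exp (\<L> \<gamma> v) = e \<gamma> v"
begin

lemma factor_holo: "\<gamma> \<in> \<Lambda> \<Longrightarrow> holo_on UNIV (e \<gamma>)"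
  and factor_nonzero: "\<gamma> \<in> \<Lambda> \<Longrightarrow> e \<gamma> v \<noteq> 0"
  and cocycle: "\<gamma> \<in> \<Lambda> \<Longrightarrow> \<delta> \<in> \<Lambda> \<Longrightarrow> e (\<gamma> + \<delta>) v = e \<gamma> (v + \<delta>) * e \<delta> v"
  using is_line_bundle by (auto simp: line_bundle_def)

lemma cocycle_sym:
  assumes "\<gamma> \<in> \<Lambda>" "\<delta> \<in> \<Lambda>"
  shows "e \<gamma> (v + \<delta>) * e \<delta> v = e \<delta> (v + \<gamma>) * e \<gamma> v"
  using cocycle[OF assms, of v] cocycle[OF assms(2,1), of v] by (simp add: add.commute)

lemma log_shift_continuous: "\<gamma> \<in> \<Lambda> \<Longrightarrow> continuous_on UNIV (\<lambda>v. \<L> \<gamma> (v + x))"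
  by (rule continuous_on_compose2[OF log_continuous]) (auto intro!: continuous_intros)

text \<open>Up to the factor \<open>2 * pi * \<i>\<close> this is the first Chern class as an
  alternating form on the lattice, computed from the cocycle; \<open>chern_const\<close> shows that
  it does not depend on \<open>v\<close>.\<close>

definition chern :: "complex^'n \<Rightarrow> complex^'n \<Rightarrow> complex^'n \<Rightarrow> complex" where
  "chern \<gamma> \<delta> v = \<L> \<gamma> (v + \<delta>) - \<L> \<gamma> v - (\<L> \<delta> (v + \<gamma>) - \<L> \<delta> v)"

lemma chern_const:
  assumes "\<gamma> \<in> \<Lambda>" "\<delta> \<in> \<Lambda>"
  shows "\<exists>n::int. \<forall>v. chern \<gamma> \<delta> v = 2 * of_real pi * \<i> * of_int n"
proof -
  have "continuous_on UNIV (chern \<gamma> \<delta>)"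
    unfolding chern_def by (intro continuous_intros log_continuous log_shift_continuous assms)
  moreover have "exp (chern \<gamma> \<delta> v) = exp 0" for v
  proof -
    have "exp (chern \<gamma> \<delta> v) = e \<gamma> (v + \<delta>) / e \<gamma> v / (e \<delta> (v + \<gamma>) / e \<delta> v)"
      by (simp only: chern_def exp_diff exp_log assms)
    then show ?thesis
      using cocycle_sym[OF assms, of v] factor_nonzero assms by (simp add: field_simps)
  qed
  ultimately show ?thesis using continuous_exp_const[of "chern \<gamma> \<delta>" 0] by simp
qed

lemma periodic_bounded:
  fixes f :: "complex^'n \<Rightarrow> 'b::real_normed_vector"
  assumes "continuous_on UNIV f" "\<And>\<gamma> v. \<gamma> \<in> \<Lambda> \<Longrightarrow> norm (f (v + \<gamma>)) = norm (f v)"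
  obtains C where "C \<ge> 0" "\<And>v. norm (f v) \<le> C"
proof -
  have "compact (f ` cball 0 R)"
    using assms(1) by (intro compact_continuous_image) (auto intro: continuous_on_subset)
  then have "bounded (f ` cball 0 R)" by (rule compact_imp_bounded)
  then obtain C where C: "C > 0" "\<And>v. v \<in> cball 0 R \<Longrightarrow> norm (f v) \<le> C"
    unfolding bounded_pos by blast
  have "norm (f v) \<le> C" for v
  proof -
    obtain \<gamma> where \<gamma>: "\<gamma> \<in> \<Lambda>" "norm (v - \<gamma>) \<le> R" using cocompact by blast
    show ?thesis using C(2)[of "v - \<gamma>"] assms(2)[OF \<gamma>(1), of "v - \<gamma>"] \<gamma>(2) by simp
  qed
  with C(1) that show ?thesis by (meson less_imp_le)
qed

lemma holo_periodic_const:
  assumes "holo_on UNIV f" "\<And>\<gamma> v. \<gamma> \<in> \<Lambda> \<Longrightarrow> cmod (f (v + \<gamma>)) = cmod (f v)"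
  shows "f v = f 0"
proof -
  obtain C where "\<And>v. cmod (f v) \<le> C"
    using periodic_bounded[of f, OF holo_on_continuous[OF assms(1)] assms(2)] by blast
  then show ?thesis by (rule bounded_holo_on_const[OF assms(1)])
qed

text \<open>
  With \<open>x = \<delta> / N\<close> the product of the translates \<open>g (v + j x)\<close>, \<open>j < N\<close>, of the isomorphism
  \<open>g\<close> attached to \<open>x\<close> is a multiple of \<open>1 / e \<delta>\<close>; comparing logarithms determines the character
  of \<open>x\<close>, as for the Weil pairing.
\<close>

lemma chern_division:
  assumes \<gamma>: "\<gamma> \<in> \<Lambda>" and \<delta>: "\<delta> \<in> \<Lambda>" and x: "of_nat N *s x = \<delta>"
    and g: "holo_on UNIV g" "\<And>v. g v \<noteq> 0"
    and iso: "\<And>\<gamma> v. \<gamma> \<in> \<Lambda> \<Longrightarrow>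
      pic0_bundle w \<gamma> v * g v = g (v + \<gamma>) * (e \<gamma> (v + x) * inverse (e \<gamma> v))"
  shows "\<exists>m::int. chern \<gamma> \<delta> v =
    2 * of_real pi * \<i> * (of_nat N * (of_real (Im (anti_pairing w \<gamma>)) + of_int m))"
proof -
  define t where "t j = of_nat j *s x" for j
  have t: "t 0 = 0" "t N = \<delta>" "\<And>j. t (Suc j) = t j + x"
    using x by (simp_all add: t_def vec_eq_iff algebra_simps)
  obtain h where h: "continuous_on UNIV h" "\<And>v. g v = exp (h v)"
    using continuous_logarithm_entire[OF g] by blast
  have hs: "continuous_on UNIV (\<lambda>v. h (v + y))" for y
    by (rule continuous_on_compose2[OF h(1)]) (auto intro!: continuous_intros)
  have exp_c: "exp (h (v + \<gamma>) - h v + (\<L> \<gamma> (v + x) - \<L> \<gamma> v)) =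
      exp (2 * of_real pi * \<i> * of_real (Im (anti_pairing w \<gamma>)))" for v
  proof -
    have "exp (h (v + \<gamma>) - h v + (\<L> \<gamma> (v + x) - \<L> \<gamma> v)) =
        g (v + \<gamma>) * (e \<gamma> (v + x) * inverse (e \<gamma> v)) / g v"
      by (simp only: exp_add exp_diff exp_log[OF \<gamma>] flip: h(2)) (simp add: field_simps)
    also have "\<dots> = pic0_bundle w \<gamma> v" using g(2) by (simp flip: iso[OF \<gamma>])
    finally show ?thesis by (simp add: pic0_bundle_def)
  qed
  have "continuous_on UNIV (\<lambda>v. h (v + \<gamma>) - h v + (\<L> \<gamma> (v + x) - \<L> \<gamma> v))"
    by (intro continuous_intros hs h(1) log_continuous[OF \<gamma>] log_shift_continuous[OF \<gamma>])
  from continuous_exp_const[OF this exp_c] obtain m :: int where m: "\<And>v. h (v + \<gamma>) - h v + (\<L> \<gamma> (v + x) - \<L> \<gamma> v) =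
      2 * of_real pi * \<i> * of_real (Im (anti_pairing w \<gamma>)) + 2 * of_real pi * \<i> * of_int m"
    by blast
  define q where "q = 2 * of_real pi * \<i> * (of_real (Im (anti_pairing w \<gamma>)) + of_int m)"
  \<comment> \<open>The terms in \<open>\<L> \<gamma>\<close> telescope along the multiples of
    \<open>x\<close>, which end at \<open>\<delta>\<close>, so the character of \<open>x\<close> is
    collected once per step.\<close>
  have sum_n: "(\<Sum>j<n. h (v + \<gamma> + t j) - h (v + t j)) + (\<L> \<gamma> (v + t n) - \<L> \<gamma> v) = of_nat n * q" for n v
  proof (induction n)
    case (Suc n)
    have "h (v + \<gamma> + t n) - h (v + t n) + (\<L> \<gamma> (v + t (Suc n)) - \<L> \<gamma> (v + t n)) = q"
      using m[of "v + t n"] by (simp add: q_def t(3) algebra_simps)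
    moreover have "(\<Sum>j<Suc n. h (v + \<gamma> + t j) - h (v + t j)) + (\<L> \<gamma> (v + t (Suc n)) - \<L> \<gamma> v) =
      ((\<Sum>j<n. h (v + \<gamma> + t j) - h (v + t j)) + (\<L> \<gamma> (v + t n) - \<L> \<gamma> v)) +
      (h (v + \<gamma> + t n) - h (v + t n) + (\<L> \<gamma> (v + t (Suc n)) - \<L> \<gamma> (v + t n)))"
      by simp
    ultimately show ?case unfolding Suc by (simp add: algebra_simps)
  qed (simp add: t(1))
  define K where "K v = (\<Prod>j<N. g (v + t j)) * e \<delta> v" for v
  have K: "holo_on UNIV K"
    unfolding K_def by (intro holo_on_mult holo_on_prod holo_on_shift g factor_holo \<delta>)
  have step: "cmod (g (v + \<gamma>')) * cmod (e \<gamma>' (v + x)) = cmod (g v) * cmod (e \<gamma>' v)" if "\<gamma>' \<in> \<Lambda>" for \<gamma>' v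
  proof -
    have 1: "cmod (pic0_bundle w \<gamma>' v) = 1" by (simp add: pic0_bundle_def)
    have "pic0_bundle w \<gamma>' v * g v * e \<gamma>' v = g (v + \<gamma>') * e \<gamma>' (v + x)"
      using iso[OF that, of v] factor_nonzero[OF that] by simp
    from arg_cong[OF this, of cmod] 1 show ?thesis by (simp add: norm_mult)
  qed
  have prod_n: "(\<Prod>j<n. cmod (g (v + \<gamma>' + t j))) * cmod (e \<gamma>' (v + t n)) =
      (\<Prod>j<n. cmod (g (v + t j))) * cmod (e \<gamma>' v)" if "\<gamma>' \<in> \<Lambda>" for \<gamma>' v n
  proof (induction n)
    case (Suc n)
    have "(\<Prod>j<Suc n. cmod (g (v + \<gamma>' + t j))) * cmod (e \<gamma>' (v + t (Suc n))) =
      (\<Prod>j<n. cmod (g (v + \<gamma>' + t j))) * (cmod (g (v + t n + \<gamma>')) * cmod (e \<gamma>' (v + t n + x)))"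
      by (simp add: t(3) algebra_simps)
    also have "\<dots> = ((\<Prod>j<n. cmod (g (v + \<gamma>' + t j))) * cmod (e \<gamma>' (v + t n))) * cmod (g (v + t n))"
      unfolding step[OF that] by (simp only: ac_simps)
    finally show ?case unfolding Suc by simp
  qed (simp add: t(1))
  \<comment> \<open>Moduli suffice for Liouville's theorem, and they remove the unitary
    characters.\<close>
  have Kper: "cmod (K (v + \<gamma>')) = cmod (K v)" if \<gamma>': "\<gamma>' \<in> \<Lambda>" for \<gamma>' v
  proof -
    define A A' where "A = (\<Prod>j<N. cmod (g (v + t j)))" and "A' = (\<Prod>j<N. cmod (g (v + \<gamma>' + t j)))"
    have 1: "A' * cmod (e \<gamma>' (v + \<delta>)) = A * cmod (e \<gamma>' v)"
      using prod_n[OF \<gamma>', of v N] unfolding A_def A'_def t(2) .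
    have 2: "cmod (e \<gamma>' (v + \<delta>)) * cmod (e \<delta> v) = cmod (e \<delta> (v + \<gamma>')) * cmod (e \<gamma>' v)"
      using arg_cong[OF cocycle_sym[OF \<gamma>' \<delta>, of v], of cmod] by (simp only: norm_mult)
    have "A' * cmod (e \<delta> (v + \<gamma>')) * cmod (e \<gamma>' v) = (A' * cmod (e \<gamma>' (v + \<delta>))) * cmod (e \<delta> v)"
      by (simp only: mult.assoc 2)
    also have "\<dots> = A * cmod (e \<delta> v) * cmod (e \<gamma>' v)" unfolding 1 by (simp only: ac_simps)
    finally have eq: "A' * cmod (e \<delta> (v + \<gamma>')) * cmod (e \<gamma>' v) = A * cmod (e \<delta> v) * cmod (e \<gamma>' v)" .
    have "cmod (e \<gamma>' v) \<noteq> 0" using factor_nonzero[OF \<gamma>'] by simp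
    from mult_right_cancel[OF this, THEN iffD1, OF eq]
    have "A' * cmod (e \<delta> (v + \<gamma>')) = A * cmod (e \<delta> v)" .
    moreover have "cmod (K y) = (\<Prod>j<N. cmod (g (y + t j))) * cmod (e \<delta> y)" for y
      by (simp only: K_def norm_mult prod_norm)
    ultimately show ?thesis by (simp only: A_def A'_def)
  qed
  \<comment> \<open>A continuous logarithm of the constant \<open>K\<close> is constant. Comparing
    its values at \<open>v\<close> and \<open>v + \<gamma>\<close> trades the sum over
    \<open>h\<close> for the part of \<open>chern\<close> that involves
    \<open>\<L> \<delta>\<close>.\<close>
  define k where "k v = (\<Sum>j<N. h (v + t j)) + \<L> \<delta> v" for v
  have "exp (k v) = K v" for v
    by (simp only: k_def K_def exp_add exp_sum[OF finite_lessThan] exp_log[OF \<delta>] h(2))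
  then have exp_k: "exp (k v) = exp (k 0)" for v
    using holo_periodic_const[OF K Kper, of v] by simp
  have "continuous_on UNIV k"
    unfolding k_def by (intro continuous_intros hs log_continuous \<delta>)
  from continuous_exp_const[OF this exp_k] obtain i :: int
    where i: "\<And>v. k v = k 0 + 2 * of_real pi * \<i> * of_int i" by blast
  have "k (v + \<gamma>) = k v" by (rule trans[OF i i[symmetric]])
  then have "(\<Sum>j<N. h (v + \<gamma> + t j)) + \<L> \<delta> (v + \<gamma>) = (\<Sum>j<N. h (v + t j)) + \<L> \<delta> v"
    by (simp only: k_def)
  moreover have "a + b = c + d \<Longrightarrow> - (b - d) = a - c" for a b c d :: complex
    by (simp add: algebra_simps)
  ultimately have "- (\<L> \<delta> (v + \<gamma>) - \<L> \<delta> v) = (\<Sum>j<N. h (v + \<gamma> + t j) - h (v + t j))"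
    unfolding sum_subtractf by blast
  moreover have "chern \<gamma> \<delta> v = - (\<L> \<delta> (v + \<gamma>) - \<L> \<delta> v) + (\<L> \<gamma> (v + t N) - \<L> \<gamma> v)"
    by (simp add: chern_def t(2))
  ultimately have "chern \<gamma> \<delta> v =
      (\<Sum>j<N. h (v + \<gamma> + t j) - h (v + t j)) + (\<L> \<gamma> (v + t N) - \<L> \<gamma> v)"
    by (simp only:)
  then have "chern \<gamma> \<delta> v = of_nat N * q" unfolding sum_n .
  then show ?thesis by (intro exI[of _ m]) (simp add: q_def)
qed

text \<open>With \<open>x = \<delta> / N\<close> and \<open>F x = F \<delta> / N\<close>,
  \<open>chern_division\<close> gives the formula modulo \<open>N\<close>. The integer
  \<open>n\<close> is the same for all \<open>N\<close>, so an \<open>N\<close> larger than the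
  discrepancy leaves no room for one.\<close>

lemma chern_eq:
  assumes \<phi>: "is_phi \<Lambda> e \<phi>"
    and F: "\<And>c v. F (c *s v) = c *s F v"
    and lift: "\<And>v. \<phi> (torus_proj \<Lambda> v) = torus_proj (dual_lattice \<Lambda>) (F v)"
    and \<gamma>: "\<gamma> \<in> \<Lambda>" and \<delta>: "\<delta> \<in> \<Lambda>"
  shows "chern \<gamma> \<delta> v = 2 * of_real pi * \<i> * of_real (Im (anti_pairing (F \<delta>) \<gamma>))"
proof -
  define I where "I = Im (anti_pairing (F \<delta>) \<gamma>)"
  obtain n :: int where n: "\<And>v. chern \<gamma> \<delta> v = 2 * of_real pi * \<i> * of_int n"
    using chern_const[OF \<gamma> \<delta>] by blast
  have ex: "\<exists>m::int. of_int n = I + of_nat N * of_int m" if N: "N > 0" for N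
  proof -
    define x where "x = (1 / of_nat N) *s \<delta>"
    have x: "of_nat N *s x = \<delta>" using N by (simp add: x_def vec_eq_iff)
    obtain w where w: "\<phi> (torus_proj \<Lambda> x) = torus_proj (dual_lattice \<Lambda>) w"
      and iso: "bundle_iso \<Lambda> (bundle_tensor (bundle_translate x e) (bundle_dual e)) (pic0_bundle w)"
      using \<phi> unfolding is_phi_def by blast
    have "F x - w \<in> dual_lattice \<Lambda>"
      using w by (simp add: lift torus_proj_eq_iff[OF add_subgroup_dual_lattice])
    note pic = pic0_bundle_cong[OF this]
    obtain g where g: "holo_on UNIV g" "\<And>v. g v \<noteq> 0"
      "\<And>\<gamma> v. \<gamma> \<in> \<Lambda> \<Longrightarrow> pic0_bundle w \<gamma> v * g v = g (v + \<gamma>) * (e \<gamma> (v + x) * inverse (e \<gamma> v))"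
      using iso unfolding bundle_iso_def bundle_tensor_def bundle_translate_def bundle_dual_def by blast
    have g': "pic0_bundle (F x) \<gamma> v * g v = g (v + \<gamma>) * (e \<gamma> (v + x) * inverse (e \<gamma> v))"
      if "\<gamma> \<in> \<Lambda>" for \<gamma> v
      unfolding pic[OF that] by (rule g(3)[OF that])
    obtain m :: int where m: "chern \<gamma> \<delta> 0 =
        2 * of_real pi * \<i> * (of_nat N * (of_real (Im (anti_pairing (F x) \<gamma>)) + of_int m))"
      using chern_division[OF \<gamma> \<delta> x g(1,2) g', of 0] by blast
    have "F x = complex_of_real (1 / of_nat N) *s F \<delta>" by (simp add: x_def F)
    then have I: "Im (anti_pairing (F x) \<gamma>) = I / of_nat N"
      by (simp only: I_def anti_pairing_scale_left) simp
    have "2 * of_real pi * \<i> * complex_of_int n =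
        2 * of_real pi * \<i> * (of_nat N * (of_real (Im (anti_pairing (F x) \<gamma>)) + of_int m))"
      by (rule trans[OF n[symmetric] m])
    then have "complex_of_int n = of_nat N * (of_real (Im (anti_pairing (F x) \<gamma>)) + of_int m)"
      by simp
    also have "\<dots> = of_nat N * (of_real (I / of_nat N) + of_int m)"
      by (simp only: I)
    also have "\<dots> = of_real (I + of_nat N * of_int m)" using N by (simp add: field_simps)
    finally have "complex_of_int n = of_real (I + of_nat N * of_int m)" .
    then have "of_int n = I + of_nat N * of_int m" by (metis of_real_eq_iff of_real_of_int_eq)
    then show ?thesis by blast
  qed
  have "of_int n = I"
  proof (rule ccontr)
    assume ne: "of_int n \<noteq> I"
    obtain N :: nat where N: "N > \<bar>of_int n - I\<bar>" using reals_Archimedean2 by blast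
    then have "N > 0" using of_nat_0_less_iff by fastforce
    then obtain m :: int where m: "of_int n = I + of_nat N * of_int m" using ex by blast
    then have "m \<noteq> 0" using ne by auto
    then have "1 \<le> \<bar>real_of_int m\<bar>" by linarith
    then have "real N \<le> real N * \<bar>real_of_int m\<bar>" using mult_left_mono[of 1 "\<bar>real_of_int m\<bar>" "real N"] by simp
    also have "\<dots> = \<bar>of_int n - I\<bar>" using m by (simp add: abs_mult)
    finally show False using N by simp
  qed
  then have "complex_of_int n = of_real I" by (metis of_real_of_int_eq)
  with n show ?thesis by (simp add: I_def)
qed

lemma pairing_antisym:
  assumes "is_phi \<Lambda> e \<phi>" "\<And>c v. F (c *s v) = c *s F v"
    "\<And>v. \<phi> (torus_proj \<Lambda> v) = torus_proj (dual_lattice \<Lambda>) (F v)"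
    "\<gamma> \<in> \<Lambda>" "\<delta> \<in> \<Lambda>"
  shows "Im (anti_pairing (F \<delta>) \<gamma>) = - Im (anti_pairing (F \<gamma>) \<delta>)"
proof -
  have "chern \<gamma> \<delta> 0 = - chern \<delta> \<gamma> 0" by (simp add: chern_def)
  then have "2 * of_real pi * \<i> * complex_of_real (Im (anti_pairing (F \<delta>) \<gamma>)) =
      2 * of_real pi * \<i> * of_real (- Im (anti_pairing (F \<gamma>) \<delta>))"
    by (simp only: chern_eq[OF assms] chern_eq[OF assms(1-3) assms(5,4)] of_real_minus mult_minus_right)
  moreover have "2 * of_real pi * \<i> \<noteq> (0::complex)" by simp
  ultimately have "complex_of_real (Im (anti_pairing (F \<delta>) \<gamma>)) = of_real (- Im (anti_pairing (F \<gamma>) \<delta>))"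
    using mult_left_cancel by blast
  then show ?thesis unfolding of_real_eq_iff .
qed

end

section \<open>Positivity\<close>

definition herm :: "nat \<Rightarrow> (nat \<Rightarrow> complex) \<Rightarrow> (nat \<Rightarrow> complex) \<Rightarrow> complex" where
  "herm N x y = (\<Sum>i\<le>N. x i * cnj (y i))"

lemma herm_add_left: "herm N (\<lambda>i. x i + x' i) y = herm N x y + herm N x' y"
  and herm_add_right: "herm N x (\<lambda>i. y i + y' i) = herm N x y + herm N x y'"
  and herm_scale_left: "herm N (\<lambda>i. c * x i) y = c * herm N x y"
  and herm_scale_right: "herm N x (\<lambda>i. c * y i) = cnj c * herm N x y"
  by (simp_all add: herm_def sum.distrib sum_distrib_left algebra_simps)

lemma cnj_herm: "cnj (herm N x y) = herm N y x"
  by (simp add: herm_def mult.commute)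

lemma herm_self: "herm N x x = of_real (\<Sum>i\<le>N. (cmod (x i))\<^sup>2)"
  by (simp add: herm_def complex_norm_square[symmetric])

lemma herm_self_eq_0_iff: "herm N x x = 0 \<longleftrightarrow> (\<forall>i\<le>N. x i = 0)"
  unfolding herm_self of_real_eq_0_iff by (subst sum_nonneg_eq_0_iff) auto

text \<open>
  The Levi form of \<open>log |\<theta>|\<^sup>2\<close> in terms of the values \<open>p\<close> of the sections and their derivatives
  \<open>a\<close>, \<open>b\<close> along two vectors.
\<close>

definition levi :: "nat \<Rightarrow> (nat \<Rightarrow> complex) \<Rightarrow> (nat \<Rightarrow> complex) \<Rightarrow> (nat \<Rightarrow> complex) \<Rightarrow> complex" where
  "levi N p a b = (herm N p p * herm N a b - herm N a p * herm N p b) / (herm N p p)\<^sup>2"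

lemma levi_add_left: "levi N p (\<lambda>i. a i + a' i) b = levi N p a b + levi N p a' b"
  by (simp add: levi_def herm_add_left algebra_simps add_divide_distrib diff_divide_distrib)

lemma levi_scale_left: "levi N p (\<lambda>i. c * a i) b = c * levi N p a b"
  by (simp add: levi_def herm_scale_left algebra_simps)

lemma levi_scale_right: "levi N p a (\<lambda>i. c * b i) = cnj c * levi N p a b"
  by (simp add: levi_def herm_scale_right algebra_simps)

lemma cnj_levi: "cnj (levi N p a b) = levi N p b a"
  by (simp add: levi_def cnj_herm mult.commute)

text \<open>Multiplying the sections by a holomorphic \<open>f\<close>, with derivatives changed by
  the product rule, adds \<open>log |f|^2\<close> to the potential, and its Levi form vanishes. This
  is what makes the Levi form descend to the torus.\<close>

lemma levi_gauge:
  assumes "f \<noteq> 0"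
  shows "levi N (\<lambda>i. f * p i) (\<lambda>i. f * a i + s * p i) (\<lambda>i. f * b i + t * p i) = levi N p a b"
proof -
  define P A B C where "P = herm N p p" and "A = herm N a p" and "B = herm N p b" and "C = herm N a b"
  have "herm N (\<lambda>i. f * p i) (\<lambda>i. f * p i) = f * cnj f * P"
    "herm N (\<lambda>i. f * a i + s * p i) (\<lambda>i. f * p i) = f * cnj f * A + s * cnj f * P"
    "herm N (\<lambda>i. f * p i) (\<lambda>i. f * b i + t * p i) = f * cnj f * B + f * cnj t * P"
    "herm N (\<lambda>i. f * a i + s * p i) (\<lambda>i. f * b i + t * p i) =
      f * cnj f * C + f * cnj t * A + s * cnj f * B + s * cnj t * P"
    by (simp_all add: herm_add_left herm_add_right herm_scale_left herm_scale_right
        P_def A_def B_def C_def algebra_simps)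
  then have "levi N (\<lambda>i. f * p i) (\<lambda>i. f * a i + s * p i) (\<lambda>i. f * b i + t * p i) =
      ((f * cnj f)\<^sup>2 * (P * C - A * B)) / ((f * cnj f)\<^sup>2 * P\<^sup>2)"
    unfolding levi_def by (simp add: power2_eq_square algebra_simps)
  also have "\<dots> = levi N p a b"
    using assms by (simp add: levi_def P_def A_def B_def C_def)
  finally show ?thesis .
qed

lemma levi_cong:
  assumes "\<And>i. i \<le> N \<Longrightarrow> p i = p' i" "\<And>i. i \<le> N \<Longrightarrow> a i = a' i" "\<And>i. i \<le> N \<Longrightarrow> b i = b' i"
  shows "levi N p a b = levi N p' a' b'"
  using assms by (simp add: levi_def herm_def)

text \<open>Cauchy--Schwarz, in the form \<open>|p|\<^sup>2 (|p|\<^sup>2 |a|\<^sup>2 - |(a, p)|\<^sup>2) = ||p|\<^sup>2 a - (a, p) p|\<^sup>2\<close>.\<close>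

lemma levi_self: "\<exists>r\<ge>0. levi N p a a = of_real r"
proof -
  define P where "P = (\<Sum>i\<le>N. (cmod (p i))\<^sup>2)"
  have P: "herm N p p = of_real P" "P \<ge> 0" by (auto simp: herm_self P_def sum_nonneg)
  define A where "A = herm N a p"
  have A': "herm N p a = cnj A" by (simp add: A_def cnj_herm)
  define q where "q = (\<lambda>i. of_real P * a i + (- A) * p i)"
  have "herm N q q = of_real P * (of_real P * herm N a a - A * cnj A)"
    unfolding q_def herm_add_left herm_add_right herm_scale_left herm_scale_right P A' A_def[symmetric]
    by (simp add: algebra_simps)
  moreover obtain r where r: "r \<ge> 0" "herm N q q = of_real r"
    by (metis herm_self sum_nonneg zero_le_power2)
  ultimately have *: "of_real P * (of_real P * herm N a a - A * cnj A) = of_real r" by simp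
  show ?thesis
  proof (cases "P = 0")
    case True
    then show ?thesis by (intro exI[of _ 0]) (simp add: levi_def P)
  next
    case False
    have "levi N p a a = of_real (r / P ^ 3)"
      using False by (simp add: levi_def P A' *[symmetric] power2_eq_square power3_eq_cube flip: A_def)
    then show ?thesis using r P by (intro exI[of _ "r / P ^ 3"]) auto
  qed
qed

section \<open>Derivatives along real lines\<close>

lemma herm_has_vector_derivative:
  assumes "\<And>i. ((\<lambda>s. x i s) has_vector_derivative x' i) (at s within S)"
    "\<And>i. ((\<lambda>s. y i s) has_vector_derivative y' i) (at s within S)"
  shows "((\<lambda>s. herm N (\<lambda>i. x i s) (\<lambda>i. y i s)) has_vector_derivative
      herm N x' (\<lambda>i. y i s) + herm N (\<lambda>i. x i s) y') (at s within S)"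
proof -
  have "((\<lambda>s. cnj (y i s)) has_vector_derivative cnj (y' i)) (at s within S)" for i
    by (rule bounded_linear.has_vector_derivative[OF bounded_linear_cnj assms(2)])
  then have "((\<lambda>s. herm N (\<lambda>i. x i s) (\<lambda>i. y i s)) has_vector_derivative
      (\<Sum>i\<le>N. x i s * cnj (y' i) + x' i * cnj (y i s))) (at s within S)"
    unfolding herm_def by (intro has_vector_derivative_sum has_vector_derivative_mult assms)
  then show ?thesis by (simp add: herm_def sum.distrib add.commute)
qed

lemma divide_has_vector_derivative:
  fixes f g :: "real \<Rightarrow> complex"
  assumes "(f has_vector_derivative f') (at s within S)" "(g has_vector_derivative g') (at s within S)"
    "g s \<noteq> 0"
  shows "((\<lambda>s. f s / g s) has_vector_derivative (f' * g s - f s * g') / (g s)\<^sup>2) (at s within S)"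
  using has_derivative_divide'[OF assms(1,2)[unfolded has_vector_derivative_def] assms(3)]
  unfolding has_vector_derivative_def
  by (rule has_derivative_eq_rhs)
     (use assms(3) in \<open>simp add: fun_eq_iff power2_eq_square scaleR_conv_of_real field_simps\<close>)

lemma holo_on_real_line:
  assumes "holo_on UNIV f"
  shows "((\<lambda>s. f (v + s *\<^sub>R x)) has_vector_derivative dderiv f (v + s *\<^sub>R x) x) (at s within S)"
proof -
  have "((\<lambda>s. v + s *\<^sub>R x) has_derivative (\<lambda>h. h *\<^sub>R x)) (at s within S)"
    by (auto intro!: derivative_eq_intros)
  from has_derivative_compose[OF this holo_on_has_derivative[OF assms]]
  show ?thesis
    unfolding has_vector_derivative_def
    by (simp add: linear_scale[OF has_derivative_linear[OF holo_on_has_derivative[OF assms]]])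
qed

text \<open>Only the indices up to \<open>N\<close> carry sections, but holomorphy is asked of every
  \<open>\<theta> i\<close>, so that the rules for derivatives and continuity apply without a bound
  on the index. The family is later padded with zero functions.\<close>

locale theta_map = torus_line_bundle \<Lambda> R e \<L>
  for \<Lambda> :: "(complex^'n) set" and R e \<L> +
  fixes k N :: nat and \<theta> :: "nat \<Rightarrow> complex^'n \<Rightarrow> complex"
  assumes is_section: "\<And>i. i \<le> N \<Longrightarrow> \<theta> i \<in> sections \<Lambda> (bundle_power e k)"
    and holo_\<theta>: "\<And>i. holo_on UNIV (\<theta> i)"
    and no_common_zero: "\<And>v. \<exists>i\<le>N. \<theta> i v \<noteq> 0"
begin

abbreviation "val v \<equiv> (\<lambda>i. \<theta> i v)"
abbreviation "der v x \<equiv> (\<lambda>i. dderiv (\<theta> i) v x)"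
abbreviation "der2 v x y \<equiv> (\<lambda>i. dderiv (\<lambda>v. dderiv (\<theta> i) v y) v x)"

definition nrm :: "complex^'n \<Rightarrow> complex" where "nrm v = herm N (val v) (val v)"

lemma nrm_nonzero: "nrm v \<noteq> 0"
  using no_common_zero[of v] by (auto simp: nrm_def herm_self_eq_0_iff)

lemma \<theta>_shift:
  assumes "\<gamma> \<in> \<Lambda>" "i \<le> N"
  shows "\<theta> i (v + \<gamma>) = e \<gamma> v ^ k * \<theta> i v"
  using is_section[OF assms(2)] assms(1) by (simp add: sections_def bundle_power_def)

lemma der_shift:
  assumes \<gamma>: "\<gamma> \<in> \<Lambda>" and i: "i \<le> N"
  shows "dderiv (\<theta> i) (v + \<gamma>) x =
    e \<gamma> v ^ k * dderiv (\<theta> i) v x + (of_nat k * (dderiv (e \<gamma>) v x / e \<gamma> v) * e \<gamma> v ^ k) * \<theta> i v"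
proof -
  have "((\<lambda>u. \<theta> i (u + \<gamma>)) has_derivative dderiv (\<theta> i) (v + \<gamma>)) (at v)"
    by (rule has_derivative_shift[OF holo_on_has_derivative[OF holo_\<theta>]])
  then have "((\<lambda>u. e \<gamma> u ^ k * \<theta> i u) has_derivative dderiv (\<theta> i) (v + \<gamma>)) (at v)"
    by (simp only: \<theta>_shift[OF \<gamma> i])
  moreover have "((\<lambda>u. e \<gamma> u ^ k * \<theta> i u) has_derivative (\<lambda>x. e \<gamma> v ^ k * dderiv (\<theta> i) v x +
      (of_nat k * dderiv (e \<gamma>) v x * e \<gamma> v ^ (k - 1)) * \<theta> i v)) (at v)"
    by (rule has_derivative_mult[OF has_derivative_power[OF holo_on_has_derivative[OF factor_holo[OF \<gamma>]]]
          holo_on_has_derivative[OF holo_\<theta>]])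
  ultimately have "dderiv (\<theta> i) (v + \<gamma>) = (\<lambda>x. e \<gamma> v ^ k * dderiv (\<theta> i) v x +
      (of_nat k * dderiv (e \<gamma>) v x * e \<gamma> v ^ (k - 1)) * \<theta> i v)"
    by (rule has_derivative_unique)
  \<comment> \<open>For \<open>k = 0\<close> the exponent \<open>k - 1\<close> is truncated, but
    then both sides vanish.\<close>
  moreover have "of_nat k * z * e \<gamma> v ^ (k - 1) = of_nat k * (z / e \<gamma> v) * e \<gamma> v ^ k" for z
    using factor_nonzero[OF \<gamma>, of v] by (cases k) auto
  ultimately show ?thesis by simp
qed

definition lev :: "complex^'n \<Rightarrow> complex^'n \<Rightarrow> complex^'n \<Rightarrow> complex" where
  "lev v x y = levi N (val v) (der v x) (der v y)"

lemma lev_periodic: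
  assumes "\<gamma> \<in> \<Lambda>"
  shows "lev (v + \<gamma>) x y = lev v x y"
proof -
  define s where "s x = of_nat k * (dderiv (e \<gamma>) v x / e \<gamma> v) * e \<gamma> v ^ k" for x
  have "lev (v + \<gamma>) x y = levi N (\<lambda>i. e \<gamma> v ^ k * val v i)
      (\<lambda>i. e \<gamma> v ^ k * der v x i + s x * val v i) (\<lambda>i. e \<gamma> v ^ k * der v y i + s y * val v i)"
    unfolding lev_def
    by (rule levi_cong) (simp_all only: \<theta>_shift[OF assms] der_shift[OF assms] s_def)
  also have "\<dots> = lev v x y"
    unfolding lev_def by (rule levi_gauge) (simp add: factor_nonzero[OF assms])
  finally show ?thesis .
qed

lemma continuous_on_herm:
  assumes "\<And>i. continuous_on S (\<lambda>v. x v i)" "\<And>i. continuous_on S (\<lambda>v. y v i)"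
  shows "continuous_on S (\<lambda>v. herm N (x v) (y v))"
  unfolding herm_def by (intro continuous_intros assms)

lemma continuous_on_lev: "continuous_on S (\<lambda>v. lev v x y)"
proof -
  note c = continuous_on_herm continuous_on_dderiv[OF holo_\<theta>] holo_on_continuous[OF holo_\<theta>]
  show ?thesis
    unfolding lev_def levi_def
    by (intro continuous_intros c ballI) (use nrm_nonzero in \<open>simp add: nrm_def\<close>)
qed

lemma lev_add_left: "lev v (x + x') y = lev v x y + lev v x' y"
  by (simp add: lev_def dderiv_add[OF holo_\<theta>] levi_add_left)

lemma lev_scale_left: "lev v (c *s x) y = c * lev v x y"
  by (simp add: lev_def dderiv_scale[OF holo_\<theta>] levi_scale_left)

lemma lev_scale_right: "lev v x (c *s y) = cnj c * lev v x y"
  by (simp add: lev_def dderiv_scale[OF holo_\<theta>] levi_scale_right)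

lemma lev_sum_left: "lev v (\<Sum>i\<in>I. x i) y = (\<Sum>i\<in>I. lev v (x i) y)"
proof (induction I rule: infinite_finite_induct)
  case (insert i I)
  then show ?case by (simp add: lev_add_left)
qed (use lev_scale_left[of v 0 0 y] in auto)

text \<open>Periodicity and compactness bound the form on each coordinate vector uniformly in
  \<open>v\<close>; linearity in \<open>x\<close> does the rest. It controls the error made by
  replacing \<open>\<i> n \<gamma>\<close> by a nearby lattice vector.\<close>

lemma lev_bound:
  obtains C where "C \<ge> 0" "\<And>v x. cmod (lev v x y) \<le> C * norm x"
proof -
  have "\<exists>C\<ge>0. \<forall>v. cmod (lev v (axis i 1) y) \<le> C" for i
  proof -
    obtain C where "C \<ge> 0" "\<And>v. cmod (lev v (axis i 1) y) \<le> C"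
      using periodic_bounded[of "\<lambda>v. lev v (axis i 1) y"] continuous_on_lev lev_periodic by metis
    then show ?thesis by blast
  qed
  then obtain c where c: "\<And>i. c i \<ge> 0" "\<And>i v. cmod (lev v (axis i 1) y) \<le> c i" by metis
  have "cmod (lev v x y) \<le> (\<Sum>i\<in>UNIV. c i) * norm x" for v x
  proof -
    have "lev v x y = lev v (\<Sum>i\<in>UNIV. x $ i *s axis i 1) y" by (simp add: basis_expansion)
    also have "\<dots> = (\<Sum>i\<in>UNIV. x $ i * lev v (axis i 1) y)"
      by (simp only: lev_sum_left lev_scale_left)
    finally have "cmod (lev v x y) \<le> (\<Sum>i\<in>UNIV. cmod (x $ i * lev v (axis i 1) y))" by (simp add: norm_sum)
    also have "\<dots> \<le> (\<Sum>i\<in>UNIV. norm x * c i)"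
      unfolding norm_mult by (intro sum_mono mult_mono c Finite_Cartesian_Product.norm_nth_le) auto
    finally show ?thesis by (simp add: sum_distrib_left mult.commute)
  qed
  moreover have "(\<Sum>i\<in>UNIV. c i) \<ge> 0" by (intro sum_nonneg c)
  ultimately show ?thesis using that by blast
qed

text \<open>The one-form \<open>d\<^sup>c log |\<theta>|\<^sup>2\<close>.\<close>

definition alpha :: "complex^'n \<Rightarrow> complex^'n \<Rightarrow> real" where
  "alpha v y = 2 * Im (herm N (der v y) (val v) / nrm v)"

definition dalpha :: "complex^'n \<Rightarrow> complex^'n \<Rightarrow> complex^'n \<Rightarrow> real" where
  "dalpha v x y = 2 * Im (((herm N (der2 v x y) (val v) + herm N (der v y) (der v x)) * nrm v -
     herm N (der v y) (val v) * (herm N (der v x) (val v) + herm N (val v) (der v x))) / (nrm v)\<^sup>2)"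

lemma alpha_has_vector_derivative:
  "((\<lambda>s. alpha (v + s *\<^sub>R x) y) has_vector_derivative dalpha (v + s *\<^sub>R x) x y) (at s within S)"
proof -
  let ?u = "\<lambda>s. v + s *\<^sub>R x"
  note d = holo_on_real_line[OF holo_\<theta>] holo_on_real_line[OF holo_on_dderiv[OF holo_\<theta>]]
  have "((\<lambda>s. herm N (der (?u s) y) (val (?u s)) / nrm (?u s)) has_vector_derivative
     ((herm N (der2 (?u s) x y) (val (?u s)) + herm N (der (?u s) y) (der (?u s) x)) * nrm (?u s) -
     herm N (der (?u s) y) (val (?u s)) *
       (herm N (der (?u s) x) (val (?u s)) + herm N (val (?u s)) (der (?u s) x))) / (nrm (?u s))\<^sup>2)
     (at s within S)"
    unfolding nrm_def
    by (rule divide_has_vector_derivative[OF herm_has_vector_derivative herm_has_vector_derivative])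
       (rule d nrm_nonzero[unfolded nrm_def])+
  from bounded_linear.has_vector_derivative[OF bounded_linear_mult_right[of 2]
      bounded_linear.has_vector_derivative[OF bounded_linear_Im this]]
  show ?thesis unfolding alpha_def dalpha_def .
qed

lemma continuous_on_alpha: "continuous_on S (\<lambda>v. alpha v y)"
proof -
  note c = continuous_on_herm continuous_on_dderiv[OF holo_\<theta>] holo_on_continuous[OF holo_\<theta>]
  show ?thesis
    unfolding alpha_def nrm_def
    by (intro continuous_intros c ballI) (use nrm_nonzero in \<open>simp add: nrm_def\<close>)
qed

lemma continuous_on_dalpha: "continuous_on S (\<lambda>v. dalpha v x y)"
proof -
  note c = continuous_on_herm continuous_on_dderiv[OF holo_\<theta>] holo_on_continuous[OF holo_\<theta>]
    continuous_on_dderiv[OF holo_on_dderiv[OF holo_\<theta>]]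
  show ?thesis
    unfolding dalpha_def nrm_def
    by (intro continuous_intros c ballI) (use nrm_nonzero in \<open>simp add: nrm_def\<close>)
qed

text \<open>This is the exterior derivative of \<open>alpha\<close>. The second derivatives of the
  sections cancel by \<open>dderiv_commute\<close>, and what remains is the Levi form minus its
  conjugate.\<close>

lemma dalpha_antisym: "dalpha v x y - dalpha v y x = 4 * Im (lev v y x)"
proof -
  define P A B C where "P = nrm v" and "A = herm N (der v y) (val v)"
    and "B = herm N (der v x) (val v)" and "C = herm N (der v y) (der v x)"
  have P: "herm N (val v) (val v) = P" by (simp add: P_def nrm_def)
  have cnjs: "herm N (val v) (der v y) = cnj A" "herm N (val v) (der v x) = cnj B"
    "herm N (der v x) (der v y) = cnj C" by (simp_all add: A_def B_def C_def cnj_herm)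
  have sym: "der2 v y x = der2 v x y" by (rule ext) (rule dderiv_commute[OF holo_\<theta>])
  define X where "X = herm N (der2 v x y) (val v)"
  have "((X + C) * P - A * (B + cnj B)) / P\<^sup>2 - ((X + cnj C) * P - B * (A + cnj A)) / P\<^sup>2 =
      lev v y x - lev v x y"
    unfolding lev_def levi_def P cnjs A_def[symmetric] B_def[symmetric] C_def[symmetric]
      diff_divide_distrib[symmetric]
    by (simp add: algebra_simps)
  moreover have "lev v x y = cnj (lev v y x)" by (simp add: lev_def cnj_levi)
  ultimately have "Im (((X + C) * P - A * (B + cnj B)) / P\<^sup>2) - Im (((X + cnj C) * P - B * (A + cnj A)) / P\<^sup>2) =
      2 * Im (lev v y x)"
    by (metis cnj.sel(2) minus_complex.sel(2) diff_minus_eq_add mult_2)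
  then show ?thesis
    unfolding dalpha_def sym cnjs P_def[symmetric] A_def[symmetric] B_def[symmetric] C_def[symmetric]
      X_def[symmetric]
    by simp
qed

text \<open>Translation by \<open>\<gamma>\<close> adds \<open>2 k log |e \<gamma>|\<close> to
  \<open>log |\<theta>|^2\<close>. Hence opposite edges of the parallelogram in Green's formula
  differ by integrals of the derivative of \<open>Im (\<L> \<gamma>)\<close>.\<close>

lemma alpha_shift:
  assumes "\<gamma> \<in> \<Lambda>"
  shows "alpha (v + \<gamma>) y = alpha v y + 2 * real k * Im (dderiv (e \<gamma>) v y / e \<gamma> v)"
proof -
  define f where "f = e \<gamma> v ^ k"
  define l where "l = dderiv (e \<gamma>) v y / e \<gamma> v"
  define A where "A = herm N (der v y) (val v)"
  have f: "f \<noteq> 0" by (simp add: f_def factor_nonzero[OF assms])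
  have P: "herm N (val v) (val v) \<noteq> 0" using nrm_nonzero by (simp add: nrm_def)
  have eqs: "val (v + \<gamma>) i = f * val v i" "der (v + \<gamma>) y i = f * der v y i + (of_nat k * l * f) * val v i"
    if "i \<le> N" for i
    using \<theta>_shift[OF assms that] der_shift[OF assms that] by (simp_all add: f_def l_def)
  have "herm N (val (v + \<gamma>)) (val (v + \<gamma>)) = herm N (\<lambda>i. f * val v i) (\<lambda>i. f * val v i)"
    "herm N (der (v + \<gamma>) y) (val (v + \<gamma>)) =
      herm N (\<lambda>i. f * der v y i + (of_nat k * l * f) * val v i) (\<lambda>i. f * val v i)"
    unfolding herm_def by (simp_all add: eqs)
  then have "herm N (der (v + \<gamma>) y) (val (v + \<gamma>)) / nrm (v + \<gamma>) =
      (cnj f * f * (A + of_nat k * l * nrm v)) / (cnj f * f * nrm v)"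
    by (simp add: nrm_def herm_add_left herm_scale_left herm_scale_right A_def algebra_simps)
  also have "\<dots> = A / nrm v + of_nat k * l"
    using f nrm_nonzero[of v] by (simp add: field_simps)
  finally have "alpha (v + \<gamma>) y = 2 * Im (A / nrm v + of_nat k * l)" by (simp only: alpha_def)
  also have "\<dots> = 2 * Im (A / nrm v) + 2 * real k * Im l" by simp
  finally show ?thesis by (simp only: alpha_def A_def l_def)
qed

lemma log_has_vector_derivative:
  assumes "\<gamma> \<in> \<Lambda>"
  shows "((\<lambda>s. Im (\<L> \<gamma> (v + s *\<^sub>R x))) has_vector_derivative
    Im (dderiv (e \<gamma>) (v + s *\<^sub>R x) x / e \<gamma> (v + s *\<^sub>R x))) (at s within S)"
proof -
  have "((\<lambda>v. exp (\<L> \<gamma> v)) has_derivative dderiv (e \<gamma>) u) (at u)" for u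
    using holo_on_has_derivative[OF factor_holo[OF assms], of u] by (simp add: exp_log[OF assms])
  from continuous_logarithm_has_derivative[OF log_continuous[OF assms] this]
  have L: "(\<L> \<gamma> has_derivative (\<lambda>w. dderiv (e \<gamma>) u w / e \<gamma> u)) (at u)" for u
    by (simp add: exp_log[OF assms])
  have "((\<lambda>s. v + s *\<^sub>R x) has_derivative (\<lambda>h. h *\<^sub>R x)) (at s within S)"
    by (auto intro!: derivative_eq_intros)
  from has_derivative_compose[OF this L]
  have "((\<lambda>s. \<L> \<gamma> (v + s *\<^sub>R x)) has_vector_derivative
    dderiv (e \<gamma>) (v + s *\<^sub>R x) x / e \<gamma> (v + s *\<^sub>R x)) (at s within S)"
    unfolding has_vector_derivative_def
    by (simp add: linear_scale[OF has_derivative_linear[OF holo_on_has_derivative[OF factor_holo[OF assms]]]]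
        scaleR_conv_of_real[where 'a = complex])
  from bounded_linear.has_vector_derivative[OF bounded_linear_Im this] show ?thesis .
qed

text \<open>
  Green's formula on the parallelogram spanned by \<open>\<gamma>\<close> and \<open>\<delta>\<close>: the integral of \<open>d alpha\<close> is a
  period of the line bundle.
\<close>

lemma chern_lower_bound:
  assumes \<gamma>: "\<gamma> \<in> \<Lambda>" and \<delta>: "\<delta> \<in> \<Lambda>" and m: "\<And>u. m \<le> 4 * Im (lev u \<delta> \<gamma>)"
  shows "m \<le> 2 * real k * Im (chern \<gamma> \<delta> v)"
proof -
  define p where "p s t = v + s *\<^sub>R \<gamma> + t *\<^sub>R \<delta>" for s t
  have cont_p: "continuous_on S (\<lambda>t. p s t)" "continuous_on T (\<lambda>x. p (fst x) (snd x))" for s S T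
    unfolding p_def by (intro continuous_intros)+
  define \<Phi> where "\<Phi> s = integral (cbox 0 1) (\<lambda>t. alpha (p s t) \<delta>)" for s
  define \<Phi>' where "\<Phi>' s = integral (cbox 0 1) (\<lambda>t. dalpha (p s t) \<gamma> \<delta>)" for s
  have int_alpha: "(\<lambda>t. alpha (p s t) y) integrable_on cbox 0 1" for s y
    by (intro integrable_continuous continuous_on_compose2[OF continuous_on_alpha[of UNIV] cont_p(1)]) auto
  have int_dalpha: "(\<lambda>t. dalpha (p s t) x y) integrable_on cbox 0 1" for s x y
    by (intro integrable_continuous continuous_on_compose2[OF continuous_on_dalpha[of UNIV] cont_p(1)]) auto
  have int_lev: "(\<lambda>t. 4 * Im (lev (p s t) x y)) integrable_on cbox 0 1" for s x y
    by (intro integrable_continuous continuous_intros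
        continuous_on_compose2[OF continuous_on_lev[of UNIV] cont_p(1)]) auto
  have \<Phi>: "(\<Phi> has_vector_derivative \<Phi>' s) (at s within UNIV)" for s
    unfolding \<Phi>_def \<Phi>'_def
  proof (rule leibniz_rule_vector_derivative)
    fix s t
    show "((\<lambda>s. alpha (p s t) \<delta>) has_vector_derivative dalpha (p s t) \<gamma> \<delta>) (at s within UNIV)"
      using alpha_has_vector_derivative[of "v + t *\<^sub>R \<delta>" \<gamma> \<delta> s UNIV] by (simp add: p_def algebra_simps)
  next
    show "continuous_on (UNIV \<times> cbox 0 1) (\<lambda>(s, t). dalpha (p s t) \<gamma> \<delta>)"
      unfolding split_beta
      by (rule continuous_on_compose2[OF continuous_on_dalpha[of UNIV] cont_p(2)]) auto
  qed (use int_alpha in auto)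
  \<comment> \<open>\<open>\<Phi>\<close> integrates \<open>alpha\<close> over the edge parallel to
    \<open>\<delta>\<close>, and \<open>b\<close> accumulates the difference of the two edges
    parallel to \<open>\<gamma>\<close>. Since only a lower bound is wanted, the mean value theorem
    for \<open>\<Phi> - b\<close> replaces the outer integration.\<close>
  define b where "b s = 2 * real k * Im (\<L> \<delta> (v + s *\<^sub>R \<gamma>))" for s
  define b' where "b' s = 2 * real k * Im (dderiv (e \<delta>) (v + s *\<^sub>R \<gamma>) \<gamma> / e \<delta> (v + s *\<^sub>R \<gamma>))" for s
  have b: "(b has_vector_derivative b' s) (at s within UNIV)" for s
    unfolding b_def b'_def by (rule has_vector_derivative_mult_right[OF log_has_vector_derivative[OF \<delta>]])
  have lower: "m \<le> \<Phi>' s - b' s" for s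
  proof -
    have "((\<lambda>t. dalpha (p s t) \<delta> \<gamma>) has_integral alpha (p s 1) \<gamma> - alpha (p s 0) \<gamma>) {0..1}"
      unfolding p_def
      by (rule fundamental_theorem_of_calculus) (use alpha_has_vector_derivative in auto)
    moreover have "alpha (p s 1) \<gamma> - alpha (p s 0) \<gamma> = b' s"
      using alpha_shift[OF \<delta>, of "v + s *\<^sub>R \<gamma>" \<gamma>] by (simp add: p_def b'_def)
    ultimately have "b' s = integral (cbox 0 1) (\<lambda>t. dalpha (p s t) \<delta> \<gamma>)"
      by (simp add: integral_unique)
    then have "\<Phi>' s - b' s = integral (cbox 0 1) (\<lambda>t. dalpha (p s t) \<gamma> \<delta> - dalpha (p s t) \<delta> \<gamma>)"
      unfolding \<Phi>'_def by (simp only: integral_diff[OF int_dalpha int_dalpha])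
    also have "\<dots> = integral (cbox 0 1) (\<lambda>t. 4 * Im (lev (p s t) \<delta> \<gamma>))"
      by (simp only: dalpha_antisym)
    also have "\<dots> \<ge> integral (cbox 0 1) (\<lambda>t::real. m)"
      by (rule integral_le[OF _ int_lev m]) (rule integrable_const)
    finally show ?thesis by simp
  qed
  have "((\<lambda>s. \<Phi> s - b s) has_real_derivative \<Phi>' s - b' s) (at s)" for s
    unfolding has_real_derivative_iff_has_vector_derivative
    using has_vector_derivative_diff[OF \<Phi> b] .
  then obtain z where "(\<Phi> 1 - b 1) - (\<Phi> 0 - b 0) = (1 - 0) * (\<Phi>' z - b' z)"
    using MVT2[of 0 1 "\<lambda>s. \<Phi> s - b s" "\<lambda>s. \<Phi>' s - b' s"] by auto
  with lower[of z] have "m \<le> \<Phi> 1 - \<Phi> 0 - (b 1 - b 0)" by simp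
  also have "b 1 - b 0 = 2 * real k * Im (\<L> \<delta> (v + \<gamma>) - \<L> \<delta> v)"
    by (simp add: b_def algebra_simps)
  also have "\<Phi> 1 - \<Phi> 0 = integral {0..1} (\<lambda>t. alpha (p 1 t) \<delta> - alpha (p 0 t) \<delta>)"
    unfolding \<Phi>_def by (simp add: integral_diff int_alpha[simplified])
  also have "(\<lambda>t. alpha (p 1 t) \<delta> - alpha (p 0 t) \<delta>) =
      (\<lambda>t. 2 * real k * Im (dderiv (e \<gamma>) (v + t *\<^sub>R \<delta>) \<delta> / e \<gamma> (v + t *\<^sub>R \<delta>)))"
  proof
    fix t
    have "p 1 t = p 0 t + \<gamma>" "p 0 t = v + t *\<^sub>R \<delta>" by (simp_all add: p_def algebra_simps)
    then show "alpha (p 1 t) \<delta> - alpha (p 0 t) \<delta> =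
        2 * real k * Im (dderiv (e \<gamma>) (v + t *\<^sub>R \<delta>) \<delta> / e \<gamma> (v + t *\<^sub>R \<delta>))"
      using alpha_shift[OF \<gamma>, of "p 0 t" \<delta>] by simp
  qed
  also have "integral {0..1} \<dots> =
      2 * real k * Im (\<L> \<gamma> (v + 1 *\<^sub>R \<delta>)) - 2 * real k * Im (\<L> \<gamma> (v + 0 *\<^sub>R \<delta>))"
    by (rule integral_unique[OF fundamental_theorem_of_calculus])
       (auto intro: has_vector_derivative_mult_right[OF log_has_vector_derivative[OF \<gamma>]])
  also have "\<dots> = 2 * real k * Im (\<L> \<gamma> (v + \<delta>) - \<L> \<gamma> v)" by (simp add: algebra_simps)
  finally show ?thesis
    by (simp only: chern_def minus_complex.sel right_diff_distrib)
qed

text \<open>In general \<open>\<i> n \<gamma>\<close> is not a period; a lattice vector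
  \<open>\<delta>\<close> stands in for it, at the price of an error \<open>\<eta>\<close> bounded
  by \<open>R\<close> for every \<open>n\<close>. The main terms grow like \<open>n^2\<close> and
  the errors like \<open>n\<close>, so a negative \<open>H\<close> would contradict the nonnegative
  Levi form.\<close>

lemma pairing_nonneg:
  assumes k: "k \<ge> 1"
    and \<phi>: "is_phi \<Lambda> e \<phi>"
    and Fadd: "\<And>u v. F (u + v) = F u + F v" and Fscale: "\<And>c v. F (c *s v) = c *s F v"
    and lift: "\<And>v. \<phi> (torus_proj \<Lambda> v) = torus_proj (dual_lattice \<Lambda>) (F v)"
    and \<gamma>: "\<gamma> \<in> \<Lambda>"
  shows "Re (anti_pairing (F \<gamma>) \<gamma>) \<ge> 0"
proof (rule ccontr)
  define H where "H = Re (anti_pairing (F \<gamma>) \<gamma>)"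
  assume "\<not> ?thesis"
  then have H: "H < 0" by (simp add: H_def)
  have "linear F" by (rule linearI) (simp_all add: Fadd Fscale scaleR_vec_complex)
  then obtain K where K: "K > 0" "\<And>v. norm (F v) \<le> norm v * K"
    using linear_conv_bounded_linear bounded_linear.pos_bounded by blast
  obtain C where C: "C \<ge> 0" "\<And>v x. cmod (lev v x \<gamma>) \<le> C * norm x" using lev_bound[of \<gamma>] by blast
  have R: "R \<ge> 0" using cocompact[of 0] norm_ge_zero order_trans by blast
  define C' where "C' = CARD('n) * (R * K * norm \<gamma>)"
  have "C' \<ge> 0" using R K by (simp add: C'_def)
  \<comment> \<open>After division by \<open>n\<close>, \<open>C * R\<close> bounds the error of the
    Levi form at \<open>\<eta>\<close>, and \<open>C'\<close> that of the pairing with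
    \<open>F \<eta>\<close>.\<close>
  obtain n :: nat where n: "real n * - H > C' + C * R" using reals_Archimedean3[of "- H"] H by auto
  have "0 \<le> C' + C * R" using \<open>C' \<ge> 0\<close> C(1) R by simp
  with n have n0: "n > 0" by (cases n) auto
  have mult: "of_nat j *s \<gamma> \<in> \<Lambda>" for j
  proof (induction j)
    case (Suc j)
    have "of_nat (Suc j) *s \<gamma> = of_nat j *s \<gamma> + \<gamma>" by (simp add: vec_eq_iff algebra_simps)
    with add_subgroup_add[OF subgroup Suc \<gamma>] show ?case by (simp only:)
  qed (use add_subgroup_zero[OF subgroup] in \<open>simp add: vec_eq_iff\<close>)
  define c where "c = \<i> * (of_nat n :: complex)"
  obtain \<delta> where \<delta>: "\<delta> \<in> \<Lambda>" "norm (c *s \<gamma> - \<delta>) \<le> R" using cocompact by blast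
  define \<eta> where "\<eta> = \<delta> - c *s \<gamma>"
  have \<eta>: "norm \<eta> \<le> R" using \<delta>(2) by (simp add: \<eta>_def norm_minus_commute)
  have \<delta>_eq: "\<delta> = c *s \<gamma> + \<eta>" by (simp add: \<eta>_def)
  have "4 * (real n * - (C * R)) \<le> 4 * Im (lev u \<delta> (of_nat n *s \<gamma>))" for u
  proof -
    obtain r where r: "r \<ge> 0" "lev u \<gamma> \<gamma> = of_real r"
      using levi_self unfolding lev_def by blast
    have "Im (lev u \<delta> (of_nat n *s \<gamma>)) = real n * (real n * r + Im (lev u \<eta> \<gamma>))"
      by (simp add: \<delta>_eq lev_add_left lev_scale_left lev_scale_right r c_def algebra_simps)
    moreover have "\<bar>Im (lev u \<eta> \<gamma>)\<bar> \<le> C * R"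
      using C(2)[of u \<eta>] mult_left_mono[OF \<eta> C(1)] abs_Im_le_cmod[of "lev u \<eta> \<gamma>"] by linarith
    then have "- (C * R) \<le> real n * r + Im (lev u \<eta> \<gamma>)"
      using mult_nonneg_nonneg[OF of_nat_0_le_iff r(1), of n] by linarith
    from mult_left_mono[OF this of_nat_0_le_iff[of n]]
    have "real n * - (C * R) \<le> real n * (real n * r + Im (lev u \<eta> \<gamma>))" .
    ultimately show ?thesis by linarith
  qed
  from chern_lower_bound[OF mult \<delta>(1) this]
  have low: "4 * (real n * - (C * R)) \<le> 2 * real k * Im (chern (of_nat n *s \<gamma>) \<delta> 0)" .
  have "Im (chern (of_nat n *s \<gamma>) \<delta> 0) = 2 * pi * Im (anti_pairing (F \<delta>) (of_nat n *s \<gamma>))"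
    by (simp add: chern_eq[OF \<phi> Fscale lift mult \<delta>(1)])
  also have "Im (anti_pairing (F \<delta>) (of_nat n *s \<gamma>)) = real n * (real n * H + Im (anti_pairing (F \<eta>) \<gamma>))"
    by (simp add: \<delta>_eq Fadd Fscale anti_pairing_add_left anti_pairing_scale_left anti_pairing_scale_right
        c_def H_def algebra_simps)
  finally have chern: "Im (chern (of_nat n *s \<gamma>) \<delta> 0) =
      2 * pi * (real n * (real n * H + Im (anti_pairing (F \<eta>) \<gamma>)))" .
  have "\<bar>Im (anti_pairing (F \<eta>) \<gamma>)\<bar> \<le> C'"
  proof -
    have "norm (F \<eta>) \<le> R * K" using K(2)[of \<eta>] mult_right_mono[OF \<eta>, of K] K(1) by linarith
    then have "CARD('n) * (norm (F \<eta>) * norm \<gamma>) \<le> C'"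
      unfolding C'_def by (intro mult_left_mono mult_right_mono) auto
    then show ?thesis
      using anti_pairing_le[of "F \<eta>" \<gamma>] abs_Im_le_cmod[of "anti_pairing (F \<eta>) \<gamma>"] by linarith
  qed
  then have "real n * H + Im (anti_pairing (F \<eta>) \<gamma>) < - (C * R)" using n by linarith
  then have "real n * (real n * H + Im (anti_pairing (F \<eta>) \<gamma>)) < real n * - (C * R)"
    using n0 by (intro mult_strict_left_mono) auto
  moreover define X where "X = real n * (real n * H + Im (anti_pairing (F \<eta>) \<gamma>))"
  ultimately have X: "X < real n * - (C * R)" by simp
  have X0: "X \<le> 0" using X C(1) R by (meson less_le_trans less_imp_le mult_nonneg_nonneg mult_nonneg_nonpos neg_le_0_iff_le of_nat_0_le_iff)
  \<comment> \<open>The lower bound carries the factor 4 and the Chern class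
    \<open>4 * pi * k\<close>. As \<open>X\<close> is not positive and \<open>pi * k\<close> is at
    least 1, dropping \<open>pi * k\<close> only increases the value.\<close>
  have "1 * 1 \<le> real k * pi" using k pi_ge_two by (intro mult_mono) auto
  then have "4 * (real k * pi) * X \<le> 4 * 1 * X" using X0 by (intro mult_right_mono_neg) auto
  also have "\<dots> < 4 * (real n * - (C * R))" using X by linarith
  also have "\<dots> \<le> 2 * real k * (2 * pi * X)" using low unfolding chern X_def .
  finally show False by simp
qed

end

section \<open>Principal polarisations\<close>

lemma principal_polarisation_map:
  fixes \<Lambda> :: "(complex^'n) set"
  assumes \<Lambda>: "add_subgroup \<Lambda>" and cocompact: "\<And>v. \<exists>\<gamma>\<in>\<Lambda>. norm (v - \<gamma>) \<le> R"
    and disc: "0 < \<delta>" "\<And>x. x \<in> \<Lambda> \<Longrightarrow> norm x < \<delta> \<Longrightarrow> x = 0"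
    and disc_dual: "0 < \<epsilon>" "\<And>x. x \<in> dual_lattice \<Lambda> \<Longrightarrow> norm x < \<epsilon> \<Longrightarrow> x = 0"
    and pol: "admits_principal_polarisation \<Lambda>"
  obtains F where "\<And>u v. F (u + v) = F u + F v" "\<And>c v. F (c *s v) = c *s F v"
    "F ` \<Lambda> = dual_lattice \<Lambda>"
    "\<And>\<gamma> \<delta>. \<gamma> \<in> \<Lambda> \<Longrightarrow> \<delta> \<in> \<Lambda> \<Longrightarrow> Im (anti_pairing (F \<delta>) \<gamma>) = - Im (anti_pairing (F \<gamma>) \<delta>)"
    "\<And>\<gamma>. \<gamma> \<in> \<Lambda> \<Longrightarrow> Re (anti_pairing (F \<gamma>) \<gamma>) \<ge> 0"
proof -
  obtain e e' \<phi> where e: "ample \<Lambda> e" and e': "e' \<in> ns_class \<Lambda> e"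
    and \<phi>': "is_phi \<Lambda> e' \<phi>" and iso: "\<phi> \<in> torus_isos \<Lambda> (dual_lattice \<Lambda>)"
    using pol unfolding admits_principal_polarisation_def polarisations_def principal_def by blast
  have lb: "line_bundle \<Lambda> e" using e by (simp add: ample_def)
  have \<phi>: "is_phi \<Lambda> e \<phi>" by (rule is_phi_ns_class[OF lb e' \<phi>'])
  obtain F where Fadd: "\<And>u v. F (u + v) = F u + F v" and Fscale: "\<And>c v. F (c *s v) = c *s F v"
    and lift: "\<And>v. \<phi> (torus_proj \<Lambda> v) = torus_proj (dual_lattice \<Lambda>) (F v)"
    and image: "F ` \<Lambda> = dual_lattice \<Lambda>"
    using torus_iso_lift[OF \<Lambda> add_subgroup_dual_lattice disc disc_dual iso] by blast
  obtain k where k: "k \<ge> 1" "very_ample \<Lambda> (bundle_power e k)"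
    using e by (auto simp: ample_def)
  obtain N :: nat and \<theta> :: "nat \<Rightarrow> complex^'n \<Rightarrow> complex" where \<theta>: "\<And>i. i \<le> N \<Longrightarrow> \<theta> i \<in> sections \<Lambda> (bundle_power e k)"
    "\<And>v. \<exists>i\<le>N. \<theta> i v \<noteq> 0"
    using k(2) unfolding very_ample_def by blast
  define \<theta>' where "\<theta>' i = (if i \<le> N then \<theta> i else (\<lambda>v. 0))" for i
  have "\<exists>g. continuous_on UNIV g \<and> (\<forall>v. e \<gamma> v = exp (g v))" if "\<gamma> \<in> \<Lambda>" for \<gamma>
    using continuous_logarithm_entire[of "e \<gamma>"] lb that unfolding line_bundle_def by metis
  then obtain \<L> where \<L>: "\<And>\<gamma>. \<gamma> \<in> \<Lambda> \<Longrightarrow> continuous_on UNIV (\<L> \<gamma>)"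
    "\<And>\<gamma> v. \<gamma> \<in> \<Lambda> \<Longrightarrow> exp (\<L> \<gamma> v) = e \<gamma> v"
    by metis
  interpret theta_map \<Lambda> R e \<L> k N \<theta>'
  proof
    show "\<theta>' i \<in> sections \<Lambda> (bundle_power e k)" if "i \<le> N" for i
      using \<theta>(1)[OF that] that by (simp add: \<theta>'_def)
    show "holo_on UNIV (\<theta>' i)" for i
      using \<theta>(1)[of i] by (auto simp: \<theta>'_def sections_def holo_on_const)
    show "\<exists>i\<le>N. \<theta>' i v \<noteq> 0" for v
      using \<theta>(2)[of v] by (auto simp: \<theta>'_def)
  qed (use \<Lambda> cocompact lb \<L> in auto)
  show ?thesis
    by (rule that[OF Fadd Fscale image pairing_antisym[OF \<phi> Fscale lift]
          pairing_nonneg[OF k(1) \<phi> Fadd Fscale lift]])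
qed

section \<open>Lattices generated by the columns of a matrix\<close>

lemma add_subgroup_column_lattice:
  fixes L :: "complex^'m^'n"
  shows "add_subgroup (column_lattice L)"
proof -
  have "0 = L *v (\<chi> j. of_int ((0 :: int^'m) $ j))" by (simp add: vec_eq_iff matrix_vector_mult_def)
  moreover have "L *v (\<chi> j. of_int (k $ j)) - L *v (\<chi> j. of_int (l $ j)) = L *v (\<chi> j. of_int ((k - l) $ j))"
    for k l :: "int^'m"
    by (simp add: vec_eq_iff matrix_vector_mult_def algebra_simps sum_subtractf)
  ultimately show ?thesis unfolding add_subgroup_def column_lattice_def by blast
qed

text \<open>Rounding the real coordinates down leaves each column with a fractional
  coefficient.\<close>

lemma column_lattice_cocompact:
  fixes L :: "complex^'m^'n"
  assumes span: "\<And>v. \<exists>t :: real^'m. v = L *v (\<chi> j. of_real (t $ j))"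
  shows "\<exists>\<gamma>\<in>column_lattice L. norm (v - \<gamma>) \<le> (\<Sum>j\<in>UNIV. norm (column j L))"
proof -
  obtain t :: "real^'m" where t: "v = L *v (\<chi> j. of_real (t $ j))" using span by blast
  define l :: "int^'m" where "l = (\<chi> j. \<lfloor>t $ j\<rfloor>)"
  have "v - L *v (\<chi> j. of_int (l $ j)) = L *v (\<chi> j. of_real (frac (t $ j)))"
    by (simp add: t l_def vec_eq_iff matrix_vector_mult_def algebra_simps sum_subtractf[symmetric] frac_def)
  also have "\<dots> = (\<Sum>j\<in>UNIV. of_real (frac (t $ j)) *s column j L)"
    by (simp add: matrix_mult_sum)
  also have "norm \<dots> \<le> (\<Sum>j\<in>UNIV. norm (column j L))"
  proof (rule sum_norm_le)
    fix j
    show "norm (complex_of_real (frac (t $ j)) *s column j L) \<le> norm (column j L)"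
      unfolding norm_smult_vec using frac_lt_1[of "t $ j"] frac_ge_0[of "t $ j"]
      by (simp add: mult_left_le_one_le)
  qed
  finally show ?thesis by (auto simp: column_lattice_def)
qed

lemma column_in_lattice:
  fixes L :: "complex^'m^'n"
  shows "column j L \<in> column_lattice L"
proof -
  have "column j L = L *v (\<chi> i. of_int ((axis j 1 :: int^'m) $ i))"
    by (simp add: vec_eq_iff matrix_vector_mult_def column_def axis_def if_distrib[where f = "\<lambda>x. _ * x"]
        if_distrib[where f = of_int] cong: if_cong)
  then show ?thesis by (auto simp: column_lattice_def)
qed

text \<open>For a short \<open>w\<close> the imaginary part of the pairing with each column is an
  integer of modulus below 1, hence 0. Since the columns span over the reals, it vanishes on all
  vectors, and at \<open>- \<i>\<close> times \<open>w\<close> it is the squared norm of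
  \<open>w\<close>.\<close>

lemma dual_column_lattice_discrete:
  fixes L :: "complex^'m^'n"
  assumes span: "\<And>v. \<exists>t :: real^'m. v = L *v (\<chi> j. of_real (t $ j))"
  shows "\<exists>\<epsilon>>0. \<forall>w\<in>dual_lattice (column_lattice L). norm w < \<epsilon> \<longrightarrow> w = 0"
proof -
  define K where "K = real CARD('n) * ((\<Sum>j\<in>UNIV. norm (column j L)) + 1)"
  have K: "K > 0" unfolding K_def by (intro mult_pos_pos add_nonneg_pos sum_nonneg) auto
  have "w = 0" if w: "w \<in> dual_lattice (column_lattice L)" and small: "norm w < 1 / K" for w
  proof -
    have zero: "Im (anti_pairing w (column j L)) = 0" for j
    proof -
      have "norm (column j L) \<le> (\<Sum>j\<in>UNIV. norm (column j L)) + 1"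
        using member_le_sum[of j UNIV "\<lambda>j. norm (column j L)"] by simp
      then have "real CARD('n) * (norm w * norm (column j L)) \<le> norm w * K"
        unfolding K_def by (simp add: mult.left_commute mult_left_mono)
      also have "\<dots> < 1" using small K by (simp add: field_simps)
      finally have "\<bar>Im (anti_pairing w (column j L))\<bar> < 1"
        using anti_pairing_le[of w "column j L"] abs_Im_le_cmod[of "anti_pairing w (column j L)"] by linarith
      moreover have "Im (anti_pairing w (column j L)) \<in> \<int>"
        using w column_in_lattice by (auto simp: dual_lattice_def)
      ultimately show ?thesis using Ints_nonzero_abs_less1 by blast
    qed
    have all: "Im (anti_pairing w v) = 0" for v
    proof -
      obtain t :: "real^'m" where t: "v = L *v (\<chi> j. of_real (t $ j))" using span by blast
      have sum: "anti_pairing w (\<Sum>j\<in>J. x j) = (\<Sum>j\<in>J. anti_pairing w (x j))" for J and x :: "'m \<Rightarrow> complex^'n"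
        by (induction J rule: infinite_finite_induct) (auto simp: anti_pairing_add_right, auto simp: anti_pairing_def)
      show ?thesis unfolding t matrix_mult_sum sum
        by (simp add: anti_pairing_scale_right zero)
    qed
    have "Im (cnj (- \<i>) * anti_pairing w w) = 0"
      using all[of "(- \<i>) *s w"] by (simp only: anti_pairing_scale_right)
    moreover have "anti_pairing w w = of_real (\<Sum>i\<in>UNIV. (cmod (w $ i))\<^sup>2)"
      by (simp add: anti_pairing_def complex_norm_square[symmetric])
    ultimately have "(\<Sum>i\<in>UNIV. (cmod (w $ i))\<^sup>2) = 0" by simp
    then show ?thesis by (simp add: sum_nonneg_eq_0_iff vec_eq_iff)
  qed
  then show ?thesis using K by (intro exI[of _ "1 / K"]) auto
qed

section \<open>Algebraic independence\<close>

text \<open>Degree two is what occurs below: the entries of an endomorphism are linear in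
  \<open>a\<close>, \<open>b\<close>, \<open>c\<close>, and they get multiplied by \<open>a\<close>
  or \<open>b\<close>.\<close>

lemma alg_independent3_quadratic:
  fixes k0 ka kb kc kaa kab kac kbb kbc kcc :: rat
  assumes "alg_independent3 a b c"
    and eq: "of_rat k0 + of_rat ka * a + of_rat kb * b + of_rat kc * c + of_rat kaa * (a * a)
      + of_rat kab * (a * b) + of_rat kac * (a * c) + of_rat kbb * (b * b) + of_rat kbc * (b * c)
      + of_rat kcc * (c * c) = 0"
  shows "k0 = 0 \<and> ka = 0 \<and> kb = 0 \<and> kc = 0 \<and> kaa = 0 \<and> kab = 0 \<and> kac = 0 \<and> kbb = 0 \<and> kbc = 0 \<and> kcc = 0"
proof -
  define xs :: "((nat \<times> nat \<times> nat) \<times> rat) list" where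
    "xs = [((0,0,0),k0), ((1,0,0),ka), ((0,1,0),kb), ((0,0,1),kc), ((2,0,0),kaa), ((1,1,0),kab),
       ((1,0,1),kac), ((0,2,0),kbb), ((0,1,1),kbc), ((0,0,2),kcc)]"
  define p where "p m = (case map_of xs m of None \<Rightarrow> 0 | Some k \<Rightarrow> k)" for m
  define S where "S = set (map fst xs)"
  have "p m = 0" if "m \<notin> S" for m
    using that map_of_eq_None_iff[of xs m] by (simp add: p_def S_def)
  then have sub: "{m. p m \<noteq> 0} \<subseteq> S" by blast
  have fin: "finite S" by (simp add: S_def)
  have "(\<Sum>(i, j, k)\<in>{m. p m \<noteq> 0}. of_rat (p (i, j, k)) * a ^ i * b ^ j * c ^ k) =
      (\<Sum>(i, j, k)\<in>S. of_rat (p (i, j, k)) * a ^ i * b ^ j * c ^ k)"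
    by (rule sum.mono_neutral_left[OF fin sub]) auto
  also have "\<dots> = 0"
    using eq by (simp add: S_def xs_def p_def power2_eq_square algebra_simps)
  finally have "\<And>m. p m = 0"
    using assms(1) finite_subset[OF sub fin] unfolding alg_independent3_def by blast
  from this[of "(0,0,0)"] this[of "(1,0,0)"] this[of "(0,1,0)"] this[of "(0,0,1)"] this[of "(2,0,0)"]
    this[of "(1,1,0)"] this[of "(1,0,1)"] this[of "(0,2,0)"] this[of "(0,1,1)"] this[of "(0,0,2)"]
  show ?thesis by (simp add: p_def xs_def)
qed

text \<open>The rational span of the lattice of \<open>S\<close>, and also of that of its dual in the coordinates \<open>v\<^sub>3 / 3\<close>, \<open>v\<^sub>4\<close>.\<close>

definition rational_span :: "complex \<Rightarrow> complex \<Rightarrow> complex \<Rightarrow> complex \<Rightarrow> complex \<Rightarrow> bool" where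
  "rational_span a b c x1 x2 \<longleftrightarrow> (\<exists>p q r s. x1 = of_rat p * a + of_rat q * b + of_rat r \<and>
                                     x2 = of_rat p * b + of_rat q * c + of_rat s)"

text \<open>The \<open>g\<close> form a 2 by 2 matrix whose columns are the images of the basis
  vectors; the last assumption concerns the image of the column \<open>(a, b)\<close> of the period
  matrix. Comparing monomials of degree two kills the linear parts of the entries, and degree one
  then makes the matrix scalar.\<close>

lemma rational_endomorphism_scalar:
  assumes alg: "alg_independent3 a b c"
    and 1: "rational_span a b c g11 g21" and 2: "rational_span a b c g12 g22"
    and 3: "rational_span a b c (a * g11 + b * g12) (a * g21 + b * g22)"
  shows "\<exists>q. g11 = of_rat q \<and> g22 = of_rat q \<and> g12 = 0 \<and> g21 = 0"
proof -
  obtain p1 p2 q1 q2 where g1: "g11 = of_rat p1 * a + of_rat p2 * b + of_rat q1"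
    "g21 = of_rat p1 * b + of_rat p2 * c + of_rat q2" using 1 unfolding rational_span_def by blast
  obtain p3 p4 q3 q4 where g2: "g12 = of_rat p3 * a + of_rat p4 * b + of_rat q3"
    "g22 = of_rat p3 * b + of_rat p4 * c + of_rat q4" using 2 unfolding rational_span_def by blast
  obtain p5 p6 q5 q6 where g3: "a * g11 + b * g12 = of_rat p5 * a + of_rat p6 * b + of_rat q5"
    "a * g21 + b * g22 = of_rat p5 * b + of_rat p6 * c + of_rat q6" using 3 unfolding rational_span_def by blast
  have 1: "p1 = 0 \<and> p2 + p3 = 0 \<and> p4 = 0 \<and> q1 - p5 = 0 \<and> q3 - p6 = 0 \<and> q5 = 0"
    using alg_independent3_quadratic[OF alg, of "- q5" "q1 - p5" "q3 - p6" 0 p1 "p2 + p3" 0 p4 0 0] g3(1)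
    by (simp add: g1 g2 of_rat_add of_rat_diff of_rat_minus algebra_simps)
  have 2: "p1 + 0 = 0 \<and> p2 = 0 \<and> p3 = 0 \<and> q2 = 0 \<and> q4 - p5 = 0 \<and> p6 = 0"
    using alg_independent3_quadratic[OF alg, of "- q6" q2 "q4 - p5" "- p6" 0 p1 p2 p3 p4 0] g3(2)
    by (simp add: g1 g2 of_rat_add of_rat_diff of_rat_minus algebra_simps)
  show ?thesis by (rule exI[of _ q1]) (use 1 2 in \<open>simp add: g1 g2\<close>)
qed

lemma unimodular_form_indefinite:
  fixes x y t s k :: int
  assumes det: "(y * y - t * x) * k = 1" and t: "t = 3 * s"
    and nonneg: "\<And>m n. x * (m * m) + 2 * y * (m * n) + t * (n * n) \<ge> 0"
  shows False
proof -
  have "y * y - t * x = 1 \<or> y * y - t * x = -1" using det by (auto simp: zmult_eq_1_iff)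
  then show False
  proof
    assume 1: "y * y - t * x = 1"
    have "x \<ge> 0" using nonneg[of 1 0] by simp
    \<comment> \<open>At \<open>(- y, x)\<close> the form takes the value \<open>x\<close> times its
      determinant, which is -1 here.\<close>
    moreover have "x * (t * x - y * y) \<ge> 0" using nonneg[of "- y" x] by (simp add: algebra_simps)
    then have "x * (-1) \<ge> 0" using 1 by (metis minus_diff_eq)
    ultimately have x: "x = 0" by simp
    then have "y * y = 1" using 1 by simp
    \<comment> \<open>Once \<open>x = 0\<close>, the mixed term decides the sign; the factor
      \<open>\<bar>t\<bar> + 1\<close> makes it outweigh \<open>t\<close>.\<close>
    moreover have "0 \<le> - 2 * (y * y) * (\<bar>t\<bar> + 1) + t"
      using nonneg[of "- y * (\<bar>t\<bar> + 1)" 1] x by (simp add: algebra_simps)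
    ultimately show False by simp
  next
    assume "y * y - t * x = -1"
    then have "(y * y + 1) mod 3 = 0" by (simp add: t) (metis add.commute add_diff_cancel_left' diff_eq_eq
        minus_diff_eq mod_mult_self1_is_0 mult.assoc uminus_add_conv_diff)
    moreover have "(y * y + 1) mod 3 = ((y mod 3) * (y mod 3) + 1) mod 3"
      by (metis mod_add_left_eq mod_mult_eq)
    moreover have "y mod 3 = 0 \<or> y mod 3 = 1 \<or> y mod 3 = 2" by arith
    ultimately show False by auto
  qed
qed

section \<open>The lattice of \<open>A\<close>\<close>

locale period_matrix =
  fixes a b c :: complex
  assumes pos_def: "pos_def_matrix (map_matrix Im (matrix_Z a b c))"
begin

definition D :: real where "D = Im a * Im c - Im b * Im b"

lemma Im_a_pos: "Im a > 0" and D_pos: "D > 0"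
proof -
  have pos: "0 < x \<bullet> (map_matrix Im (matrix_Z a b c) *v x)" if "x \<noteq> 0" for x
    using pos_def that by (simp add: pos_def_matrix_def)
  show a: "Im a > 0"
    using pos[of "vector [1, 0]"]
    by (simp add: vec_eq_iff forall_2 inner_vec_def sum_2 matrix_vector_mult_def matrix_Z_def)
  have "0 < Im a * D"
    using pos[of "vector [- Im b, Im a]"] a
    by (simp add: vec_eq_iff forall_2 inner_vec_def sum_2 matrix_vector_mult_def matrix_Z_def
        D_def algebra_simps)
  with a show "D > 0" by (simp add: zero_less_mult_iff)
qed

lemma Im_c_pos: "Im c > 0"
proof -
  have "0 < Im a * Im c" using D_pos zero_le_square[of "Im b"] unfolding D_def by linarith
  with Im_a_pos show ?thesis by (simp add: zero_less_mult_iff)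
qed

abbreviation "\<Lambda> \<equiv> column_lattice (matrix_A a b c)"

lemma Im_eqs_unique:
  assumes "Im a * x + Im b * y = 0" "Im b * x + Im c * y = 0"
  shows "x = 0 \<and> y = 0"
proof -
  have "D * x = Im c * (Im a * x + Im b * y) - Im b * (Im b * x + Im c * y)"
    "D * y = Im a * (Im b * x + Im c * y) - Im b * (Im a * x + Im b * y)"
    by (simp_all add: D_def algebra_simps)
  then show ?thesis using D_pos unfolding assms by simp
qed

section \<open>Real coordinates, the dual lattice and the isomorphism\<close>

lemma real_coordinates:
  "\<exists>P Q R S :: real. x1 = a * of_real P + b * of_real Q + of_real R \<and>
                     x2 = b * of_real P + c * of_real Q + of_real S"
proof -
  define P Q where "P = (Im c * Im x1 - Im b * Im x2) / D" and "Q = (Im a * Im x2 - Im b * Im x1) / D"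
  have "Im a * P + Im b * Q = (D * Im x1) / D" "Im b * P + Im c * Q = (D * Im x2) / D"
    unfolding P_def Q_def times_divide_eq_right add_divide_distrib[symmetric]
    by (simp_all add: D_def algebra_simps)
  then have "Im a * P + Im b * Q = Im x1" "Im b * P + Im c * Q = Im x2" using D_pos by simp_all
  then have "x1 = a * of_real P + b * of_real Q + of_real (Re x1 - Re a * P - Re b * Q) \<and>
        x2 = b * of_real P + c * of_real Q + of_real (Re x2 - Re b * P - Re c * Q)"
    by (simp add: complex_eq_iff)
  then show ?thesis by blast
qed

lemma lattice_spans: "\<exists>t :: real^8. v = matrix_A a b c *v (\<chi> j. of_real (t $ j))"
proof -
  obtain P Q R S :: real where 1: "v $ 1 = a * of_real P + b * of_real Q + of_real R"
    "v $ 2 = b * of_real P + c * of_real Q + of_real S" using real_coordinates by blast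
  obtain P' Q' R' S' :: real where 2: "v $ 3 / 3 = a * of_real P' + b * of_real Q' + of_real R'"
    "v $ 4 = b * of_real P' + c * of_real Q' + of_real S'" using real_coordinates by blast
  have 3: "v $ 3 = 3 * (a * of_real P' + b * of_real Q' + of_real R')" using 2(1) by (simp add: field_simps)
  show ?thesis
    \<comment> \<open>\<open>3 * Q'\<close> and \<open>S / 3\<close> compensate for the columns with
      entries \<open>c / 3\<close> and \<open>3\<close>.\<close>
    by (rule exI[of _ "vector [P, Q, P', 3 * Q', R, S / 3, R', S']"])
       (simp add: vec_eq_iff forall_4 matrix_vector_mult_def matrix_A_def sum_8 vector_4' vector_8'
          1 2(2) 3 algebra_simps)
qed

text \<open>
  Multiplication by \<open>Im Z\<close> carries the real coordinates of an antilinear functional that are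
  dual to the columns of \<open>[Z, 1]\<close> to coordinates with respect to these columns.
\<close>

lemma dual_coordinates:
  fixes P Q R S :: real
  shows "Im x1 = P \<and> Im x2 = Q \<and> Im (x1 * cnj a + x2 * cnj b) = - R \<and> Im (x1 * cnj b + x2 * cnj c) = - S
    \<longleftrightarrow> of_real (Im a) * x1 + of_real (Im b) * x2 = a * of_real P + b * of_real Q + of_real R \<and>
        of_real (Im b) * x1 + of_real (Im c) * x2 = b * of_real P + c * of_real Q + of_real S"
    (is "?l \<longleftrightarrow> ?r")
proof
  assume ?l
  then show ?r by (auto simp: complex_eq_iff algebra_simps)
next
  assume r: ?r
  then have "Im a * (Im x1 - P) + Im b * (Im x2 - Q) = 0" "Im b * (Im x1 - P) + Im c * (Im x2 - Q) = 0"
    by (auto simp: complex_eq_iff algebra_simps)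
  from Im_eqs_unique[OF this] have "Im x1 = P" "Im x2 = Q" by auto
  with r show ?l by (auto simp: complex_eq_iff algebra_simps)
qed

text \<open>Multiplication by \<open>Im Z\<close> in each block, followed by the exchange of the two
  factors. The second factor has the coordinate \<open>v $ 3 / 3\<close>, to which
  \<open>3 * w $ 3\<close> is dual; this accounts for the factors 3.\<close>

definition dual_to_lattice :: "complex^4^4" where
  "dual_to_lattice = vector
     [vector [0, 0, 3 * of_real (Im a), of_real (Im b)],
      vector [0, 0, 3 * of_real (Im b), of_real (Im c)],
      vector [3 * of_real (Im a), 3 * of_real (Im b), 0, 0],
      vector [of_real (Im b), of_real (Im c), 0, 0]]"

definition lattice_to_dual :: "complex^4^4" where
  "lattice_to_dual = vector
     [vector [0, 0, of_real (Im c) / (3 * of_real D), - of_real (Im b) / of_real D],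
      vector [0, 0, - of_real (Im b) / (3 * of_real D), of_real (Im a) / of_real D],
      vector [of_real (Im c) / (3 * of_real D), - of_real (Im b) / (3 * of_real D), 0, 0],
      vector [- of_real (Im b) / of_real D, of_real (Im a) / of_real D, 0, 0]]"

lemma dual_to_lattice_nth:
  "(dual_to_lattice *v w) $ 1 = of_real (Im a) * (3 * w $ 3) + of_real (Im b) * w $ 4"
  "(dual_to_lattice *v w) $ 2 = of_real (Im b) * (3 * w $ 3) + of_real (Im c) * w $ 4"
  "(dual_to_lattice *v w) $ 3 = 3 * (of_real (Im a) * w $ 1 + of_real (Im b) * w $ 2)"
  "(dual_to_lattice *v w) $ 4 = of_real (Im b) * w $ 1 + of_real (Im c) * w $ 2"
  by (simp_all add: dual_to_lattice_def matrix_vector_mult_def sum_4 vector_4' algebra_simps)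

lemma dual_to_lattice_inverse:
  "lattice_to_dual ** dual_to_lattice = mat 1" "dual_to_lattice ** lattice_to_dual = mat 1"
proof -
  define y z u d where "y = complex_of_real (Im a)" and "z = complex_of_real (Im b)"
    and "u = complex_of_real (Im c)" and "d = complex_of_real D"
  have d: "d \<noteq> 0" using D_pos by (simp add: d_def)
  have d': "d = y * u - z * z" by (simp add: d_def D_def y_def z_def u_def)
  show "lattice_to_dual ** dual_to_lattice = mat 1" "dual_to_lattice ** lattice_to_dual = mat 1"
    unfolding lattice_to_dual_def dual_to_lattice_def y_def[symmetric] z_def[symmetric] u_def[symmetric]
      d_def[symmetric]
    using d by (simp_all add: vec_eq_iff forall_4 matrix_matrix_mult_def sum_4 mat_def vector_4' field_simps)
      (simp_all add: d' algebra_simps)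
qed

lemma Im_pairing_lattice:
  fixes v w :: "complex^4"
  assumes "v $ 1 = a * of_int p + b * of_int q + of_int r"
    "v $ 2 = b * of_int p + c * of_int q + 3 * of_int s"
    "v $ 3 = 3 * a * of_int p' + b * of_int q' + 3 * of_int r'"
    "v $ 4 = b * of_int p' + c / 3 * of_int q' + of_int s'"
  shows "Im (anti_pairing w v) =
    of_int p * Im (w $ 1 * cnj a + w $ 2 * cnj b) + of_int q * Im (w $ 1 * cnj b + w $ 2 * cnj c)
    + of_int r * Im (w $ 1) + of_int s * (3 * Im (w $ 2))
    + of_int p' * Im (3 * w $ 3 * cnj a + w $ 4 * cnj b)
    + of_int q' * (Im (3 * w $ 3 * cnj b + w $ 4 * cnj c) / 3)
    + of_int r' * Im (3 * w $ 3) + of_int s' * Im (w $ 4)"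
  unfolding anti_pairing_def sum_4 assms by (simp add: field_simps)

text \<open>The eight columns give eight integrality conditions, which
  \<open>dual_coordinates\<close> turns into lattice coordinates. Integrality of
  \<open>3 * Im (w $ 2)\<close> allows a coefficient in thirds, as in the lattice of the other
  factor; this is why the factors are exchanged.\<close>

lemma mem_dual_lattice_A:
  "w \<in> dual_lattice \<Lambda> \<longleftrightarrow> dual_to_lattice *v w \<in> \<Lambda>"
proof
  assume w: "w \<in> dual_lattice \<Lambda>"
  have Int: "of_int p * Im (w $ 1 * cnj a + w $ 2 * cnj b) + of_int q * Im (w $ 1 * cnj b + w $ 2 * cnj c)
    + of_int r * Im (w $ 1) + of_int s * (3 * Im (w $ 2))
    + of_int p' * Im (3 * w $ 3 * cnj a + w $ 4 * cnj b)
    + of_int q' * (Im (3 * w $ 3 * cnj b + w $ 4 * cnj c) / 3)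
    + of_int r' * Im (3 * w $ 3) + of_int s' * Im (w $ 4) \<in> \<int>" for p q r s p' q' r' s' :: int
  proof -
    define v :: "complex^4" where "v = vector [a * of_int p + b * of_int q + of_int r,
      b * of_int p + c * of_int q + 3 * of_int s,
      3 * a * of_int p' + b * of_int q' + 3 * of_int r', b * of_int p' + c / 3 * of_int q' + of_int s']"
    note v = vector_4'[of "a * of_int p + b * of_int q + of_int r"
      "b * of_int p + c * of_int q + 3 * of_int s"
      "3 * a * of_int p' + b * of_int q' + 3 * of_int r'" "b * of_int p' + c / 3 * of_int q' + of_int s'",
      folded v_def]
    have "v \<in> \<Lambda>" unfolding mem_lattice_A using v by blast
    then have "Im (anti_pairing w v) \<in> \<int>" using w by (auto simp: dual_lattice_def)
    then show ?thesis unfolding Im_pairing_lattice[OF v] .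
  qed
  have "Im (w $ 1 * cnj a + w $ 2 * cnj b) \<in> \<int>" "Im (w $ 1 * cnj b + w $ 2 * cnj c) \<in> \<int>"
    "Im (w $ 1) \<in> \<int>" "3 * Im (w $ 2) \<in> \<int>"
    using Int[of 1 0 0 0 0 0 0 0] Int[of 0 1 0 0 0 0 0 0] Int[of 0 0 1 0 0 0 0 0] Int[of 0 0 0 1 0 0 0 0]
    by simp_all
  then obtain r' s' p' q' :: int where 1: "Im (w $ 1) = of_int p'" "3 * Im (w $ 2) = of_int q'"
    "Im (w $ 1 * cnj a + w $ 2 * cnj b) = of_int r'" "Im (w $ 1 * cnj b + w $ 2 * cnj c) = of_int s'"
    by (elim Ints_cases)
  have "Im (3 * w $ 3 * cnj a + w $ 4 * cnj b) \<in> \<int>" "Im (3 * w $ 3 * cnj b + w $ 4 * cnj c) / 3 \<in> \<int>"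
    "Im (3 * w $ 3) \<in> \<int>" "Im (w $ 4) \<in> \<int>"
    using Int[of 0 0 0 0 1 0 0 0] Int[of 0 0 0 0 0 1 0 0] Int[of 0 0 0 0 0 0 1 0] Int[of 0 0 0 0 0 0 0 1]
    by simp_all
  then obtain r s p q :: int where 2: "Im (3 * w $ 3) = of_int p" "Im (w $ 4) = of_int q"
    "Im (3 * w $ 3 * cnj a + w $ 4 * cnj b) = of_int r" "Im (3 * w $ 3 * cnj b + w $ 4 * cnj c) / 3 = of_int s"
    by (elim Ints_cases)
  have 1: "of_real (Im a) * w $ 1 + of_real (Im b) * w $ 2 =
      a * of_real (of_int p') + b * of_real (of_int q' / 3) + of_real (- of_int r') \<and>
    of_real (Im b) * w $ 1 + of_real (Im c) * w $ 2 =
      b * of_real (of_int p') + c * of_real (of_int q' / 3) + of_real (- of_int s')"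
    by (rule dual_coordinates[THEN iffD1]) (use 1 in auto)
  have 2: "of_real (Im a) * (3 * w $ 3) + of_real (Im b) * w $ 4 =
      a * of_real (of_int p) + b * of_real (of_int q) + of_real (- of_int r) \<and>
    of_real (Im b) * (3 * w $ 3) + of_real (Im c) * w $ 4 =
      b * of_real (of_int p) + c * of_real (of_int q) + of_real (- (3 * of_int s))"
    by (rule dual_coordinates[THEN iffD1]) (use 2 in auto)
  show "dual_to_lattice *v w \<in> \<Lambda>"
    unfolding mem_lattice_A dual_to_lattice_nth 1[THEN conjunct1] 1[THEN conjunct2] 2[THEN conjunct1]
      2[THEN conjunct2]
    by (rule exI[of _ p], rule exI[of _ q], rule exI[of _ p'], rule exI[of _ q'], rule exI[of _ "- r"],
        rule exI[of _ "- s"], rule exI[of _ "- r'"], rule exI[of _ "- s'"]) (simp add: algebra_simps)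
next
  assume "dual_to_lattice *v w \<in> \<Lambda>"
  then obtain p q p' q' r s r' s' :: int where *:
    "of_real (Im a) * (3 * w $ 3) + of_real (Im b) * w $ 4 = a * of_int p + b * of_int q + of_int r"
    "of_real (Im b) * (3 * w $ 3) + of_real (Im c) * w $ 4 = b * of_int p + c * of_int q + 3 * of_int s"
    "3 * (of_real (Im a) * w $ 1 + of_real (Im b) * w $ 2) = 3 * a * of_int p' + b * of_int q' + 3 * of_int r'"
    "of_real (Im b) * w $ 1 + of_real (Im c) * w $ 2 = b * of_int p' + c / 3 * of_int q' + of_int s'"
    unfolding mem_lattice_A dual_to_lattice_nth by blast
  have 1: "Im (w $ 1) = of_int p' \<and> Im (w $ 2) = of_int q' / 3 \<and>
      Im (w $ 1 * cnj a + w $ 2 * cnj b) = - of_int r' \<and> Im (w $ 1 * cnj b + w $ 2 * cnj c) = - of_int s'"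
    by (rule dual_coordinates[THEN iffD2]) (use *(3,4) in \<open>simp add: field_simps\<close>)
  have 2: "Im (3 * w $ 3) = of_int p \<and> Im (w $ 4) = of_int q \<and>
      Im (3 * w $ 3 * cnj a + w $ 4 * cnj b) = - of_int r \<and>
      Im (3 * w $ 3 * cnj b + w $ 4 * cnj c) = - (3 * of_int s)"
    by (rule dual_coordinates[THEN iffD2]) (use *(1,2) in simp)
  note conj1 = 1[THEN conjunct1] 1[THEN conjunct2, THEN conjunct1]
      1[THEN conjunct2, THEN conjunct2, THEN conjunct1] 1[THEN conjunct2, THEN conjunct2, THEN conjunct2]
  note conj2 = 2[THEN conjunct1] 2[THEN conjunct2, THEN conjunct1]
      2[THEN conjunct2, THEN conjunct2, THEN conjunct1] 2[THEN conjunct2, THEN conjunct2, THEN conjunct2]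
  show "w \<in> dual_lattice \<Lambda>"
    unfolding dual_lattice_def
  proof (intro CollectI ballI)
    fix v assume "v \<in> \<Lambda>"
    then obtain P Q P' Q' R S R' S' :: int where
      v: "v $ 1 = a * of_int P + b * of_int Q + of_int R"
         "v $ 2 = b * of_int P + c * of_int Q + 3 * of_int S"
         "v $ 3 = 3 * a * of_int P' + b * of_int Q' + 3 * of_int R'"
         "v $ 4 = b * of_int P' + c / 3 * of_int Q' + of_int S'"
      unfolding mem_lattice_A by blast
    have "Im (anti_pairing w v) =
        of_int (- P * r' - Q * s' + R * p' + S * q' - P' * r - Q' * s + R' * p + S' * q)"
      unfolding Im_pairing_lattice[OF v] conj1 conj2 by simp
    then show "Im (anti_pairing w v) \<in> \<int>" by (metis Ints_of_int)
  qed
qed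

lemma image_lattice_to_dual: "(*v) lattice_to_dual ` \<Lambda> = dual_lattice \<Lambda>"
proof (intro subset_antisym subsetI)
  fix w assume "w \<in> dual_lattice \<Lambda>"
  moreover have "w = lattice_to_dual *v (dual_to_lattice *v w)"
    by (simp add: matrix_vector_mul_assoc dual_to_lattice_inverse)
  ultimately show "w \<in> (*v) lattice_to_dual ` \<Lambda>" unfolding mem_dual_lattice_A by (rule image_eqI[rotated])
next
  fix w assume "w \<in> (*v) lattice_to_dual ` \<Lambda>"
  then obtain v where "v \<in> \<Lambda>" "w = lattice_to_dual *v v" by blast
  then show "w \<in> dual_lattice \<Lambda>"
    unfolding mem_dual_lattice_A by (simp add: matrix_vector_mul_assoc dual_to_lattice_inverse)
qed

lemma isomorphic_dual: "tori_isomorphic \<Lambda> (dual_lattice \<Lambda>)"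
  by (rule tori_isomorphic_linear[OF dual_to_lattice_inverse image_lattice_to_dual])

lemma dual_discrete: "\<exists>\<epsilon>>0. \<forall>w\<in>dual_lattice \<Lambda>. norm w < \<epsilon> \<longrightarrow> w = 0"
  by (rule dual_column_lattice_discrete[OF lattice_spans])

text \<open>Carried over from the dual lattice, where integrality of the pairing gives
  discreteness.\<close>

lemma lattice_discrete: "\<exists>\<delta>>0. \<forall>v\<in>\<Lambda>. norm v < \<delta> \<longrightarrow> v = 0"
proof -
  obtain \<epsilon> where \<epsilon>: "\<epsilon> > 0" "\<And>w. w \<in> dual_lattice \<Lambda> \<Longrightarrow> norm w < \<epsilon> \<Longrightarrow> w = 0"
    using dual_discrete by blast
  have "linear ((*v) lattice_to_dual)"
    by (rule linearI) (simp_all add: matrix_vector_right_distrib scaleR_vec_complex vector_scalar_commute)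
  then obtain K where K: "K > 0" "\<And>v. norm (lattice_to_dual *v v) \<le> norm v * K"
    using linear_conv_bounded_linear bounded_linear.pos_bounded by blast
  have "v = 0" if v: "v \<in> \<Lambda>" "norm v < \<epsilon> / K" for v
  proof -
    have "norm (lattice_to_dual *v v) < \<epsilon>"
      using K(2)[of v] v(2) K(1) by (simp add: field_simps)
    moreover have "lattice_to_dual *v v \<in> dual_lattice \<Lambda>" using v(1) image_lattice_to_dual by blast
    ultimately have "lattice_to_dual *v v = 0" using \<epsilon>(2) by blast
    then have "dual_to_lattice *v (lattice_to_dual *v v) = 0" by (simp add: matrix_vector_mult_0_right)
    then show ?thesis by (simp add: matrix_vector_mul_assoc dual_to_lattice_inverse)
  qed
  then show ?thesis using \<epsilon>(1) K(1) by (intro exI[of _ "\<epsilon> / K"]) auto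
qed

section \<open>Endomorphisms that preserve the lattice\<close>

lemma rational_span_lattice:
  assumes "v \<in> \<Lambda>"
  shows "rational_span a b c (v $ 1) (v $ 2)" "rational_span a b c (v $ 3 / 3) (v $ 4)"
proof -
  obtain p q p' q' r s r' s' :: int where v: "v $ 1 = a * of_int p + b * of_int q + of_int r"
    "v $ 2 = b * of_int p + c * of_int q + 3 * of_int s"
    "v $ 3 = 3 * a * of_int p' + b * of_int q' + 3 * of_int r'"
    "v $ 4 = b * of_int p' + c / 3 * of_int q' + of_int s'"
    using assms unfolding mem_lattice_A by blast
  show "rational_span a b c (v $ 1) (v $ 2)" unfolding rational_span_def
    by (rule exI[of _ "of_int p"], rule exI[of _ "of_int q"], rule exI[of _ "of_int r"],
        rule exI[of _ "3 * of_int s"]) (simp add: v of_rat_mult algebra_simps)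
  show "rational_span a b c (v $ 3 / 3) (v $ 4)" unfolding rational_span_def
    by (rule exI[of _ "of_int p'"], rule exI[of _ "of_int q' / 3"], rule exI[of _ "of_int r'"],
        rule exI[of _ "of_int s'"]) (simp add: v of_rat_divide field_simps)
qed

text \<open>The second basis vector of \<open>S\<close> lies in \<open>\<Lambda>\<close> only after
  multiplication by 3, a factor that the rational span ignores.\<close>

lemma rational_span_third:
  assumes "rational_span a b c (3 * x) (3 * y)"
  shows "rational_span a b c x y"
proof -
  obtain p q r s where *: "3 * x = of_rat p * a + of_rat q * b + of_rat r"
    "3 * y = of_rat p * b + of_rat q * c + of_rat s" using assms unfolding rational_span_def by blast
  show ?thesis unfolding rational_span_def
    by (rule exI[of _ "p / 3"], rule exI[of _ "q / 3"], rule exI[of _ "r / 3"], rule exI[of _ "s / 3"])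
       (use * in \<open>simp add: of_rat_divide field_simps\<close>)
qed

text \<open>The third entry is scaled so that both factors have the same rational span in the
  arguments and \<open>G\<close> acts by scalars between them.\<close>

definition vec4 :: "complex \<Rightarrow> complex \<Rightarrow> complex \<Rightarrow> complex \<Rightarrow> complex^4" where
  "vec4 x1 x2 x3 x4 = vector [x1, x2, 3 * x3, x4]"

lemma vec4_nth:
  "vec4 x1 x2 x3 x4 $ 1 = x1" "vec4 x1 x2 x3 x4 $ 2 = x2" "vec4 x1 x2 x3 x4 $ 3 = 3 * x3"
  "vec4 x1 x2 x3 x4 $ 4 = x4"
  by (simp_all add: vec4_def vector_4')

lemma vec4_eta: "vec4 (v $ 1) (v $ 2) (v $ 3 / 3) (v $ 4) = v"
  by (simp add: vec_eq_iff forall_4 vec4_nth)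

lemma vec4_in_lattice:
  fixes p q p' q' r s r' s' :: int
  assumes "x1 = a * of_int p + b * of_int q + of_int r"
    "x2 = b * of_int p + c * of_int q + 3 * of_int s"
    "3 * x3 = 3 * a * of_int p' + b * of_int q' + 3 * of_int r'"
    "x4 = b * of_int p' + c / 3 * of_int q' + of_int s'"
  shows "vec4 x1 x2 x3 x4 \<in> \<Lambda>"
  unfolding mem_lattice_A vec4_nth using assms by blast

text \<open>Here \<open>u\<close> and \<open>v\<close> are the basis vectors of one factor, and
  \<open>a *s u + b *s v\<close> is the period given by the first column of \<open>Z\<close>. The
  scalars \<open>q\<close> and \<open>q'\<close> describe the components of \<open>G\<close> in the
  two factors.\<close>

lemma scalar_on_pair:
  assumes alg: "alg_independent3 a b c"
    and Gadd: "\<And>u v. G (u + v) = G u + G v" and Gscale: "\<And>k v. G (k *s v) = k *s G v"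
    and G: "\<And>v. v \<in> \<Lambda> \<Longrightarrow> G v \<in> \<Lambda>"
    and "u \<in> \<Lambda>" "3 *s v \<in> \<Lambda>" "a *s u + b *s v \<in> \<Lambda>"
  obtains q q' where "G u $ 1 = of_rat q" "G u $ 2 = 0" "G u $ 3 = 3 * of_rat q'" "G u $ 4 = 0"
    "G v $ 1 = 0" "G v $ 2 = of_rat q" "G v $ 3 = 0" "G v $ 4 = of_rat q'"
proof -
  note 1 = rational_span_lattice[OF G[OF assms(5)]]
  have "rational_span a b c (3 * (G v $ 1)) (3 * (G v $ 2))"
    "rational_span a b c (3 * (G v $ 3 / 3)) (3 * (G v $ 4))"
    using rational_span_lattice[OF G[OF assms(6)]] by (simp_all add: Gscale)
  note 2 = this[THEN rational_span_third]
  have 3: "rational_span a b c (a * (G u $ 1) + b * (G v $ 1)) (a * (G u $ 2) + b * (G v $ 2))"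
    "rational_span a b c (a * (G u $ 3 / 3) + b * (G v $ 3 / 3)) (a * (G u $ 4) + b * (G v $ 4))"
    using rational_span_lattice[OF G[OF assms(7)]] by (simp_all add: Gadd Gscale add_divide_distrib)
  obtain q where "G u $ 1 = of_rat q" "G v $ 2 = of_rat q" "G v $ 1 = 0" "G u $ 2 = 0"
    using rational_endomorphism_scalar[OF alg 1(1) 2(1) 3(1)] by blast
  moreover obtain q' where "G u $ 3 / 3 = of_rat q'" "G v $ 4 = of_rat q'" "G v $ 3 / 3 = 0" "G u $ 4 = 0"
    using rational_endomorphism_scalar[OF alg 1(2) 2(2) 3(2)] by blast
  ultimately show ?thesis by (intro that[of q q']) (simp_all add: field_simps)
qed

lemma rational_constant_term:
  assumes "alg_independent3 a b c" "of_rat ka * a + of_rat kb * b + of_rat kc * c + of_rat k0 = 0"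
  shows "k0 = 0"
  using alg_independent3_quadratic[OF assms(1), of k0 ka kb kc 0 0 0 0 0 0] assms(2)
  by (simp add: algebra_simps)

lemma no_principal_polarisation:
  assumes alg: "alg_independent3 a b c"
  shows "\<not> admits_principal_polarisation \<Lambda>"
proof
  assume pol: "admits_principal_polarisation \<Lambda>"
  obtain \<delta> where \<delta>: "\<delta> > 0" "\<And>v. v \<in> \<Lambda> \<Longrightarrow> norm v < \<delta> \<Longrightarrow> v = 0" using lattice_discrete by blast
  obtain \<epsilon> where \<epsilon>: "\<epsilon> > 0" "\<And>w. w \<in> dual_lattice \<Lambda> \<Longrightarrow> norm w < \<epsilon> \<Longrightarrow> w = 0"
    using dual_discrete by blast
  obtain F where Fadd: "\<And>u v. F (u + v) = F u + F v" and Fscale: "\<And>c v. F (c *s v) = c *s F v"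
    and image: "F ` \<Lambda> = dual_lattice \<Lambda>"
    and antisym: "\<And>\<gamma> \<delta>. \<gamma> \<in> \<Lambda> \<Longrightarrow> \<delta> \<in> \<Lambda> \<Longrightarrow> Im (anti_pairing (F \<delta>) \<gamma>) = - Im (anti_pairing (F \<gamma>) \<delta>)"
    and nonneg: "\<And>\<gamma>. \<gamma> \<in> \<Lambda> \<Longrightarrow> Re (anti_pairing (F \<gamma>) \<gamma>) \<ge> 0"
    by (rule principal_polarisation_map[OF add_subgroup_column_lattice
          column_lattice_cocompact[OF lattice_spans] \<delta>(1) _ \<epsilon>(1) _ pol])
       (rule \<delta>(2), assumption, assumption, rule \<epsilon>(2), assumption, assumption, (rule that; assumption))
  \<comment> \<open>Followed by the isomorphism from the dual back to \<open>A\<close>, the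
    polarisation becomes a bijective endomorphism of \<open>\<Lambda>\<close>, to which the
    rationality results apply.\<close>
  define G where "G v = dual_to_lattice *v F v" for v
  have Gadd: "G (u + v) = G u + G v" and Gscale: "G (k *s v) = k *s G v" for u v k
    by (simp_all add: G_def Fadd Fscale matrix_vector_right_distrib vector_scalar_commute)
  have G: "G v \<in> \<Lambda>" if "v \<in> \<Lambda>" for v
    using that image unfolding G_def mem_dual_lattice_A[symmetric] by blast
  have surj: "\<exists>v\<in>\<Lambda>. G v = u" if "u \<in> \<Lambda>" for u
  proof -
    have "lattice_to_dual *v u \<in> F ` \<Lambda>"
      using that unfolding image image_lattice_to_dual[symmetric] by blast
    then obtain v where "v \<in> \<Lambda>" "F v = lattice_to_dual *v u" by (elim imageE) simp
    then show ?thesis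
      by (intro bexI[of _ v]) (simp_all add: G_def matrix_vector_mul_assoc dual_to_lattice_inverse)
  qed
  let ?e1 = "vec4 1 0 0 0" and ?e2 = "vec4 0 1 0 0" and ?e3 = "vec4 0 0 1 0" and ?e4 = "vec4 0 0 0 1"
  have e1: "?e1 \<in> \<Lambda>" by (rule vec4_in_lattice[of _ 0 0 1 _ 0 _ 0 0 0 _ 0]) auto
  have e2: "3 *s ?e2 \<in> \<Lambda>"
  proof -
    have "3 *s ?e2 = vec4 0 3 0 0" by (simp add: vec_eq_iff forall_4 vec4_nth)
    also have "\<dots> \<in> \<Lambda>" by (rule vec4_in_lattice[of _ 0 0 0 _ 1 _ 0 0 0 _ 0]) auto
    finally show ?thesis .
  qed
  have e3: "?e3 \<in> \<Lambda>" by (rule vec4_in_lattice[of _ 0 0 0 _ 0 _ 0 0 1 _ 0]) auto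
  have e4: "?e4 \<in> \<Lambda>" by (rule vec4_in_lattice[of _ 0 0 0 _ 0 _ 0 0 0 _ 1]) auto
  have e4': "3 *s ?e4 \<in> \<Lambda>"
  proof -
    have "3 *s ?e4 = vec4 0 0 0 3" by (simp add: vec_eq_iff forall_4 vec4_nth)
    also have "\<dots> \<in> \<Lambda>" by (rule vec4_in_lattice[of _ 0 0 0 _ 0 _ 0 0 0 _ 3]) auto
    finally show ?thesis .
  qed
  have f1: "a *s ?e1 + b *s ?e2 \<in> \<Lambda>"
  proof -
    have "a *s ?e1 + b *s ?e2 = vec4 a b 0 0" by (simp add: vec_eq_iff forall_4 vec4_nth)
    also have "\<dots> \<in> \<Lambda>" by (rule vec4_in_lattice[of _ 1 0 0 _ 0 _ 0 0 0 _ 0]) auto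
    finally show ?thesis .
  qed
  have f2_eq: "a *s ?e3 + b *s ?e4 = vec4 0 0 a b" by (simp add: vec_eq_iff forall_4 vec4_nth)
  have f2: "vec4 0 0 a b \<in> \<Lambda>" by (rule vec4_in_lattice[of _ 0 0 0 _ 0 _ 1 0 0 _ 0]) auto
  obtain z x where zx: "G ?e1 $ 1 = of_rat z" "G ?e1 $ 2 = 0" "G ?e1 $ 3 = 3 * of_rat x" "G ?e1 $ 4 = 0"
    "G ?e2 $ 1 = 0" "G ?e2 $ 2 = of_rat z" "G ?e2 $ 3 = 0" "G ?e2 $ 4 = of_rat x"
    by (rule scalar_on_pair[of G, OF alg Gadd Gscale _ e1 e2 f1]) (rule G, assumption, (rule that; assumption))
  obtain t y where ty: "G ?e3 $ 1 = of_rat t" "G ?e3 $ 2 = 0" "G ?e3 $ 3 = 3 * of_rat y" "G ?e3 $ 4 = 0"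
    "G ?e4 $ 1 = 0" "G ?e4 $ 2 = of_rat t" "G ?e4 $ 3 = 0" "G ?e4 $ 4 = of_rat y"
    by (rule scalar_on_pair[of G, OF alg Gadd Gscale _ e3 e4' f2[folded f2_eq]])
       (rule G, assumption, (rule that; assumption))
  have G_vec4: "G (vec4 x1 x2 x3 x4) $ 1 = of_rat z * x1 + of_rat t * x3"
    "G (vec4 x1 x2 x3 x4) $ 2 = of_rat z * x2 + of_rat t * x4"
    "G (vec4 x1 x2 x3 x4) $ 3 = 3 * (of_rat x * x1 + of_rat y * x3)"
    "G (vec4 x1 x2 x3 x4) $ 4 = of_rat x * x2 + of_rat y * x4" for x1 x2 x3 x4
  proof -
    have "vec4 x1 x2 x3 x4 = x1 *s ?e1 + x2 *s ?e2 + x3 *s ?e3 + x4 *s ?e4"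
      by (simp add: vec_eq_iff forall_4 vec4_nth)
    then have "G (vec4 x1 x2 x3 x4) = x1 *s G ?e1 + x2 *s G ?e2 + x3 *s G ?e3 + x4 *s G ?e4"
      by (simp only: Gadd Gscale)
    then show "G (vec4 x1 x2 x3 x4) $ 1 = of_rat z * x1 + of_rat t * x3"
      "G (vec4 x1 x2 x3 x4) $ 2 = of_rat z * x2 + of_rat t * x4"
      "G (vec4 x1 x2 x3 x4) $ 3 = 3 * (of_rat x * x1 + of_rat y * x3)"
      "G (vec4 x1 x2 x3 x4) $ 4 = of_rat x * x2 + of_rat y * x4"
      by (simp_all add: zx ty algebra_simps)
  qed
  have integral: "\<exists>r r' :: int. k = of_int r \<and> k' = of_int r'"
    if v: "v \<in> \<Lambda>" and k: "G v $ 1 = of_rat k" "G v $ 3 = 3 * of_rat k'" for v k k'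
  proof -
    obtain p q p' q' r r' :: int where *: "of_rat k = a * of_int p + b * of_int q + of_int r"
      "3 * of_rat k' = 3 * a * of_int p' + b * of_int q' + 3 * of_int r'"
      using G[OF v] unfolding mem_lattice_A k by blast
    have "of_int r - k = 0"
      by (rule rational_constant_term[OF alg, of "of_int p" "of_int q" 0])
         (use *(1) in \<open>simp add: of_rat_diff algebra_simps\<close>)
    moreover have "of_int r' - k' = 0"
      by (rule rational_constant_term[OF alg, of "of_int p'" "of_int q' / 3" 0])
         (use *(2) in \<open>simp add: of_rat_diff of_rat_divide field_simps\<close>)
    ultimately show ?thesis by (intro exI[of _ r] exI[of _ r']) simp
  qed
  obtain Z X :: int where ZX: "z = of_int Z" "x = of_int X"
    using integral[OF e1 zx(1,3)] by blast
  obtain T Y :: int where TY: "t = of_int T" "y = of_int Y"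
    using integral[OF e3 ty(1,3)] by blast
  \<comment> \<open>\<open>?e4\<close> is a period, and its image has second coordinate
    \<open>t\<close>; constant terms there are multiples of 3. This is the source of the congruence
    modulo 3.\<close>
  obtain s :: int where s: "T = 3 * s"
  proof -
    obtain p q s :: int where "of_rat t = b * of_int p + c * of_int q + 3 * of_int s"
      using G[OF e4] unfolding mem_lattice_A ty by blast
    then have "3 * of_int s - t = 0"
      by (intro rational_constant_term[OF alg, of 0 "of_int p" "of_int q"])
         (simp add: of_rat_diff of_rat_mult algebra_simps)
    then have "of_int (3 * s) = (of_int T :: rat)" by (simp add: TY)
    then have "T = 3 * s" unfolding of_int_eq_iff ..
    with that show thesis .
  qed
  \<comment> \<open>The constant terms of a preimage are integers on which \<open>G\<close> acts by
    the same 2 by 2 matrix. Solving for both unit vectors makes this matrix invertible over the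
    integers.\<close>
  have preimage: "\<exists>r r' :: int. Z * r + T * r' = m \<and> X * r + Y * r' = n"
    if mn: "vec4 (of_int m) 0 (of_int n) 0 \<in> \<Lambda>" for m n
  proof -
    obtain v where v: "v \<in> \<Lambda>" "G v = vec4 (of_int m) 0 (of_int n) 0" using surj[OF mn] by blast
    obtain p q p' q' r r' :: int where c: "v $ 1 = a * of_int p + b * of_int q + of_int r"
      "v $ 3 = 3 * a * of_int p' + b * of_int q' + 3 * of_int r'"
      using v(1) unfolding mem_lattice_A by blast
    have c3: "v $ 3 / 3 = a * of_int p' + b * of_int q' / 3 + of_int r'" by (simp add: c field_simps)
    have 1: "of_int m = of_rat z * v $ 1 + of_rat t * (v $ 3 / 3)"
      using G_vec4(1)[of "v $ 1" "v $ 2" "v $ 3 / 3" "v $ 4"] unfolding vec4_eta v(2) vec4_nth .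
    have 3: "of_int n = of_rat x * v $ 1 + of_rat y * (v $ 3 / 3)"
      using G_vec4(3)[of "v $ 1" "v $ 2" "v $ 3 / 3" "v $ 4"]
      unfolding vec4_eta v(2) vec4_nth mult_cancel_left by simp
    have "of_int (Z * r + T * r' - m) = (0 :: rat)"
      by (rule rational_constant_term[OF alg, of "of_int (Z * p + T * p')" "of_int Z * of_int q + of_int T * (of_int q' / 3)" 0])
         (use 1 in \<open>simp add: c(1) c3 ZX TY of_rat_add of_rat_mult of_rat_divide of_rat_diff algebra_simps\<close>)
    moreover have "of_int (X * r + Y * r' - n) = (0 :: rat)"
      by (rule rational_constant_term[OF alg, of "of_int (X * p + Y * p')" "of_int X * of_int q + of_int Y * (of_int q' / 3)" 0])
         (use 3 in \<open>simp add: c(1) c3 ZX TY of_rat_add of_rat_mult of_rat_divide of_rat_diff algebra_simps\<close>)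
    ultimately have "Z * r + T * r' - m = 0" "X * r + Y * r' - n = 0" unfolding of_int_eq_0_iff by blast+
    then show ?thesis by (intro exI[of _ r] exI[of _ r']) simp
  qed
  obtain r r' where r: "Z * r + T * r' = 1" "X * r + Y * r' = 0" using preimage[of 1 0] e1 by auto
  obtain u u' where u: "Z * u + T * u' = 0" "X * u + Y * u' = 1" using preimage[of 0 1] e3 by auto
  have "(Z * Y - T * X) * (r * u' - r' * u) =
      (Z * r + T * r') * (X * u + Y * u') - (X * r + Y * r') * (Z * u + T * u')"
    by (simp add: algebra_simps)
  then have det: "(Z * Y - T * X) * (r * u' - r' * u) = 1" by (simp only: r u)
  have F_vec4: "of_real (Im a) * F (vec4 x1 x2 x3 x4) $ 1 + of_real (Im b) * F (vec4 x1 x2 x3 x4) $ 2 =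
      of_int X * x1 + of_int Y * x3"
    "of_real (Im b) * F (vec4 x1 x2 x3 x4) $ 1 + of_real (Im c) * F (vec4 x1 x2 x3 x4) $ 2 =
      of_int X * x2 + of_int Y * x4"
    "of_real (Im a) * (3 * F (vec4 x1 x2 x3 x4) $ 3) + of_real (Im b) * F (vec4 x1 x2 x3 x4) $ 4 =
      of_int Z * x1 + of_int T * x3"
    "of_real (Im b) * (3 * F (vec4 x1 x2 x3 x4) $ 3) + of_real (Im c) * F (vec4 x1 x2 x3 x4) $ 4 =
      of_int Z * x2 + of_int T * x4" for x1 x2 x3 x4
    using G_vec4[of x1 x2 x3 x4] unfolding G_def dual_to_lattice_nth ZX TY of_rat_of_int_eq mult_cancel_left by simp_all
  \<comment> \<open>The pair of periods is chosen so that each pairing reduces to a single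
    coefficient: \<open>?e1\<close> and the column \<open>(a, b)\<close> in the second
    factor.\<close>
  have "Y = Z"
  proof -
    have 1: "Im (F (vec4 0 0 a b) $ 1) = of_int Y \<and> Im (F (vec4 0 0 a b) $ 2) = 0 \<and>
        Im (F (vec4 0 0 a b) $ 1 * cnj a + F (vec4 0 0 a b) $ 2 * cnj b) = - 0 \<and>
        Im (F (vec4 0 0 a b) $ 1 * cnj b + F (vec4 0 0 a b) $ 2 * cnj c) = - 0"
      by (rule dual_coordinates[THEN iffD2]) (use F_vec4(1,2)[of 0 0 a b] in simp)
    have 2: "Im (3 * F ?e1 $ 3) = 0 \<and> Im (F ?e1 $ 4) = 0 \<and>
        Im (3 * F ?e1 $ 3 * cnj a + F ?e1 $ 4 * cnj b) = - of_int Z \<and>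
        Im (3 * F ?e1 $ 3 * cnj b + F ?e1 $ 4 * cnj c) = - 0"
      by (rule dual_coordinates[THEN iffD2]) (use F_vec4(3,4)[of 1 0 0 0] in simp)
    have 3: "anti_pairing (F (vec4 0 0 a b)) ?e1 = F (vec4 0 0 a b) $ 1"
      "anti_pairing (F ?e1) (vec4 0 0 a b) = 3 * F ?e1 $ 3 * cnj a + F ?e1 $ 4 * cnj b"
      by (simp_all add: anti_pairing_def sum_4 vec4_nth)
    have "real_of_int Y = - (- of_int Z)"
      using antisym[OF e1 f2] unfolding 3 1[THEN conjunct1]
        2[THEN conjunct2, THEN conjunct2, THEN conjunct1] .
    then show ?thesis by simp
  qed
  have form: "X * (m * m) + 2 * Y * (m * n) + T * (n * n) \<ge> 0" for m n
  proof -
    define g where "g = vec4 (of_int m) 0 (of_int n) 0"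
    have g: "g \<in> \<Lambda>" unfolding g_def by (rule vec4_in_lattice[of _ 0 0 m _ 0 _ 0 0 n _ 0]) auto
    \<comment> \<open>Cramer's rule for the matrix \<open>Im Z\<close>; it makes the Hermitian form
      on these vectors \<open>Im c / D\<close> times the integral form.\<close>
    have D: "of_real D * w1 = of_real (Im c) * k"
      if "of_real (Im a) * w1 + of_real (Im b) * w2 = k" "of_real (Im b) * w1 + of_real (Im c) * w2 = 0"
      for w1 w2 k :: complex
    proof -
      have "of_real D * w1 = of_real (Im c) * (of_real (Im a) * w1 + of_real (Im b) * w2) -
          of_real (Im b) * (of_real (Im b) * w1 + of_real (Im c) * w2)"
        by (simp add: D_def algebra_simps)
      then show ?thesis unfolding that by simp
    qed
    have 1: "of_real D * F g $ 1 = of_real (Im c) * (of_int X * of_int m + of_int Y * of_int n)"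
      by (rule D) (use F_vec4(1,2)[of "of_int m" 0 "of_int n" 0] in \<open>simp_all add: g_def\<close>)
    have 3: "of_real D * (3 * F g $ 3) = of_real (Im c) * (of_int Z * of_int m + of_int T * of_int n)"
      by (rule D) (use F_vec4(3,4)[of "of_int m" 0 "of_int n" 0] in \<open>simp_all add: g_def\<close>)
    have "anti_pairing (F g) g = F g $ 1 * of_int m + (3 * F g $ 3) * of_int n"
      by (simp add: anti_pairing_def sum_4 vec4_nth g_def)
    then have "of_real D * anti_pairing (F g) g =
        (of_real D * F g $ 1) * of_int m + (of_real D * (3 * F g $ 3)) * of_int n"
      by (simp add: algebra_simps)
    also have "\<dots> = of_real (Im c * of_int (X * (m * m) + 2 * Y * (m * n) + T * (n * n)))"
      unfolding 1 3 \<open>Y = Z\<close> by (simp add: algebra_simps)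
    finally have "Re (of_real D * anti_pairing (F g) g) =
        Im c * of_int (X * (m * m) + 2 * Y * (m * n) + T * (n * n))"
      by (metis Re_complex_of_real)
    moreover have "Re (of_real D * anti_pairing (F g) g) \<ge> 0"
      using nonneg[OF g] D_pos by simp
    ultimately have "0 \<le> Im c * of_int (X * (m * m) + 2 * Y * (m * n) + T * (n * n))" by linarith
    then have "0 \<le> real_of_int (X * (m * m) + 2 * Y * (m * n) + T * (n * n))"
      using Im_c_pos by (simp only: zero_le_mult_iff) linarith
    then show ?thesis unfolding of_int_0_le_iff .
  qed
  show False
    by (rule unimodular_form_indefinite[OF det[folded \<open>Y = Z\<close>] s form])
qed

end

theorem mainTheorem3:
  fixes a b c :: complex
  assumes "alg_independent3 a b c"
    and "pos_def_matrix (map_matrix Im (matrix_Z a b c))"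
  shows "tori_isomorphic (column_lattice (matrix_A a b c))
           (dual_lattice (column_lattice (matrix_A a b c))) \<and>
         \<not> admits_principal_polarisation (column_lattice (matrix_A a b c))"
proof -
  interpret period_matrix a b c by unfold_locales (rule assms(2))
  show ?thesis using isomorphic_dual no_principal_polarisation[OF assms(1)] by blast
qed

end
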